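(* Assume the standing assumptions, $\alpha_0=0$, and that $(\alpha_n)$ is generic. Let $q$ be the charge associated with the initial datum $\Psi_0=\varphi_{\alpha(0)}$. Then there are constants $A\in\mathbb R$, $C$, $B>0$ such that, as $t\to\infty$, $|q(t)|\le A\,t^{-3/2}+R(t)$ with $R(t)\sim Ce^{-Bt}$.
   Context: Let $H_0=-\Delta$ on $L^2(\mathbb R^3)$, $U_0(t)=e^{-iH_0t}$ with kernel $U_0(t;\vec x)=(4\pi it)^{-3/2}e^{i|\vec x|^2/(4t)}$. For $\lambda>0$, $\mathcal G^\lambda(\vec x)=e^{-\sqrt\lambda|\vec x|}/(4\pi|\vec x|)$. For $a\in\mathbb R$, $H_a$ is the point interaction at the origin of strength $a$: domain $\{\Psi\in L^2(\mathbb R^3):\exists q\in\mathbb C,\ \Psi-q\mathcal G^\lambda\in H^2(\mathbb R^3),\ (\Psi-q\mathcal G^\lambda)(0)=(a+\sqrt\lambda/(4\pi))q\}$, $(H_a+\lambda)\Psi=(H_0+\lambda)(\Psi-q\mathcal G^\lambda)$. For $a<0$, $H_a$ has the unique eigenvalue $-(4\pi a)^2$ with normalized eigenfunction $\varphi_a(\vec x)=\sqrt{2|a|}e^{4\pi a|\vec x|}/|\vec x|$. Standing assumptions: $\alpha:\mathbb R\to\mathbb R$ continuous and $T$-periodic, $\omega=2\pi/T$, $\alpha(t)=\sum_n\alpha_ne^{-in\omega t}$, $(\alpha_n)\in\ell^1(\mathbb Z)$, $\alpha_n=\overline{\alpha_{-n}}$, $\alpha(0)<0$. Dynamics: $H_{\alpha(t)}$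 generates a unitary propagator $U(t,s)$; for initial datum $\Psi_0$, $\Psi_t=U(t,0)\Psi_0=U_0(t)\Psi_0+i\int_0^tq(\tau)U_0(t-\tau;\cdot)d\tau$, where the charge $q$ is the unique solution of $q(t)+4\sqrt{\pi i}\int_0^t\frac{\alpha(\tau)q(\tau)}{\sqrt{t-\tau}}d\tau=4\sqrt{\pi i}\int_0^t\frac{(U_0(\tau)\Psi_0)(0)}{\sqrt{t-\tau}}d\tau$. Principal branch of square roots. Genericity: with $\tilde\alpha=(\alpha_1,\alpha_2,\dots)\in\ell^1(\mathbb N)$ and the shift $(\mathcal Ta)_n=a_{n+1}$ on $\ell^1(\mathbb N)$, $(\alpha_n)$ is generic if $e_1=(1,0,0,\dots)$ lies in the $\ell^1(\mathbb N)$-closure of the linear span of $\{\mathcal T^n\tilde\alpha:n\ge0\}$. *)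

theory Defs
  imports "HOL-Analysis.Analysis" "HOL-Library.Landau_Symbols"
begin

text \<open>Free Schroedinger kernel on R^3:
  U0(t; x) = (4 pi i t)^(-3/2) exp(i |x|^2 / (4 t)), principal branch:
  z^(-3/2) = 1 / (csqrt z)^3.\<close>
definition U0_kernel :: "real \<Rightarrow> real^3 \<Rightarrow> complex" where
  "U0_kernel t x = exp (\<i> * complex_of_real ((norm x)\<^sup>2 / (4 * t)))
                    / (csqrt (4 * pi * \<i> * complex_of_real t)) ^ 3"

definition U0_at_origin :: "real \<Rightarrow> (real^3 \<Rightarrow> complex) \<Rightarrow> complex" where
  "U0_at_origin t \<Psi> = (LINT y|lborel. U0_kernel t (- y) * \<Psi> y)"

text \<open>Normalized eigenfunction of H_a for a < 0.\<close>
definition phi_ev :: "real \<Rightarrow> real^3 \<Rightarrow> complex" where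
  "phi_ev a x = complex_of_real (sqrt (2 * \<bar>a\<bar>) * exp (4 * pi * a * norm x) / norm x)"

definition standing_assumptions ::
  "(real \<Rightarrow> real) \<Rightarrow> real \<Rightarrow> (int \<Rightarrow> complex) \<Rightarrow> bool" where
  "standing_assumptions \<alpha> T c \<longleftrightarrow>
     T > 0 \<and> continuous_on UNIV \<alpha> \<and> (\<forall>t. \<alpha> (t + T) = \<alpha> t) \<and>
     (\<lambda>n. norm (c n)) summable_on UNIV \<and>
     (\<forall>n. c n = cnj (c (- n))) \<and>
     (\<forall>t. complex_of_real (\<alpha> t) =
          infsum (\<lambda>n. c n * exp (- \<i> * of_int n * complex_of_real (2 * pi / T) * complex_of_real t)) UNIV) \<and>
     \<alpha> 0 < 0"

text \<open>Genericity: e_1 lies in the l^1(N)-closure of span{ T^n alpha~ : n >= 0 },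
  where alpha~_k = c (k+1) (k = 0,1,...), (T^j alpha~)_k = c (k+j+1), and e_1 = (1,0,0,...).\<close>
definition generic :: "(int \<Rightarrow> complex) \<Rightarrow> bool" where
  "generic c \<longleftrightarrow>
     (\<forall>\<epsilon>>0. \<exists>N::nat. \<exists>d::nat \<Rightarrow> complex.
        (\<Sum>k. norm ((if k = 0 then 1 else 0)
                      - (\<Sum>j<N. d j * c (int k + int j + 1)))) < \<epsilon>)"

text \<open>The charge equation (for t > 0) with datum function F(tau) = (U0(tau) Psi0)(0).\<close>
definition charge_eq :: "(real \<Rightarrow> real) \<Rightarrow> (real \<Rightarrow> complex) \<Rightarrow> (real \<Rightarrow> complex) \<Rightarrow> bool" where
  "charge_eq \<alpha> F q \<longleftrightarrow>
     (\<forall>t>0. q t + 4 * csqrt (pi * \<i>) *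
              integral {0..t} (\<lambda>\<tau>. complex_of_real (\<alpha> \<tau>) * q \<tau> / complex_of_real (sqrt (t - \<tau>)))
            = 4 * csqrt (pi * \<i>) *
              integral {0..t} (\<lambda>\<tau>. F \<tau> / complex_of_real (sqrt (t - \<tau>))))"

end

theory Submission
  imports Defs "HOL-Probability.Probability" "HOL-Real_Asymp.Real_Asymp"
begin

text \<open>
  It suffices to show \<open>q(t) = O(t\<^sup>-\<^sup>3\<^sup>/\<^sup>2)\<close>, since \<open>R(t) = exp (-t)\<close> is then admissible.

  Multiplication by \<open>\<alpha>\<close> shifts the Laplace variable by multiples of \<open>i\<omega>\<close>, so on the points
  \<open>p\<^sub>n = p + in\<omega>\<close> the charge equation becomes the linear system
  \<open>\<surd>p\<^sub>n Q\<^sub>n + 4\<pi>\<surd>i \<Sum>\<^sub>k \<alpha>\<^sub>k Q\<^sub>n\<^sub>+\<^sub>k = \<dots>\<close>. On the closed half plane its kernel is trivial: the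
  energy identity forces \<open>Q\<^sub>n = 0\<close> for all \<open>n\<close> in a half line, and genericity propagates this to all
  \<open>n\<close>. A compactness argument turns injectivity into an a priori bound that is uniform up to the
  imaginary axis.

  Applied to all moments \<open>\<integral> t\<^sup>m/m! q(t) exp (-pt) dt\<close>, the bound produces estimates of the form
  \<open>K\<^sup>m |p|\<^sup>1\<^sup>/\<^sup>2\<^sup>-\<^sup>m\<close>; the free datum, a Laplace transform in the spectral parameter, satisfies the
  same estimates. Split the Abel kernel \<open>t\<^sup>-\<^sup>1\<^sup>/\<^sup>2\<close> into an exponentially damped part and a rest. The
  damped part is absorbed by a Gronwall argument with weights; the contribution of the rest has an
  integrable Laplace transform along vertical lines and is recovered pointwise by Fourier inversion.
  Summing the moment bounds over \<open>m\<close> lowers any positive exponential growth rate of \<open>q\<close>, hence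
  every positive rate is admissible; then the second moment on the line \<open>Re p = 1/t\<close> gives the
  rate \<open>t\<^sup>-\<^sup>3\<^sup>/\<^sup>2\<close>.
\<close>

section \<open>Fourier inversion bound\<close>

text \<open>The rate is that of a square root singularity: the moment bounds are those of a function
  of sqrt p, whose m-th derivative has size |p|^(1/2-m). For m = 2 this is integrable over Re p =
  \<sigma>, with integral of order \<sigma>^(-1/2); division by t^2 at \<sigma> = 1/t leaves
  t^(-3/2). Two obstacles shape the argument. The equations for the transforms hold only to the
  right of a growth rate of \<open>q\<close>, which at first is merely finite, and no analytic
  continuation leads further left. Instead the constants depend on an upper bound for Re p and never
  on the rate, so the bounds for all m together act like a radius of convergence that reaches beyond
  the known rate. Moreover the a priori bound is a supremum over the lattice without decay in n, too
  weak for integrability of the transform of \<open>q\<close> on vertical lines. The difference of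
  the transforms of the undamped and the damped Abel kernel supplies a factor |p_n|^(-3/2); the
  damped kernel needs no transform, since its total mass is small for strong damping.\<close>

lemma integrable_lborel_prod_mult:
  fixes f g :: "real \<Rightarrow> complex"
  assumes f: "integrable lborel f" and g: "integrable lborel g"
  shows "integrable (lborel \<Otimes>\<^sub>M lborel) (\<lambda>(x, y). f x * g y)"
proof (rule lborel_pair.Fubini_integrable)
  show "AE x in lborel. integrable lborel (\<lambda>y. case (x, y) of (x, y) \<Rightarrow> f x * g y)"
    using g by simp
  show "integrable lborel (\<lambda>x. LINT y|lborel. norm (case (x, y) of (x, y) \<Rightarrow> f x * g y))"
    using f by (simp add: norm_mult)
qed (use f g in measurable)

text \<open>The Gaussian reproduces itself under the Fourier transform; this is the characteristic
  function of the normal distribution read backwards. It turns Gaussian averages in time into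
  Gaussian weights in frequency.\<close>

lemma std_normal_density_fourier:
  "complex_of_real (std_normal_density x) =
     (LINT s|lborel. std_normal_density s *\<^sub>R iexp (- (x * s))) / of_real (sqrt (2 * pi))"
proof -
  have "(LINT s|lborel. std_normal_density s *\<^sub>R iexp (- (x * s)))
      = (LINT s|std_normal_distribution. iexp (- x * s))"
    by (subst integral_density) auto
  also have "\<dots> = char std_normal_distribution (- x)" by (simp add: char_def)
  also have "\<dots> = of_real (exp (- (x\<^sup>2) / 2))" by (simp add: char_std_normal_distribution)
  finally show ?thesis by (simp add: std_normal_density_def)
qed

text \<open>Only a bound is wanted from Fourier inversion, so no limit is taken on the frequency
  side. A Gaussian average of \<open>h\<close> around \<open>t0\<close> equals, by Fubini, a
  frequency integral against a Gaussian weight. That weight never exceeds its peak, so the average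
  is at most \<open>K / (2 * pi)\<close> at every width. Letting the width shrink uses only
  continuity and boundedness of \<open>h\<close>.\<close>

lemma norm_le_integral_fourier:
  fixes h :: "real \<Rightarrow> complex"
  assumes cont: "continuous_on UNIV h" and h: "integrable lborel h" and B: "\<And>t. norm (h t) \<le> B"
    and K: "(\<integral>\<^sup>+s. ennreal (norm (LINT t|lborel. h t * iexp (- (s * t)))) \<partial>lborel) \<le> ennreal K" "0 \<le> K"
  shows "norm (h t0) \<le> K / (2 * pi)"
proof -
  define H where "H s = (LINT t|lborel. h t * iexp (- (s * t)))" for s
  have hm [measurable]: "h \<in> borel_measurable borel" using h by simp
  have Hm [measurable]: "H \<in> borel_measurable borel"
    unfolding H_def by measurable
  \<comment> \<open>\<open>e\<close> is the width of the Gaussian and \<open>t0\<close> its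
    centre.\<close>
  define G where "G e = (LINT x|lborel. std_normal_density x *\<^sub>R h (t0 + e * x))" for e
  have bound: "norm (G e) \<le> K / (2 * pi)" if e: "e > 0" for e
  proof -
    have he: "integrable lborel (\<lambda>x. h (t0 + e * x))"
      using h lborel_integrable_real_affine[of h e t0] e by simp
    have nd: "integrable lborel (\<lambda>s. complex_of_real (std_normal_density s))"
      by (intro integrable_of_real) simp
    define f where "f = (\<lambda>x s. h (t0 + e * x) * (of_real (std_normal_density s) * iexp (- (x * s))))"
    have fint: "integrable (lborel \<Otimes>\<^sub>M lborel) (case_prod f)"
    proof (rule Bochner_Integration.integrable_bound)
      show "integrable (lborel \<Otimes>\<^sub>M lborel) (\<lambda>(x, s). h (t0 + e * x) * complex_of_real (std_normal_density s))"
        by (rule integrable_lborel_prod_mult[OF he nd])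
      show "case_prod f \<in> borel_measurable (lborel \<Otimes>\<^sub>M lborel)" unfolding f_def by measurable
    qed (auto simp: f_def norm_mult)
    \<comment> \<open>The substitution t = t0 + e x turns the inner integral into the transform of
      \<open>h\<close> at frequency s / e, up to a phase of modulus one and the factor 1 /
      e.\<close>
    have inner: "(LINT x|lborel. f x s) = of_real (std_normal_density s) * (iexp (s / e * t0) * H (s / e) / of_real e)" for s
    proof -
      have "H (s / e) = e *\<^sub>R (LINT x|lborel. h (t0 + e * x) * iexp (- (s / e * (t0 + e * x))))"
        unfolding H_def using e by (subst lborel_integral_real_affine[of e _ t0]) auto
      also have "\<dots> = e *\<^sub>R (LINT x|lborel. iexp (- (s / e * t0)) * (h (t0 + e * x) * iexp (- (x * s))))"
      proof -
        have "iexp (- (s / e * (t0 + e * x))) = iexp (- (s / e * t0)) * iexp (- (x * s))" for x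
          unfolding exp_add[symmetric] using e by (intro arg_cong[where f = exp]) (simp add: field_simps)
        then show ?thesis by (simp only: mult_ac)
      qed
      finally have "iexp (s / e * t0) * H (s / e) / of_real e
          = (iexp (s / e * t0) * iexp (- (s / e * t0))) * (LINT x|lborel. h (t0 + e * x) * iexp (- (x * s)))"
        using e by (simp add: scaleR_conv_of_real)
      also have "iexp (s / e * t0) * iexp (- (s / e * t0)) = 1" by (simp add: exp_add[symmetric])
      finally show ?thesis unfolding f_def
        by (simp add: mult_ac) 
    qed
    have "G e = (LINT x|lborel. (LINT s|lborel. f x s)) / of_real (sqrt (2 * pi))"
    proof -
      have "(LINT s|lborel. f x s) / of_real (sqrt (2 * pi)) = std_normal_density x *\<^sub>R h (t0 + e * x)" for x
        unfolding scaleR_conv_of_real by (subst std_normal_density_fourier) (simp add: f_def scaleR_conv_of_real)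
      then show ?thesis unfolding G_def by (simp flip: integral_divide_zero)
    qed
    also have "(LINT x|lborel. (LINT s|lborel. f x s)) = (LINT s|lborel. (LINT x|lborel. f x s))"
      using lborel_pair.Fubini_integral[OF fint] by simp
    finally have Ge: "G e = (LINT s|lborel. (LINT x|lborel. f x s)) / of_real (sqrt (2 * pi))" .
    have "integrable lborel (\<lambda>s. LINT x|lborel. f x s)"
      using lborel_pair.integrable_snd[OF fint] by simp
    then have "ennreal (norm (LINT s|lborel. (LINT x|lborel. f x s))) \<le> (\<integral>\<^sup>+s. norm (LINT x|lborel. f x s) \<partial>lborel)"
      by (rule integral_norm_bound_ennreal)
    also have "\<dots> \<le> (\<integral>\<^sup>+s. ennreal (1 / sqrt (2 * pi)) * (ennreal (1 / e) * norm (H (s / e))) \<partial>lborel)"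
    proof (intro nn_integral_mono)
      fix s
      have "norm (LINT x|lborel. f x s) = std_normal_density s * (norm (H (s / e)) / e)"
        unfolding inner using e by (simp add: norm_mult norm_divide)
      also have "\<dots> \<le> 1 / sqrt (2 * pi) * (norm (H (s / e)) / e)"
        using e by (intro mult_right_mono) (auto simp: std_normal_density_def intro!: divide_right_mono)
      finally show "ennreal (norm (LINT x|lborel. f x s))
          \<le> ennreal (1 / sqrt (2 * pi)) * (ennreal (1 / e) * norm (H (s / e)))"
        using e by (simp add: ennreal_mult[symmetric] ennreal_leI)
    qed
    also have "\<dots> = ennreal (1 / sqrt (2 * pi)) * (ennreal (1 / e) * (\<integral>\<^sup>+s. norm (H (s / e)) \<partial>lborel))"
      by (simp add: nn_integral_cmult)
    also have "ennreal (1 / e) * (\<integral>\<^sup>+s. norm (H (s / e)) \<partial>lborel) = (\<integral>\<^sup>+s. norm (H s) \<partial>lborel)"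
      using e by (subst (2) nn_integral_real_affine[of _ "1 / e" 0]) auto
    also have "ennreal (1 / sqrt (2 * pi)) * \<dots> \<le> ennreal (1 / sqrt (2 * pi)) * ennreal K"
      using K(1) by (intro mult_left_mono) (auto simp: H_def)
    finally have "norm (LINT s|lborel. (LINT x|lborel. f x s)) \<le> 1 / sqrt (2 * pi) * K"
      using K(2) by (simp add: ennreal_mult[symmetric])
    then have "norm (G e) \<le> 1 / sqrt (2 * pi) * K / sqrt (2 * pi)"
      unfolding Ge norm_divide norm_of_real using K(2) by (intro frac_le) auto
    then show ?thesis by simp
  qed
  have "(\<lambda>n. G (1 / (real n + 1))) \<longlonglongrightarrow> (LINT x|lborel. std_normal_density x *\<^sub>R h t0)"
    unfolding G_def
  proof (rule integral_dominated_convergence[where w = "\<lambda>x. B * std_normal_density x"])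
    have "(\<lambda>n. 1 / (real n + 1)) \<longlonglongrightarrow> 0"
      using LIMSEQ_inverse_real_of_nat by (simp add: inverse_eq_divide add.commute)
    then have "(\<lambda>n. t0 + 1 / (real n + 1) * x) \<longlonglongrightarrow> t0 + 0 * x" for x
      by (intro tendsto_intros)
    then have "(\<lambda>n. h (t0 + 1 / (real n + 1) * x)) \<longlonglongrightarrow> h t0" for x
      by (intro continuous_on_tendsto_compose[OF cont]) auto
    then show "AE x in lborel. (\<lambda>n. std_normal_density x *\<^sub>R h (t0 + 1 / (real n + 1) * x))
        \<longlonglongrightarrow> std_normal_density x *\<^sub>R h t0"
      by (intro AE_I2 tendsto_scaleR tendsto_const)
    show "AE x in lborel. norm (std_normal_density x *\<^sub>R h (t0 + 1 / (real n + 1) * x))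
        \<le> B * std_normal_density x" for n
    proof (intro AE_I2)
      fix x
      show "norm (std_normal_density x *\<^sub>R h (t0 + 1 / (real n + 1) * x)) \<le> B * std_normal_density x"
        using mult_right_mono[OF B[of "t0 + 1 / (real n + 1) * x"], of "std_normal_density x"]
        by (simp add: mult.commute)
    qed
  qed auto
  also have "(LINT x|lborel. std_normal_density x *\<^sub>R h t0) = h t0"
    by simp
  finally have lim: "(\<lambda>n. G (1 / (real n + 1))) \<longlonglongrightarrow> h t0" .
  show ?thesis
    by (rule LIMSEQ_le_const2[OF tendsto_norm[OF lim]]) (auto intro!: exI[of _ 0] bound)
qed

section \<open>Laplace moments\<close>

lemma has_vector_derivative_iff_quotient:
  fixes f :: "real \<Rightarrow> 'a::real_normed_vector"
  shows "(f has_vector_derivative D) (at x) \<longleftrightarrow> ((\<lambda>y. (f y - f x) /\<^sub>R (y - x)) \<longlongrightarrow> D) (at x)"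
proof -
  have eq: "norm (f y - f x - (y - x) *\<^sub>R D) / norm (y - x) = norm ((f y - f x) /\<^sub>R (y - x) - D)"
    if "y \<noteq> x" for y
  proof -
    have "f y - f x - (y - x) *\<^sub>R D = (y - x) *\<^sub>R ((f y - f x) /\<^sub>R (y - x) - D)"
      using that by (simp add: scaleR_diff_right)
    then show ?thesis using that by simp
  qed
  have "(f has_vector_derivative D) (at x) \<longleftrightarrow>
      ((\<lambda>y. norm (f y - f x - (y - x) *\<^sub>R D) / norm (y - x)) \<longlongrightarrow> 0) (at x)"
    by (simp add: has_vector_derivative_def has_derivative_iff_norm bounded_linear_scaleR_left)
  also have "\<dots> \<longleftrightarrow> ((\<lambda>y. norm ((f y - f x) /\<^sub>R (y - x) - D)) \<longlongrightarrow> 0) (at x)"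
    by (intro filterlim_cong refl) (use eq in \<open>auto simp: eventually_at_filter intro!: always_eventually\<close>)
  also have "\<dots> \<longleftrightarrow> ((\<lambda>y. (f y - f x) /\<^sub>R (y - x)) \<longlongrightarrow> D) (at x)"
    by (simp add: tendsto_norm_zero_iff LIM_zero_iff)
  finally show ?thesis .
qed

text \<open>On the convex set \<open>U\<close> the mean value inequality turns the bound on
  \<open>f'\<close> into a Lipschitz bound with constant \<open>g x\<close>, and this dominates all
  difference quotients at once.\<close>

lemma has_vector_derivative_lebesgue_integral:
  fixes f f' :: "real \<Rightarrow> 'a \<Rightarrow> complex"
  assumes U: "open U" "convex U" "y0 \<in> U"
    and int: "\<And>y. y \<in> U \<Longrightarrow> integrable M (f y)"
    and meas: "f' y0 \<in> borel_measurable M"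
    and deriv: "\<And>x y. x \<in> space M \<Longrightarrow> y \<in> U \<Longrightarrow> ((\<lambda>y. f y x) has_vector_derivative f' y x) (at y)"
    and g: "integrable M g" "\<And>x y. x \<in> space M \<Longrightarrow> y \<in> U \<Longrightarrow> norm (f' y x) \<le> g x"
  shows "((\<lambda>y. LINT x|M. f y x) has_vector_derivative (LINT x|M. f' y0 x)) (at y0)"
proof -
  have lip: "norm (f y x - f y0 x) \<le> g x * norm (y - y0)" if "x \<in> space M" "y \<in> U" for x y
  proof (rule differentiable_bound[OF U(2)])
    show "((\<lambda>y. f y x) has_derivative (\<lambda>h. h *\<^sub>R f' y x)) (at y within U)" if "y \<in> U" for y
      using deriv[OF \<open>x \<in> space M\<close> that] by (simp add: has_vector_derivative_def has_derivative_at_withinI)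
    show "onorm (\<lambda>h. h *\<^sub>R f' y x) \<le> g x" if "y \<in> U" for y
      using g(2)[OF \<open>x \<in> space M\<close> that] by (simp add: onorm_scaleR_left bounded_linear_ident onorm_id)
  qed (use that U in auto)
  have "((\<lambda>y. (LINT x|M. (f y x - f y0 x) /\<^sub>R (y - y0))) \<longlongrightarrow> (LINT x|M. f' y0 x)) (at y0 within U)"
    unfolding tendsto_at_iff_sequentially
  proof (intro allI impI)
    fix X :: "nat \<Rightarrow> real" assume X: "\<forall>i. X i \<in> U - {y0}" "X \<longlonglongrightarrow> y0"
    then have Xat: "filterlim X (at y0) sequentially" by (auto simp: filterlim_at)
    show "((\<lambda>y. (LINT x|M. (f y x - f y0 x) /\<^sub>R (y - y0))) \<circ> X) \<longlonglongrightarrow> (LINT x|M. f' y0 x)"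
      unfolding comp_def
    proof (rule integral_dominated_convergence[where w = g])
      show "f' y0 \<in> borel_measurable M" by (rule meas)
      show "(\<lambda>x. (f (X i) x - f y0 x) /\<^sub>R (X i - y0)) \<in> borel_measurable M" for i
        using int[of "X i"] int[OF U(3)] X(1) by (intro borel_measurable_scaleR borel_measurable_diff) auto
      show "integrable M g" by (rule g)
      show "AE x in M. (\<lambda>i. (f (X i) x - f y0 x) /\<^sub>R (X i - y0)) \<longlonglongrightarrow> f' y0 x"
        using deriv[OF _ U(3)] unfolding has_vector_derivative_iff_quotient
        by (intro AE_I2) (rule filterlim_compose[OF _ Xat], auto)
      show "AE x in M. norm ((f (X i) x - f y0 x) /\<^sub>R (X i - y0)) \<le> g x" for i
      proof (intro AE_I2)
        fix x assume "x \<in> space M"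
        moreover have "0 < \<bar>X i - y0\<bar>" using X(1) by auto
        ultimately show "norm ((f (X i) x - f y0 x) /\<^sub>R (X i - y0)) \<le> g x"
          using lip[of x "X i"] X(1) unfolding norm_scaleR abs_inverse
          by (simp add: divide_inverse_commute[symmetric] pos_divide_le_eq)
      qed
    qed
  qed
  then have "((\<lambda>y. (LINT x|M. (f y x - f y0 x) /\<^sub>R (y - y0))) \<longlongrightarrow> (LINT x|M. f' y0 x)) (at y0)"
    by (simp only: at_within_open[OF U(3) U(1)])
  moreover have "\<forall>\<^sub>F y in at y0. (LINT x|M. (f y x - f y0 x) /\<^sub>R (y - y0))
      = ((LINT x|M. f y x) - (LINT x|M. f y0 x)) /\<^sub>R (y - y0)"
    using eventually_at_in_open'[OF U(1,3)]
    by eventually_elim (use int U(3) in simp)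
  ultimately show ?thesis
    unfolding has_vector_derivative_iff_quotient by (rule Lim_transform_eventually)
qed

lemma FTC_half_line:
  fixes f F :: "real \<Rightarrow> complex"
  assumes "\<And>t. t > 0 \<Longrightarrow> (F has_vector_derivative f t) (at t)"
    and "continuous_on {0<..} f" and "set_integrable lborel {0<..} f"
    and "(F \<longlongrightarrow> A) (at_right 0)" and "(F \<longlongrightarrow> B) at_top"
  shows "(LBINT t:{0<..}. f t) = B - A"
proof -
  have "(LBINT t=0..\<infinity>. f t) = B - A"
  proof (rule interval_integral_FTC_integrable)
    show "((F \<circ> real_of_ereal) \<longlongrightarrow> A) (at_right 0)"
      using assms(4) by (simp add: zero_ereal_def ereal_tendsto_simps1)
    show "((F \<circ> real_of_ereal) \<longlongrightarrow> B) (at_left \<infinity>)"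
      using assms(5) by (simp add: ereal_tendsto_simps1)
    show "isCont f t" if "0 < ereal t" for t
      using assms(2) that by (auto simp: continuous_on_eq_continuous_at)
    show "set_integrable lborel (einterval 0 \<infinity>) f"
      using assms(3) by (simp add: einterval_def greaterThan_def)
  qed (use assms(1) in auto)
  then show ?thesis by (simp add: interval_lebesgue_integral_def einterval_def greaterThan_def)
qed

section \<open>Gamma integrals\<close>

lemma has_bochner_integral_powr_exp:
  fixes x a :: real
  assumes x: "x > 0" and a: "a > 0"
  shows "has_bochner_integral lborel (\<lambda>t. indicator {0<..} t *\<^sub>R (t powr (x - 1) * exp (- (a * t))))
           (Gamma x / a powr x)"
proof (rule has_bochner_integral_nn_integral)
  have "ennreal (Gamma x) = (\<integral>\<^sup>+t. ennreal (indicator {0..} t * t powr (x - 1) / exp t) \<partial>lborel)"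
    by (rule Gamma_conv_nn_integral_real[OF x])
  also have "\<dots> = \<bar>a\<bar> * (\<integral>\<^sup>+t. ennreal (indicator {0..} (0 + a * t) * (0 + a * t) powr (x - 1) / exp (0 + a * t)) \<partial>lborel)"
    using a by (intro nn_integral_real_affine) auto
  also have "\<dots> = ennreal a * (\<integral>\<^sup>+t. ennreal (a powr (x - 1)) * ennreal (indicator {0<..} t *\<^sub>R (t powr (x - 1) * exp (- (a * t)))) \<partial>lborel)"
    using a by (intro arg_cong2[where f = "(*)"] nn_integral_cong)
      (auto simp: indicator_def powr_mult ennreal_mult[symmetric] exp_minus field_simps zero_le_mult_iff)
  also have "\<dots> = ennreal a * (ennreal (a powr (x - 1)) * (\<integral>\<^sup>+t. ennreal (indicator {0<..} t *\<^sub>R (t powr (x - 1) * exp (- (a * t)))) \<partial>lborel))"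
    by (subst nn_integral_cmult) auto
  finally have *: "ennreal (a powr x) * (\<integral>\<^sup>+t. ennreal (indicator {0<..} t *\<^sub>R (t powr (x - 1) * exp (- (a * t)))) \<partial>lborel) = ennreal (Gamma x)"
    using a by (simp add: mult.assoc[symmetric] ennreal_mult[symmetric] powr_diff)
  have "(\<integral>\<^sup>+t. ennreal (indicator {0<..} t *\<^sub>R (t powr (x - 1) * exp (- (a * t)))) \<partial>lborel)
      = ennreal (1 / a powr x) * (ennreal (a powr x) * (\<integral>\<^sup>+t. ennreal (indicator {0<..} t *\<^sub>R (t powr (x - 1) * exp (- (a * t)))) \<partial>lborel))"
    using a by (simp add: mult.assoc[symmetric] ennreal_mult[symmetric])
  then show "(\<integral>\<^sup>+t. ennreal (indicator {0<..} t *\<^sub>R (t powr (x - 1) * exp (- (a * t)))) \<partial>lborel) = ennreal (Gamma x / a powr x)"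
    unfolding * using a x by (simp add: ennreal_mult[symmetric] Gamma_real_pos less_imp_le)
qed (use a x in \<open>auto simp: Gamma_real_pos less_imp_le\<close>)

lemma set_integrable_powr_exp:
  fixes x a :: real
  assumes "x > -1" "a > 0"
  shows "set_integrable lborel {0<..} (\<lambda>t. t powr x * exp (- (a * t)))"
  using has_bochner_integral_powr_exp[of "x + 1" a] assms
  unfolding set_integrable_def by (auto simp: has_bochner_integral_iff)

lemma set_integral_powr_exp:
  fixes x a :: real
  assumes "x > -1" "a > 0"
  shows "(LBINT t:{0<..}. t powr x * exp (- (a * t))) = Gamma (x + 1) / a powr (x + 1)"
  using has_bochner_integral_powr_exp[of "x + 1" a] assms
  unfolding set_lebesgue_integral_def by (auto simp: has_bochner_integral_iff)

text \<open>Up to the sign \<open>(-1) ^ m\<close> this is the m-th Taylor coefficient of the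
  Laplace transform at \<open>p\<close>. With the division by m! the moments of a convolution form a
  Cauchy product without binomial coefficients.\<close>

definition laplace_moment :: "nat \<Rightarrow> (real \<Rightarrow> complex) \<Rightarrow> complex \<Rightarrow> complex" where
  "laplace_moment m g p = (LBINT t:{0<..}. of_real (t ^ m / fact m) * g t * exp (- (p * of_real t)))"

text \<open>Absolute convergence of every moment at once, on the whole line Re p = \<sigma>.\<close>

definition laplaceable :: "real \<Rightarrow> (real \<Rightarrow> complex) \<Rightarrow> bool" where
  "laplaceable \<sigma> g \<longleftrightarrow> (\<forall>m. set_integrable lborel {0<..} (\<lambda>t. of_real (t ^ m * exp (- (\<sigma> * t))) * g t))"

definition half_conv :: "(real \<Rightarrow> complex) \<Rightarrow> (real \<Rightarrow> complex) \<Rightarrow> real \<Rightarrow> complex" where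
  "half_conv u v t = (LBINT s:{0<..<t}. u (t - s) * v s)"

lemma set_borel_measurable_half_line:
  fixes g :: "real \<Rightarrow> complex"
  assumes "continuous_on {0<..} g"
  shows "set_borel_measurable lborel {0<..} g"
  using borel_measurable_continuous_on_indicator[of "{0<..}" g] assms
  by (simp add: set_borel_measurable_def)

text \<open>The factor 1 + t^(-1/2) admits the singularity at 0 that the Abel kernel and the free
  datum share. The gap between \<open>s\<close> and \<open>\<sigma>\<close> absorbs all powers of
  t.\<close>

lemma laplaceableI:
  fixes g :: "real \<Rightarrow> complex"
  assumes meas: "set_borel_measurable lborel {0<..} g" and s: "s < \<sigma>"
    and bound: "\<And>t. t > 0 \<Longrightarrow> norm (g t) \<le> C * (1 + t powr (-1/2)) * exp (s * t)"
  shows "laplaceable \<sigma> g"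
  unfolding laplaceable_def
proof
  fix m :: nat
  have 1: "set_integrable lborel {0<..} (\<lambda>t. C * (t powr (real m) * exp (- ((\<sigma> - s) * t))
      + t powr (real m - 1/2) * exp (- ((\<sigma> - s) * t))))"
    using s by (intro set_integrable_mult_right set_integral_add set_integrable_powr_exp) auto
  show "set_integrable lborel {0<..} (\<lambda>t. of_real (t ^ m * exp (- (\<sigma> * t))) * g t)"
  proof (rule set_integrable_bound[OF 1])
    have "(\<lambda>t. of_real (t ^ m * exp (- (\<sigma> * t))) * (indicator {0<..} t *\<^sub>R g t)) \<in> borel_measurable lborel"
      using meas unfolding set_borel_measurable_def by measurable
    then show "set_borel_measurable lborel {0<..} (\<lambda>t. of_real (t ^ m * exp (- (\<sigma> * t))) * g t)"
      unfolding set_borel_measurable_def by simp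
    show "AE t in lborel. t \<in> {0<..} \<longrightarrow> norm (of_real (t ^ m * exp (- (\<sigma> * t))) * g t)
        \<le> norm (C * (t powr (real m) * exp (- ((\<sigma> - s) * t)) + t powr (real m - 1/2) * exp (- ((\<sigma> - s) * t))))"
    proof (intro AE_I2 impI)
      fix t :: real assume "t \<in> {0<..}"
      then have t: "t > 0" by simp
      have "norm (of_real (t ^ m * exp (- (\<sigma> * t))) * g t) = t ^ m * exp (- (\<sigma> * t)) * norm (g t)"
        using t by (simp add: norm_mult abs_mult norm_power)
      also have "\<dots> \<le> t ^ m * exp (- (\<sigma> * t)) * (C * (1 + t powr (-1/2)) * exp (s * t))"
        using t by (intro mult_left_mono bound) auto
      also have "\<dots> = C * (t powr (real m) * exp (- ((\<sigma> - s) * t)) + t powr (real m - 1/2) * exp (- ((\<sigma> - s) * t)))"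
      proof -
        have "exp (- ((\<sigma> - s) * t)) = exp (- (\<sigma> * t)) * exp (s * t)"
          by (simp add: exp_add[symmetric] algebra_simps)
        moreover have "t powr (real m - 1/2) = t ^ m * t powr (-1/2)"
          using t by (simp add: powr_realpow[symmetric] powr_add[symmetric])
        moreover have "t powr (real m) = t ^ m" using t by (simp add: powr_realpow)
        ultimately show ?thesis by (simp only:) (simp add: algebra_simps)
      qed
      also have "\<dots> \<le> norm \<dots>" by simp
      finally show "norm (of_real (t ^ m * exp (- (\<sigma> * t))) * g t) \<le> norm (C * (t powr (real m)
          * exp (- ((\<sigma> - s) * t)) + t powr (real m - 1/2) * exp (- ((\<sigma> - s) * t))))" .
    qed
  qed
qed

lemma laplaceable_integrable:
  assumes "laplaceable (Re p) g"
  shows "set_integrable lborel {0<..} (\<lambda>t. of_real (t ^ m / fact m) * g t * exp (- (p * of_real t)))"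
proof -
  have m: "set_integrable lborel {0<..} (\<lambda>t. of_real (t ^ m * exp (- (Re p * t))) * g t)" (is "set_integrable _ _ ?f")
    using assms by (simp add: laplaceable_def)
  have "set_integrable lborel {0<..} (\<lambda>t. (of_real (1 / fact m) * exp (- \<i> * of_real (Im p * t))) * ?f t)"
  proof (rule set_integrable_bound[OF m])
    have "(\<lambda>t. (of_real (1 / fact m) * exp (- \<i> * of_real (Im p * t))) * (indicator {0<..} t *\<^sub>R ?f t)) \<in> borel_measurable lborel"
      using m unfolding set_integrable_def by (intro borel_measurable_times) (auto dest: borel_measurable_integrable)
    then show "set_borel_measurable lborel {0<..} (\<lambda>t. (of_real (1 / fact m) * exp (- \<i> * of_real (Im p * t))) * ?f t)"
      unfolding set_borel_measurable_def by (simp only: scaleR_conv_of_real mult_ac)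
    show "AE t in lborel. t \<in> {0<..} \<longrightarrow> norm ((of_real (1 / fact m) * exp (- \<i> * of_real (Im p * t))) * ?f t) \<le> norm (?f t)"
    proof (intro AE_I2 impI)
      fix t :: real
      have "norm (of_real (1 / fact m) * exp (- \<i> * of_real (Im p * t)) :: complex) \<le> 1"
        by (simp add: norm_mult norm_divide fact_ge_1)
      then show "norm ((of_real (1 / fact m) * exp (- \<i> * of_real (Im p * t))) * ?f t) \<le> norm (?f t)"
        unfolding norm_mult by (rule mult_left_le_one_le[rotated 2]) auto
    qed
  qed
  moreover have "(of_real (1 / fact m) * exp (- \<i> * of_real (Im p * t))) * ?f t
      = of_real (t ^ m / fact m) * g t * exp (- (p * of_real t))" for t
  proof -
    have "exp (- \<i> * of_real (Im p * t)) * of_real (exp (- (Re p * t))) = exp (- (p * of_real t))"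
      unfolding exp_of_real[symmetric] exp_add[symmetric]
      by (intro arg_cong[where f = exp]) (simp add: complex_eq_iff)
    then show ?thesis by (simp add: field_simps)
  qed
  ultimately show ?thesis by (simp only:)
qed

section \<open>Moments of a convolution\<close>

lemma integral_convolution_lborel:
  fixes f g :: "real \<Rightarrow> complex"
  assumes f: "integrable lborel f" and g: "integrable lborel g"
  shows "integrable lborel (\<lambda>t. LINT s|lborel. f (t - s) * g s)"
    and "(LINT t|lborel. (LINT s|lborel. f (t - s) * g s)) = (LINT t|lborel. f t) * (LINT t|lborel. g t)"
    and "AE t in lborel. integrable lborel (\<lambda>s. f (t - s) * g s)"
proof -
  have fm [measurable]: "f \<in> borel_measurable borel" "g \<in> borel_measurable borel" using f g by auto
  have shift: "integrable lborel (\<lambda>t. f (t - s))" "(LINT t|lborel. f (t - s)) = (LINT t|lborel. f t)"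
     "(LINT t|lborel. norm (f (t - s))) = (LINT t|lborel. norm (f t))" for s
    using lborel_integrable_real_affine[OF f, of 1 "- s"] lborel_integral_real_affine[of 1 f "- s"]
      lborel_integral_real_affine[of 1 "\<lambda>t. norm (f t)" "- s"] by auto
  have int: "integrable (lborel \<Otimes>\<^sub>M lborel) (\<lambda>(s, t). f (t - s) * g s)"
  proof (rule lborel_pair.Fubini_integrable)
    show "(\<lambda>(s, t). f (t - s) * g s) \<in> borel_measurable (lborel \<Otimes>\<^sub>M lborel)" by measurable
    show "integrable lborel (\<lambda>s. LINT t|lborel. norm (case (s, t) of (s, t) \<Rightarrow> f (t - s) * g s))"
      using g by (simp add: norm_mult shift)
    show "AE s in lborel. integrable lborel (\<lambda>t. case (s, t) of (s, t) \<Rightarrow> f (t - s) * g s)"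
      using shift by simp
  qed
  show "integrable lborel (\<lambda>t. LINT s|lborel. f (t - s) * g s)"
    using lborel_pair.integrable_snd[OF int] by simp
  show "AE t in lborel. integrable lborel (\<lambda>s. f (t - s) * g s)"
    using lborel_pair.AE_integrable_snd[OF int] by simp
  show "(LINT t|lborel. (LINT s|lborel. f (t - s) * g s)) = (LINT t|lborel. f t) * (LINT t|lborel. g t)"
    using lborel_pair.Fubini_integral[OF int] by (simp add: shift)
qed

lemma binomial_divided_powers:
  fixes x y :: complex
  shows "(\<Sum>i\<le>m. x ^ i / fact i * (y ^ (m - i) / fact (m - i))) = (x + y) ^ m / fact m"
proof -
  have "(x + y) ^ m / fact m = (\<Sum>i\<le>m. of_nat (m choose i) * x ^ i * y ^ (m - i) / fact m)"
    by (simp add: binomial_ring sum_divide_distrib)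
  also have "\<dots> = (\<Sum>i\<le>m. x ^ i / fact i * (y ^ (m - i) / fact (m - i)))"
    by (intro sum.cong refl) (simp add: binomial_fact field_simps)
  finally show ?thesis ..
qed

text \<open>Since t = (t - s) + s, the divided power t^m / m! splits by the binomial theorem into
  products of divided powers of t - s and s, and each product is an ordinary convolution on the
  line.\<close>

lemma laplace_moment_half_conv:
  assumes u: "laplaceable (Re p) u" and v: "laplaceable (Re p) v"
  shows "laplace_moment m (half_conv u v) p =
    (\<Sum>i\<le>m. laplace_moment i u p * laplace_moment (m - i) v p)"
proof -
  define U where "U i x = indicator {0<..} x *\<^sub>R (of_real (x ^ i / fact i) * u x * exp (- (p * of_real x)))" for i and x :: real
  define V where "V i x = indicator {0<..} x *\<^sub>R (of_real (x ^ i / fact i) * v x * exp (- (p * of_real x)))" for i and x :: real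
  have Ui: "integrable lborel (U i)" for i
    using laplaceable_integrable[OF u, of i] unfolding set_integrable_def U_def .
  have Vi: "integrable lborel (V i)" for i
    using laplaceable_integrable[OF v, of i] unfolding set_integrable_def V_def .
  \<comment> \<open>The indicators inside \<open>U\<close> and \<open>V\<close> restrict s to the
    interval from 0 to t, so the sum of full-line convolution integrands is the integrand of
    \<open>half_conv\<close>.\<close>
  have pt: "(\<Sum>i\<le>m. U i (t - s) * V (m - i) s) =
     indicator {0<..<t} s *\<^sub>R (u (t - s) * v s * (of_real (t ^ m / fact m) * exp (- (p * of_real t))))" for m t s
  proof (cases "0 < s \<and> s < t")
    case True
    then have "(\<Sum>i\<le>m. U i (t - s) * V (m - i) s) = 
        (\<Sum>i\<le>m. (of_real (t - s) ^ i / fact i * (of_real s ^ (m - i) / fact (m - i)))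
          * (u (t - s) * v s * (exp (- (p * of_real (t - s))) * exp (- (p * of_real s)))))"
      unfolding U_def V_def by (intro sum.cong refl) (simp add: field_simps)
    also have "exp (- (p * of_real (t - s))) * exp (- (p * of_real s)) = exp (- (p * of_real t))"
      unfolding exp_add[symmetric] by (simp add: algebra_simps)
    finally show ?thesis using True
      unfolding sum_distrib_right[symmetric] binomial_divided_powers by (simp add: field_simps)
  next
    case False
    then show ?thesis by (auto simp: U_def V_def indicator_def intro!: sum.neutral)
  qed
  have "(\<Sum>i\<le>m. laplace_moment i u p * laplace_moment (m - i) v p)
      = (\<Sum>i\<le>m. (LINT t|lborel. U i t) * (LINT t|lborel. V (m - i) t))"
    unfolding laplace_moment_def set_lebesgue_integral_def U_def V_def ..
  also have "\<dots> = (\<Sum>i\<le>m. (LINT t|lborel. (LINT s|lborel. U i (t - s) * V (m - i) s)))"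
    using integral_convolution_lborel(2)[OF Ui Vi] by simp
  also have "\<dots> = (LINT t|lborel. (\<Sum>i\<le>m. (LINT s|lborel. U i (t - s) * V (m - i) s)))"
    by (intro Bochner_Integration.integral_sum[symmetric] integral_convolution_lborel(1) Ui Vi)
  also have "\<dots> = (LINT t|lborel. indicator {0<..} t *\<^sub>R
      (of_real (t ^ m / fact m) * half_conv u v t * exp (- (p * of_real t))))"
  proof (rule integral_cong_AE)
    show "(\<lambda>t. \<Sum>i\<le>m. (LINT s|lborel. U i (t - s) * V (m - i) s)) \<in> borel_measurable lborel"
      by (intro borel_measurable_sum borel_measurable_integrable integral_convolution_lborel(1) Ui Vi)
    have eq: "AE t in lborel. (\<Sum>i\<le>m. (LINT s|lborel. U i (t - s) * V (m - i) s)) =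
        indicator {0<..} t *\<^sub>R (of_real (t ^ m / fact m) * half_conv u v t * exp (- (p * of_real t)))"
    proof -
      have "AE t in lborel. \<forall>i\<in>{..m}. integrable lborel (\<lambda>s. U i (t - s) * V (m - i) s)"
        by (intro AE_finite_allI integral_convolution_lborel(3) Ui Vi) auto
      then show ?thesis
      proof eventually_elim
        case (elim t)
        have "(\<Sum>i\<le>m. (LINT s|lborel. U i (t - s) * V (m - i) s)) =
            (LINT s|lborel. (\<Sum>i\<le>m. U i (t - s) * V (m - i) s))"
          using elim by (intro Bochner_Integration.integral_sum[symmetric]) auto
        also have "\<dots> = half_conv u v t * (of_real (t ^ m / fact m) * exp (- (p * of_real t)))"
          unfolding pt half_conv_def set_lebesgue_integral_def
          by (subst integral_mult_left_zero[symmetric]) (simp only: mult_scaleR_left)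
        also have "\<dots> = indicator {0<..} t *\<^sub>R (of_real (t ^ m / fact m) * half_conv u v t * exp (- (p * of_real t)))"
          by (cases "0 < t") (auto simp: half_conv_def set_lebesgue_integral_def)
        finally show ?case .
      qed
    qed
    then show "AE t in lborel. (\<Sum>i\<le>m. (LINT s|lborel. U i (t - s) * V (m - i) s)) =
        indicator {0<..} t *\<^sub>R (of_real (t ^ m / fact m) * half_conv u v t * exp (- (p * of_real t)))" .
    show "(\<lambda>t. indicator {0<..} t *\<^sub>R (of_real (t ^ m / fact m) * half_conv u v t * exp (- (p * of_real t))))
        \<in> borel_measurable lborel"
    proof -
      \<comment> \<open>Measurability of \<open>half_conv u v\<close> is no hypothesis. The case m =
        0 of \<open>pt\<close> displays it as an integrable function times an exponential.\<close>
      have hc: "half_conv u v = (\<lambda>t. (LINT s|lborel. U 0 (t - s) * V 0 s) * exp (p * of_real t))"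
      proof
        fix t
        have "(LINT s|lborel. U 0 (t - s) * V 0 s) = half_conv u v t * exp (- (p * of_real t))"
          using pt[where m = 0 and t = t] unfolding half_conv_def set_lebesgue_integral_def
          by (subst integral_mult_left_zero[symmetric]) (simp add: mult_scaleR_left)
        then show "half_conv u v t = (LINT s|lborel. U 0 (t - s) * V 0 s) * exp (p * of_real t)"
          by (simp add: mult.assoc exp_add[symmetric])
      qed
      have [measurable]: "(\<lambda>t. LINT s|lborel. U 0 (t - s) * V 0 s) \<in> borel_measurable lborel"
        by (intro borel_measurable_integrable integral_convolution_lborel(1) Ui Vi)
      show ?thesis unfolding hc by measurable
    qed
  qed
  finally show ?thesis
    unfolding laplace_moment_def[of m "half_conv u v" p] set_lebesgue_integral_def by (rule sym)
qed

section \<open>The damped Abel kernel\<close>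

definition abel_kernel :: "real \<Rightarrow> real \<Rightarrow> complex" where
  "abel_kernel \<Lambda> t = of_real (exp (- (\<Lambda> * t)) / sqrt t)"

text \<open>Taylor coefficients of (1 - x)^(-1/2).\<close>

definition abel_coeff :: "nat \<Rightarrow> real" where
  "abel_coeff i = (-1) ^ i * ((-1/2) gchoose i)"

lemma abel_coeff_0 [simp]: "abel_coeff 0 = 1"
  by (simp add: abel_coeff_def)

lemma abel_coeff_Suc: "abel_coeff (Suc i) = abel_coeff i * ((real i + 1/2) / (real i + 1))"
  by (simp add: abel_coeff_def gbinomial_prod_rev field_simps)

lemma abel_coeff_bounds: "0 \<le> abel_coeff i \<and> abel_coeff i \<le> 1"
proof (induction i)
  case (Suc i)
  have "0 \<le> (real i + 1/2) / (real i + 1)" "(real i + 1/2) / (real i + 1) \<le> 1" by auto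
  with Suc show ?case unfolding abel_coeff_Suc using mult_le_one mult_nonneg_nonneg by blast
qed simp

lemma continuous_on_abel_kernel: "continuous_on {0<..} (abel_kernel \<Lambda>)"
  unfolding abel_kernel_def by (intro continuous_intros) auto

lemma inverse_sqrt_powr: "t > 0 \<Longrightarrow> 1 / sqrt t = t powr (-1/2)"
  using powr_minus_divide[of t "1/2"] by (simp add: powr_half_sqrt)

lemma laplaceable_abel_kernel:
  assumes "\<sigma> + \<Lambda> > 0"
  shows "laplaceable \<sigma> (abel_kernel \<Lambda>)"
proof (rule laplaceableI[where C = 1 and s = "- \<Lambda>"])
  show "set_borel_measurable lborel {0<..} (abel_kernel \<Lambda>)"
    by (intro set_borel_measurable_half_line continuous_on_abel_kernel)
  show "norm (abel_kernel \<Lambda> t) \<le> 1 * (1 + t powr (-1/2)) * exp (- \<Lambda> * t)" if "t > 0" for t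
  proof -
    have "norm (abel_kernel \<Lambda> t) = 1 / sqrt t * exp (- \<Lambda> * t)"
      using that by (simp add: abel_kernel_def norm_divide)
    also have "\<dots> \<le> 1 * (1 + t powr (-1/2)) * exp (- \<Lambda> * t)"
      unfolding inverse_sqrt_powr[OF that] by (intro mult_right_mono) auto
    finally show ?thesis .
  qed
qed (use assms in auto)

text \<open>Integration by parts: the derivative of t^(i + 1/2) exp (- w t) has integral 0 over the
  half line, since the function vanishes at both ends.\<close>

lemma laplace_moment_abel_kernel_Suc:
  assumes w: "Re w > 0"
  shows "laplace_moment (Suc i) (abel_kernel 0) w =
    of_real ((real i + 1/2) / (real i + 1)) / w * laplace_moment i (abel_kernel 0) w"
proof -
  define a where "a = real i + 1/2"
  define h where "h i t = of_real (t ^ i / fact i) * abel_kernel 0 t * exp (- (w * of_real t))" for i t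
  define F where "F t = of_real (t powr a) * exp (- (w * of_real t))" for t :: real
  define f where "f t = of_real (a * fact i) * h i t - w * of_real (fact (Suc i)) * h (Suc i) t" for t
  have hint: "set_integrable lborel {0<..} (h i)" for i
    unfolding h_def using w by (intro laplaceable_integrable laplaceable_abel_kernel) simp
  have hL: "laplace_moment i (abel_kernel 0) w = (LBINT t:{0<..}. h i t)" for i
    by (simp add: laplace_moment_def h_def)
  have "(LBINT t:{0<..}. f t) = 0 - 0"
  proof (rule FTC_half_line)
    fix t :: real assume t: "t > 0"
    have "a - 1 = real i + (-1/2)" by (simp add: a_def)
    then have "t powr (a - 1) = t ^ i * (1 / sqrt t)"
      by (simp only: powr_add powr_realpow[OF t] inverse_sqrt_powr[OF t])
    then have p1: "a * t powr (a - 1) = a * (t ^ i / sqrt t)" by simp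
    have p2: "t powr a = t ^ Suc i / sqrt t"
    proof -
      have "t powr a = t ^ i * sqrt t" using t by (simp add: a_def powr_add powr_realpow powr_half_sqrt)
      also have "sqrt t = t / sqrt t" using t by (simp add: real_div_sqrt)
      finally show ?thesis by simp
    qed
    have "((\<lambda>t. t powr a) has_real_derivative a * t powr (a - 1)) (at t)"
      using t by (auto intro!: derivative_eq_intros)
    then have "((\<lambda>t. complex_of_real (t powr a)) has_vector_derivative of_real (a * t powr (a - 1))) (at t)"
      unfolding has_real_derivative_iff_has_vector_derivative by (rule bounded_linear.has_vector_derivative[OF bounded_linear_of_real])
    moreover have "((\<lambda>t. exp (- (w * of_real t))) has_vector_derivative - w * exp (- (w * of_real t))) (at t)"
      by (rule has_vector_derivative_real_field) (auto intro!: derivative_eq_intros)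
    ultimately have "(F has_vector_derivative of_real (t powr a) * (- w * exp (- (w * of_real t)))
        + of_real (a * t powr (a - 1)) * exp (- (w * of_real t))) (at t)"
      unfolding F_def by (rule has_vector_derivative_mult)
    then show "(F has_vector_derivative f t) (at t)"
      unfolding p1 p2 f_def h_def abel_kernel_def
      by (rule has_vector_derivative_eq_rhs) (simp add: field_simps del: fact_Suc)
  next
    show "continuous_on {0<..} f"
      unfolding f_def h_def by (intro continuous_intros continuous_on_abel_kernel) auto
    show "set_integrable lborel {0<..} f"
      unfolding f_def using hint by (intro set_integral_diff set_integrable_mult_right) auto
    have nF: "norm (F t) = t powr a * exp (- (Re w * t))" for t
      by (simp add: F_def norm_mult)
    have "a > 0" by (simp add: a_def)
    then have "((\<lambda>t. t powr a * exp (- (Re w * t))) \<longlongrightarrow> 0) (at_right 0)" by real_asymp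
    then show "(F \<longlongrightarrow> 0) (at_right 0)" by (subst tendsto_norm_zero_iff[symmetric]) (simp add: nF)
    have "((\<lambda>t. t powr a * exp (- (Re w * t))) \<longlongrightarrow> 0) at_top" using w by real_asymp
    then show "(F \<longlongrightarrow> 0) at_top" by (subst tendsto_norm_zero_iff[symmetric]) (simp add: nF)
  qed
  also have "(LBINT t:{0<..}. f t) = of_real (a * fact i) * laplace_moment i (abel_kernel 0) w
      - w * of_real (fact (Suc i)) * laplace_moment (Suc i) (abel_kernel 0) w"
    unfolding f_def hL using hint by (subst set_integral_diff) (auto simp del: fact_Suc)
  finally have "fact i * (w * (of_real (real i + 1) * laplace_moment (Suc i) (abel_kernel 0) w))
      = fact i * (of_real a * laplace_moment i (abel_kernel 0) w)"
    by (simp add: algebra_simps)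
  then have "w * (of_real (real i + 1) * laplace_moment (Suc i) (abel_kernel 0) w)
      = of_real a * laplace_moment i (abel_kernel 0) w"
    by (rule mult_left_cancel[OF fact_nonzero, THEN iffD1])
  moreover have "w \<noteq> 0" "complex_of_real (real i + 1) \<noteq> 0"
    using w by (auto simp: complex_eq_iff)
  ultimately show ?thesis
    by (simp add: a_def[symmetric] field_simps del: of_real_add of_real_of_nat_eq)
qed

text \<open>Complex arguments are reached without rotating a contour. Along the vertical line the
  product of the transform with \<open>csqrt\<close> has derivative 0, by the recursion for the
  first moment, and on the real axis its value is Gamma (1/2) = sqrt pi.\<close>

lemma laplace_abel_kernel:
  assumes x: "x > 0"
  shows "laplace_moment 0 (abel_kernel 0) (Complex x y) = of_real (sqrt pi) / csqrt (Complex x y)"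
proof -
  define I where "I i y = laplace_moment i (abel_kernel 0) (Complex x y)" for i y
  define \<phi> where "\<phi> y = I 0 y * csqrt (Complex x y)" for y
  have ne: "Complex x y \<notin> \<real>\<^sub>\<le>\<^sub>0" for y using x by (auto simp: complex_nonpos_Reals_iff)
  have Cd: "(Complex x has_vector_derivative \<i>) (at y)" for y
    unfolding Complex_eq by (auto intro!: derivative_eq_intros)
  have dI: "((\<lambda>y. I 0 y) has_vector_derivative (- \<i> * I 1 y)) (at y)" for y
  proof -
    define f where "f = (\<lambda>y t. indicator {0<..} t *\<^sub>R (abel_kernel 0 t * exp (- (Complex x y * of_real t))))"
    define f' where "f' = (\<lambda>y t. - \<i> * (indicator {0<..} t *\<^sub>R (of_real t * abel_kernel 0 t * exp (- (Complex x y * of_real t)))))"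
    have int: "integrable lborel (\<lambda>t. indicator {0<..} t *\<^sub>R (of_real (t ^ i / fact i) * abel_kernel 0 t * exp (- (Complex x y * of_real t))))" for i y
      using laplaceable_integrable[of "Complex x y" "abel_kernel 0" i] laplaceable_abel_kernel[of x 0] x
      unfolding set_integrable_def by simp
    have "((\<lambda>y. LINT t|lborel. f y t) has_vector_derivative (LINT t|lborel. f' y t)) (at y)"
    proof (rule has_vector_derivative_lebesgue_integral[where U = UNIV
          and g = "\<lambda>t. indicator {0<..} t *\<^sub>R (t powr (1/2) * exp (- (x * t)))"])
      show "integrable lborel (f y)" for y using int[of 0 y] by (simp add: f_def)
      have "integrable lborel (f' y)" using integrable_mult_right[OF int[of 1 y], of "- \<i>"] by (simp add: f'_def)
      then show "f' y \<in> borel_measurable lborel" by (rule borel_measurable_integrable)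
      show "((\<lambda>y. f y t) has_vector_derivative f' y t) (at y)" for t y
      proof -
        have "((\<lambda>y. - (Complex x y * of_real t)) has_vector_derivative - (\<i> * of_real t)) (at y)"
          by (rule derivative_eq_intros Cd refl | simp)+
        from field_vector_diff_chain_at[OF this DERIV_exp]
        have "((\<lambda>y. exp (- (Complex x y * of_real t))) has_vector_derivative
            - (\<i> * of_real t) * exp (- (Complex x y * of_real t))) (at y)"
          by (simp add: comp_def)
        then have "((\<lambda>y. indicator {0<..} t *\<^sub>R (abel_kernel 0 t * exp (- (Complex x y * of_real t)))) has_vector_derivative
            indicator {0<..} t *\<^sub>R (abel_kernel 0 t * (- (\<i> * of_real t) * exp (- (Complex x y * of_real t))))) (at y)"
          by (intro bounded_linear.has_vector_derivative[OF bounded_linear_scaleR_right] has_vector_derivative_mult_right)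
        then show ?thesis unfolding f_def f'_def by (rule has_vector_derivative_eq_rhs) (simp add: mult_ac)
      qed
      show "integrable lborel (\<lambda>t. indicator {0<..} t *\<^sub>R (t powr (1/2) * exp (- (x * t))))"
        using set_integrable_powr_exp[of "1/2" x] x by (simp add: set_integrable_def)
      show "norm (f' y t) \<le> indicator {0<..} t *\<^sub>R (t powr (1/2) * exp (- (x * t)))" for y t
      proof (cases "0 < t")
        case True
        have "norm (f' y t) = t / sqrt t * exp (- (x * t))"
          using True by (simp add: f'_def norm_mult abel_kernel_def norm_divide)
        then show ?thesis using True by (simp add: powr_half_sqrt real_div_sqrt)
      qed (simp add: f'_def)
    qed auto
    moreover have "(LINT t|lborel. f' y t) = - \<i> * I 1 y"
      unfolding f'_def integral_mult_right_zero I_def laplace_moment_def set_lebesgue_integral_def by simp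
    moreover have "(LINT t|lborel. f y t) = I 0 y" for y
      by (simp add: f_def I_def laplace_moment_def set_lebesgue_integral_def)
    ultimately show ?thesis by simp
  qed
  have "(\<phi> has_vector_derivative 0) (at y)" for y
  proof -
    let ?w = "Complex x y"
    have w1: "?w \<noteq> 0" using x by (auto simp: complex_eq_iff)
    have w0: "csqrt ?w \<noteq> 0" using w1 by (simp only: csqrt_eq_0 not_False_eq_True)
    have dc: "((\<lambda>y. csqrt (Complex x y)) has_vector_derivative \<i> * (1 / (2 * csqrt ?w))) (at y)"
      using field_vector_diff_chain_at[OF Cd has_field_derivative_csqrt[OF ne]] by (simp add: comp_def field_simps)
    have I1: "I 1 y = (1/2) / ?w * I 0 y"
      using laplace_moment_abel_kernel_Suc[of ?w 0] x by (simp add: I_def)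
    have "I 0 y * (\<i> * (1 / (2 * csqrt ?w))) + (- \<i> * I 1 y) * csqrt ?w = 0"
    proof -
      have "csqrt ?w / ?w = 1 / csqrt ?w"
        using w0 w1 power2_csqrt[of ?w] by (simp add: field_simps power2_eq_square del: csqrt.sel)
      moreover have "- \<i> * I 1 y * csqrt ?w = - \<i> * (1/2) * I 0 y * (csqrt ?w / ?w)"
        unfolding I1 by (simp add: mult_ac)
      ultimately show ?thesis by simp
    qed
    then show ?thesis
      unfolding \<phi>_def using has_vector_derivative_mult[OF dI dc] by simp
  qed
  then obtain C where C: "\<And>y. \<phi> y = C"
    using has_vector_derivative_zero_constant[of UNIV \<phi>] by auto
  have "\<phi> 0 = of_real (sqrt pi)"
  proof -
    have "I 0 0 = (LBINT t:{0<..}. complex_of_real (t powr (-1/2) * exp (- (x * t))))"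
      unfolding I_def laplace_moment_def
    proof (rule set_lebesgue_integral_cong)
      show "\<forall>t. t \<in> {0<..} \<longrightarrow> of_real (t ^ 0 / fact 0) * abel_kernel 0 t * exp (- (Complex x 0 * of_real t))
          = complex_of_real (t powr (-1/2) * exp (- (x * t)))"
      proof (intro allI impI)
        fix t :: real assume "t \<in> {0<..}"
        then have "abel_kernel 0 t = of_real (t powr (-1/2))" by (simp add: abel_kernel_def inverse_sqrt_powr)
        moreover have "exp (- (Complex x 0 * of_real t)) = of_real (exp (- (x * t)))"
          by (simp add: Complex_eq exp_of_real[symmetric])
        ultimately show "of_real (t ^ 0 / fact 0) * abel_kernel 0 t * exp (- (Complex x 0 * of_real t))
          = complex_of_real (t powr (-1/2) * exp (- (x * t)))" by simp
      qed
    qed simp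
    also have "\<dots> = of_real (Gamma (1/2) / x powr (1/2))"
      unfolding set_integral_complex_of_real using x by (subst set_integral_powr_exp) auto
    finally have "I 0 0 = of_real (sqrt pi / sqrt x)"
      using x by (simp add: Gamma_one_half_real powr_half_sqrt)
    moreover have "csqrt (Complex x 0) = of_real (sqrt x)"
      using x csqrt_of_real[of x] by (simp add: Complex_eq)
    ultimately show ?thesis using x by (simp add: \<phi>_def)
  qed
  then have "\<phi> y = of_real (sqrt pi)" using C by metis
  moreover have "Complex x y \<noteq> 0" using x by (auto simp: complex_eq_iff)
  ultimately show ?thesis by (simp add: \<phi>_def I_def field_simps)
qed

lemma laplace_moment_abel_kernel:
  assumes "Re p + \<Lambda> > 0"
  shows "laplace_moment i (abel_kernel \<Lambda>) p =
    of_real (sqrt pi * abel_coeff i) / ((p + of_real \<Lambda>) ^ i * csqrt (p + of_real \<Lambda>))"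
proof -
  define w where "w = p + of_real \<Lambda>"
  have w: "Re w > 0" using assms by (simp add: w_def)
  have "laplace_moment i (abel_kernel \<Lambda>) p = laplace_moment i (abel_kernel 0) w"
    unfolding laplace_moment_def
  proof (rule set_lebesgue_integral_cong)
    show "\<forall>t. t \<in> {0<..} \<longrightarrow> of_real (t ^ i / fact i) * abel_kernel \<Lambda> t * exp (- (p * of_real t))
        = of_real (t ^ i / fact i) * abel_kernel 0 t * exp (- (w * of_real t))"
    proof (intro allI impI)
      fix t :: real
      have "exp (- (w * of_real t)) = of_real (exp (- (\<Lambda> * t))) * exp (- (p * of_real t))"
        unfolding exp_of_real[symmetric] exp_add[symmetric] by (simp add: w_def algebra_simps)
      then show "of_real (t ^ i / fact i) * abel_kernel \<Lambda> t * exp (- (p * of_real t))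
        = of_real (t ^ i / fact i) * abel_kernel 0 t * exp (- (w * of_real t))"
        by (simp add: abel_kernel_def)
    qed
  qed simp
  also have "\<dots> = of_real (sqrt pi * abel_coeff i) / (w ^ i * csqrt w)"
  proof (induction i)
    case 0
    then show ?case using laplace_abel_kernel[of "Re w" "Im w"] w by simp
  next
    case (Suc i)
    then show ?case unfolding laplace_moment_abel_kernel_Suc[OF w] abel_coeff_Suc
      by (simp add: mult_ac)
  qed
  finally show ?thesis by (simp add: w_def)
qed

section \<open>The free evolution of the bound state at the origin\<close>

text \<open>Both measures are determined by their values on half lines \<open>{..a}\<close>. For the
  image measure this is the volume of a ball, for the density the integral of the area of
  spheres.\<close>

lemma distr_norm_real3:
  "distr lborel borel (norm :: real^3 \<Rightarrow> real) = density lborel (\<lambda>r. ennreal (indicator {0..} r * (4 * pi * r\<^sup>2)))"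
  (is "?M = ?N")
proof (rule measure_eqI_generator_eq[where E = "range atMost" and \<Omega> = UNIV and A = "\<lambda>n. {..real n}"])
  show "Int_stable (range (atMost :: real \<Rightarrow> _))" by (auto simp: Int_stable_def)
  show "sets ?M = sigma_sets UNIV (range atMost)" "sets ?N = sigma_sets UNIV (range atMost)"
    by (simp_all add: borel_eq_atMost)
  have M: "emeasure ?M {..a} = (if 0 \<le> a then ennreal (4/3 * pi * a ^ 3) else 0)" for a
  proof -
    have "emeasure ?M {..a} = emeasure lborel (norm -` {..a} :: (real^3) set)"
      by (subst emeasure_distr) auto
    also have "(norm -` {..a} :: (real^3) set) = (if 0 \<le> a then cball 0 a else {})"
      by (auto simp: dist_norm) (meson norm_ge_zero order_trans)
    finally show ?thesis by (simp add: emeasure_cball unit_ball_vol_3)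
  qed
  then show "emeasure ?M {..real i} \<noteq> \<infinity>" for i by simp
  fix X :: "real set" assume "X \<in> range atMost"
  then obtain a where X: "X = {..a}" by auto
  have "emeasure ?N {..a} = (\<integral>\<^sup>+r. ennreal (indicator {0..} r * (4 * pi * r\<^sup>2)) * indicator {..a} r \<partial>lborel)"
    by (subst emeasure_density) auto
  also have "\<dots> = (\<integral>\<^sup>+r. ennreal (4 * pi * r\<^sup>2) * indicator {0..a} r \<partial>lborel)"
    by (intro nn_integral_cong) (auto simp: indicator_def)
  also have "\<dots> = (if 0 \<le> a then ennreal (4/3 * pi * a ^ 3) else 0)"
  proof (cases "0 \<le> a")
    case True
    have "(\<integral>\<^sup>+r. ennreal (4 * pi * r\<^sup>2) * indicator {0..a} r \<partial>lborel) = ennreal (4/3 * pi * a ^ 3 - 4/3 * pi * 0 ^ 3)"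
      using True by (intro nn_integral_FTC_Icc) (auto intro!: derivative_eq_intros)
    with True show ?thesis by simp
  qed simp
  finally show "emeasure ?M X = emeasure ?N X" unfolding X M by simp
qed (auto simp: real_arch_simple)

lemma integral_radial_real3:
  fixes g :: "real \<Rightarrow> complex"
  assumes [measurable]: "g \<in> borel_measurable borel"
  shows "(LINT y|lborel. g (norm (y :: real^3))) = (LBINT r:{0<..}. of_real (4 * pi * r\<^sup>2) * g r)"
proof -
  have "(LINT y|lborel. g (norm (y :: real^3))) = (LINT r|distr lborel borel (norm :: real^3 \<Rightarrow> real). g r)"
    by (subst integral_distr) auto
  also have "\<dots> = (LINT r|lborel. (indicator {0..} r * (4 * pi * r\<^sup>2)) *\<^sub>R g r)"
    unfolding distr_norm_real3 by (subst integral_density) auto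
  also have "\<dots> = (LBINT r:{0<..}. of_real (4 * pi * r\<^sup>2) * g r)"
    unfolding set_lebesgue_integral_def
    by (intro Bochner_Integration.integral_cong refl) (auto simp: indicator_def scaleR_conv_of_real)
  finally show ?thesis .
qed

lemma csqrt_scale: "0 < x \<Longrightarrow> csqrt (of_real x * z) = of_real (sqrt x) * csqrt z"
  using csqrt_principal[of z]
  by (intro csqrt_unique) (auto simp: power_mult_distrib simp flip: of_real_power simp del: csqrt.sel)

text \<open>What remains of the free evolution at the origin in polar coordinates. For the bound
  state n = 1, since r^2 from the area cancels one factor 1/r; n = 3 enters when the integral is
  differentiated in \<tau>.\<close>

definition fresnel_moment :: "real \<Rightarrow> nat \<Rightarrow> real \<Rightarrow> complex" where
  "fresnel_moment b n \<tau> = (LBINT r:{0<..}. of_real (r ^ n) * exp (\<i> * of_real (r\<^sup>2 / (4 * \<tau>)) - of_real (b * r)))"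

lemma U0_at_origin_phi_ev:
  assumes "\<tau> > 0" "a < 0"
  shows "U0_at_origin \<tau> (phi_ev a) = of_real (4 * pi * sqrt (2 * \<bar>a\<bar>)) / csqrt (of_real (4 * pi) * \<i>) ^ 3
    * (fresnel_moment (4 * pi * \<bar>a\<bar>) 1 \<tau> / of_real (\<tau> powr (3/2)))"
proof -
  define K where "K = csqrt (4 * pi * \<i> * of_real \<tau>) ^ 3"
  define g where "g r = exp (\<i> * of_real (r\<^sup>2 / (4 * \<tau>))) / K * of_real (sqrt (2 * \<bar>a\<bar>) * exp (4 * pi * a * r) / r)" for r
  have K: "K = of_real (\<tau> powr (3/2)) * csqrt (of_real (4 * pi) * \<i>) ^ 3"
  proof -
    have "csqrt (4 * pi * \<i> * of_real \<tau>) = of_real (sqrt \<tau>) * csqrt (of_real (4 * pi) * \<i>)"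
      using csqrt_scale[of \<tau> "of_real (4 * pi) * \<i>"] assms by (simp add: mult_ac)
    moreover have "\<tau> powr (3/2) = sqrt \<tau> ^ 3"
      using assms powr_powr[of \<tau> "1/2" 3] by (simp add: powr_half_sqrt flip: powr_numeral)
    ultimately show ?thesis by (simp add: K_def power_mult_distrib)
  qed
  have "U0_at_origin \<tau> (phi_ev a) = (LINT y|lborel. g (norm (y :: real^3)))"
    unfolding U0_at_origin_def U0_kernel_def phi_ev_def g_def K_def by simp
  also have "\<dots> = (LBINT r:{0<..}. of_real (4 * pi * r\<^sup>2) * g r)"
    unfolding g_def by (rule integral_radial_real3) measurable
  also have "\<dots> = (LBINT r:{0<..}. (of_real (4 * pi * sqrt (2 * \<bar>a\<bar>)) / K) *
      (of_real (r ^ 1) * exp (\<i> * of_real (r\<^sup>2 / (4 * \<tau>)) - of_real (4 * pi * \<bar>a\<bar> * r))))"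
  proof (rule set_lebesgue_integral_cong)
    show "\<forall>r. r \<in> {0<..} \<longrightarrow> of_real (4 * pi * r\<^sup>2) * g r = (of_real (4 * pi * sqrt (2 * \<bar>a\<bar>)) / K) *
      (of_real (r ^ 1) * exp (\<i> * of_real (r\<^sup>2 / (4 * \<tau>)) - of_real (4 * pi * \<bar>a\<bar> * r)))"
    proof (intro allI impI)
      fix r :: real assume "r \<in> {0<..}"
      moreover have "exp (\<i> * of_real (r\<^sup>2 / (4 * \<tau>)) - of_real (4 * pi * \<bar>a\<bar> * r))
          = exp (\<i> * of_real (r\<^sup>2 / (4 * \<tau>))) * of_real (exp (4 * pi * a * r))"
        unfolding exp_of_real[symmetric] exp_add[symmetric] using assms by simp
      ultimately show "of_real (4 * pi * r\<^sup>2) * g r = (of_real (4 * pi * sqrt (2 * \<bar>a\<bar>)) / K) *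
        (of_real (r ^ 1) * exp (\<i> * of_real (r\<^sup>2 / (4 * \<tau>)) - of_real (4 * pi * \<bar>a\<bar> * r)))"
        by (simp only: g_def) (simp add: power2_eq_square)
    qed
  qed simp
  also have "\<dots> = (of_real (4 * pi * sqrt (2 * \<bar>a\<bar>)) / K) * fresnel_moment (4 * pi * \<bar>a\<bar>) 1 \<tau>"
    unfolding fresnel_moment_def by (rule set_integral_mult_right)
  finally show ?thesis unfolding K by (simp add: field_simps)
qed

lemma set_integrable_fresnel:
  assumes "b > 0"
  shows "set_integrable lborel {0<..} (\<lambda>r. of_real (r ^ n) * exp (\<i> * of_real (r\<^sup>2 / (4 * \<tau>)) - of_real (b * r)))"
proof (rule set_integrable_bound[OF set_integrable_powr_exp[of "real n" b]])
  show "set_borel_measurable lborel {0<..} (\<lambda>r. of_real (r ^ n) * exp (\<i> * of_real (r\<^sup>2 / (4 * \<tau>)) - of_real (b * r)))"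
    unfolding set_borel_measurable_def by measurable
  show "AE r in lborel. r \<in> {0<..} \<longrightarrow> norm (of_real (r ^ n) * exp (\<i> * of_real (r\<^sup>2 / (4 * \<tau>)) - of_real (b * r)))
      \<le> norm (r powr (real n) * exp (- (b * r)))"
    by (intro AE_I2 impI) (auto simp: norm_mult norm_power powr_realpow)
qed (use assms in auto)

text \<open>Integrating an exact derivative links the moments 3 and 1. Since the \<tau>-derivative
  of the first moment is a multiple of the third, this closes to a first order differential equation
  for the first moment.\<close>

lemma fresnel_moment_identity:
  assumes b: "b > 0" and \<tau>: "\<tau> > 0"
  shows "fresnel_moment b 3 \<tau> / of_real (4 * \<tau>\<^sup>2)
    + (of_real (b\<^sup>2) - 3 * \<i> / of_real (2 * \<tau>)) * fresnel_moment b 1 \<tau> = 1"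
proof -
  define S where "S r = exp (\<i> * of_real (r\<^sup>2 / (4 * \<tau>)) - of_real (b * r))" for r
  \<comment> \<open>The polynomial is chosen so that in the derivative of \<open>X\<close> the even
    powers of r cancel and only r^3 and r remain. Its value -1 at 0 produces the right-hand side
    1.\<close>
  define X where "X r = (- (\<i> / of_real (2 * \<tau>)) * of_real (r ^ 2) - of_real (b * r) - 1) * S r" for r :: real
  define f where "f r = 1 / of_real (4 * \<tau>\<^sup>2) * (of_real (r ^ 3) * S r)
     + (of_real (b\<^sup>2) - 3 * \<i> / of_real (2 * \<tau>)) * (of_real (r ^ 1) * S r)" for r
  have Si: "set_integrable lborel {0<..} (\<lambda>r. of_real (r ^ n) * S r)" for n
    unfolding S_def by (rule set_integrable_fresnel[OF b])
  have "(LBINT r:{0<..}. f r) = 0 - (-1)"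
  proof (rule FTC_half_line)
    fix r :: real assume "r > 0"
    have "((\<lambda>z. (- (\<i> / of_real (2 * \<tau>)) * z\<^sup>2 - of_real b * z - 1)
        * exp (\<i> * z\<^sup>2 / of_real (4 * \<tau>) - of_real b * z)) has_field_derivative f r) (at (of_real r))"
      using \<tau> by (auto intro!: derivative_eq_intros
          simp: f_def S_def field_simps power2_eq_square power3_eq_cube)
    from has_vector_derivative_real_field[OF this]
    show "(X has_vector_derivative f r) (at r)" by (simp add: X_def[abs_def] S_def)
  next
    show "continuous_on {0<..} f" unfolding f_def S_def using \<tau> by (intro continuous_intros) auto
    show "set_integrable lborel {0<..} f"
      unfolding f_def by (intro set_integral_add set_integrable_mult_right Si)
    have "isCont X 0" unfolding X_def S_def using \<tau> by (intro continuous_intros) auto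
    then have "(X \<longlongrightarrow> X 0) (at_right 0)" unfolding isCont_def by (rule tendsto_mono[OF at_le, rotated]) auto
    then show "(X \<longlongrightarrow> -1) (at_right 0)" by (simp add: X_def S_def)
    have nX: "norm (X r) \<le> (r\<^sup>2 / (2 * \<tau>) + b * r + 1) * exp (- (b * r))" if "r > 0" for r
    proof -
      have "norm (- (\<i> / of_real (2 * \<tau>)) * of_real (r ^ 2) - of_real (b * r) - 1) \<le> r\<^sup>2 / (2 * \<tau>) + b * r + 1"
        using that b \<tau> by (intro order_trans[OF norm_triangle_ineq4] add_mono) (auto simp: norm_mult norm_divide norm_power)
      then show ?thesis by (simp add: X_def S_def norm_mult mult_right_mono)
    qed
    have "\<forall>\<^sub>F r in at_top. norm (X r) \<le> (r\<^sup>2 / (2 * \<tau>) + b * r + 1) * exp (- (b * r))"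
      using eventually_gt_at_top[of 0] by eventually_elim (use nX in auto)
    moreover have "((\<lambda>r. (r\<^sup>2 / (2 * \<tau>) + b * r + 1) * exp (- (b * r))) \<longlongrightarrow> 0) at_top"
      using b \<tau> by real_asymp
    ultimately show "(X \<longlongrightarrow> 0) at_top" by (rule Lim_null_comparison)
  qed
  also have "(LBINT r:{0<..}. f r) = 1 / of_real (4 * \<tau>\<^sup>2) * fresnel_moment b 3 \<tau>
      + (of_real (b\<^sup>2) - 3 * \<i> / of_real (2 * \<tau>)) * fresnel_moment b 1 \<tau>"
    unfolding f_def fresnel_moment_def S_def[symmetric]
    by (subst set_integral_add) (intro set_integrable_mult_right Si | simp only: set_integral_mult_right)+
  finally show ?thesis by simp
qed

lemma has_vector_derivative_fresnel_moment:
  assumes b: "b > 0" and \<tau>: "\<tau> > 0"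
  shows "(fresnel_moment b n has_vector_derivative
           - (\<i> / of_real (4 * \<tau>\<^sup>2)) * fresnel_moment b (n + 2) \<tau>) (at \<tau>)"
proof -
  define S where "S \<tau> r = exp (\<i> * of_real (r\<^sup>2 / (4 * \<tau>)) - of_real (b * r))" for \<tau> r :: real
  define f where "f = (\<lambda>\<tau> r. indicator {0<..} r *\<^sub>R (of_real (r ^ n) * S \<tau> r))"
  define f' where "f' = (\<lambda>\<tau> r. - (\<i> / of_real (4 * \<tau>\<^sup>2)) * (indicator {0<..} r *\<^sub>R (of_real (r ^ (n + 2)) * S \<tau> r)))"
  have int: "integrable lborel (\<lambda>r. indicator {0<..} r *\<^sub>R (of_real (r ^ n) * S \<tau> r))" for n \<tau>
    using set_integrable_fresnel[OF b] unfolding set_integrable_def S_def .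
  \<comment> \<open>The neighbourhood stays away from 0, so that the factor 1 / (4 t^2) is at most 1
    / \<tau>^2 throughout.\<close>
  have "((\<lambda>\<tau>. LINT r|lborel. f \<tau> r) has_vector_derivative (LINT r|lborel. f' \<tau> r)) (at \<tau>)"
  proof (rule has_vector_derivative_lebesgue_integral[where U = "{\<tau>/2<..}"
        and g = "\<lambda>r. (1 / \<tau>\<^sup>2) * (indicator {0<..} r *\<^sub>R (r powr (real (n + 2)) * exp (- (b * r))))"])
    show "integrable lborel (f t)" for t using int by (simp add: f_def)
    have "integrable lborel (f' \<tau>)" unfolding f'_def by (rule integrable_mult_right[OF int])
    then show "f' \<tau> \<in> borel_measurable lborel" by (rule borel_measurable_integrable)
    show "((\<lambda>\<tau>. f \<tau> r) has_vector_derivative f' t r) (at t)" if "t \<in> {\<tau>/2<..}" for t r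
    proof -
      have t: "t > 0" using that \<tau> by simp
      have "((\<lambda>z. of_real (indicator {0<..} r * r ^ n) * exp (\<i> * of_real (r\<^sup>2) / (4 * z) - of_real (b * r)))
          has_field_derivative f' t r) (at (of_real t))"
        using t by (auto intro!: derivative_eq_intros
            simp: f'_def S_def scaleR_conv_of_real field_simps power2_eq_square)
      from has_vector_derivative_real_field[OF this]
      show ?thesis by (simp add: f_def S_def scaleR_conv_of_real mult_ac)
    qed
    show "integrable lborel (\<lambda>r. (1 / \<tau>\<^sup>2) * (indicator {0<..} r *\<^sub>R (r powr (real (n + 2)) * exp (- (b * r)))))"
      using set_integrable_powr_exp[of "real (n + 2)" b] b unfolding set_integrable_def
      by (intro integrable_mult_right) simp
    show "norm (f' t r) \<le> (1 / \<tau>\<^sup>2) * (indicator {0<..} r *\<^sub>R (r powr (real (n + 2)) * exp (- (b * r))))"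
      if "t \<in> {\<tau>/2<..}" for t r
    proof (cases "0 < r")
      case True
      have t: "\<tau>/2 < t" "0 < t" using that \<tau> by auto
      then have "\<tau>\<^sup>2 \<le> (2 * t)\<^sup>2" using \<tau> by (intro power_mono) auto
      then have "1 / (4 * t\<^sup>2) \<le> 1 / \<tau>\<^sup>2" using \<tau> t by (intro divide_left_mono) (auto simp: power2_eq_square)
      moreover have "norm (f' t r) = 1 / (4 * t\<^sup>2) * (r ^ (n + 2) * exp (- (b * r)))"
        using True t by (simp add: f'_def S_def norm_mult norm_divide norm_power)
      moreover have "r powr (real (n + 2)) = r ^ (n + 2)" using True by (intro powr_realpow)
      moreover have "0 \<le> r ^ (n + 2) * exp (- (b * r))" using True by simp
      ultimately show ?thesis using True
        by (simp only: indicator_simps greaterThan_iff scaleR_one mult_right_mono)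
    qed (simp add: f'_def)
  qed (use \<tau> in auto)
  moreover have "(LINT r|lborel. f' \<tau> r) = - (\<i> / of_real (4 * \<tau>\<^sup>2)) * fresnel_moment b (n + 2) \<tau>"
    unfolding f'_def integral_mult_right_zero fresnel_moment_def set_lebesgue_integral_def S_def ..
  moreover have "(LINT r|lborel. f \<tau> r) = fresnel_moment b n \<tau>" for \<tau>
    unfolding f_def fresnel_moment_def set_lebesgue_integral_def S_def ..
  ultimately show ?thesis by (simp only:)
qed

text \<open>Up to a constant this is the spectral integral of sqrt \<lambda> / (\<lambda> + E) exp
  (- i \<lambda> \<tau>), with the contour rotated to \<lambda> = - i l. The oscillation becomes
  decay, and the datum becomes a Laplace transform in l.\<close>

definition bound_state_datum :: "real \<Rightarrow> real \<Rightarrow> complex" where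
  "bound_state_datum E \<tau> = (LBINT l:{0<..}. of_real (l powr (1/2) * exp (- (\<tau> * l))) / (of_real E - \<i> * of_real l))"

lemma norm_resolvent_ge: "E \<le> norm (of_real E - \<i> * of_real l)" "\<bar>l\<bar> \<le> norm (of_real E - \<i> * of_real l)"
  using abs_Re_le_cmod[of "of_real E - \<i> * of_real l"] abs_Im_le_cmod[of "of_real E - \<i> * of_real l"]
  by auto

lemma resolvent_neq_0: "E > 0 \<Longrightarrow> of_real E - \<i> * of_real l \<noteq> 0"
  using norm_resolvent_ge(1)[of E l] by auto

lemma set_integrable_datum:
  assumes E: "E > 0" and a: "a > -1" and \<tau>: "\<tau> > 0"
  shows "set_integrable lborel {0<..} (\<lambda>l. of_real (l powr a * exp (- (\<tau> * l))) / (of_real E - \<i> * of_real l))"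
proof (rule set_integrable_bound)
  show "set_integrable lborel {0<..} (\<lambda>l. 1 / E * (l powr a * exp (- (\<tau> * l))))"
    using a \<tau> by (intro set_integrable_mult_right set_integrable_powr_exp) auto
  show "set_borel_measurable lborel {0<..} (\<lambda>l. of_real (l powr a * exp (- (\<tau> * l))) / (of_real E - \<i> * of_real l))"
    unfolding set_borel_measurable_def by measurable
  show "AE l in lborel. l \<in> {0<..} \<longrightarrow> norm (of_real (l powr a * exp (- (\<tau> * l))) / (of_real E - \<i> * of_real l))
      \<le> norm (1 / E * (l powr a * exp (- (\<tau> * l))))"
  proof (intro AE_I2 impI)
    fix l
    show "norm (of_real (l powr a * exp (- (\<tau> * l))) / (of_real E - \<i> * of_real l))
      \<le> norm (1 / E * (l powr a * exp (- (\<tau> * l))))"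
      using E norm_resolvent_ge(1)[of E l] by (simp add: norm_divide norm_mult abs_mult frac_le)
  qed
qed

lemma has_vector_derivative_bound_state_datum:
  assumes E: "E > 0" and \<tau>: "\<tau> > 0"
  shows "(bound_state_datum E has_vector_derivative
     - (LBINT l:{0<..}. of_real (l powr (3/2) * exp (- (\<tau> * l))) / (of_real E - \<i> * of_real l))) (at \<tau>)"
proof -
  define f where "f = (\<lambda>\<tau> l. indicator {0<..} l *\<^sub>R (of_real (l powr (1/2) * exp (- (\<tau> * l))) / (of_real E - \<i> * of_real l)))"
  define f' where "f' = (\<lambda>\<tau> l. - (indicator {0<..} l *\<^sub>R (of_real (l powr (3/2) * exp (- (\<tau> * l))) / (of_real E - \<i> * of_real l))))"
  have "((\<lambda>\<tau>. LINT l|lborel. f \<tau> l) has_vector_derivative (LINT l|lborel. f' \<tau> l)) (at \<tau>)"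
  proof (rule has_vector_derivative_lebesgue_integral[where U = "{\<tau>/2<..}"
        and g = "\<lambda>l. (1 / E) * (indicator {0<..} l *\<^sub>R (l powr (3/2) * exp (- (\<tau> / 2 * l))))"])
    show "integrable lborel (f t)" if "t \<in> {\<tau>/2<..}" for t
      using set_integrable_datum[OF E, of "1/2" t] that \<tau> by (simp add: f_def set_integrable_def)
    have "integrable lborel (f' \<tau>)"
      using set_integrable_datum[OF E, of "3/2" \<tau>] \<tau> by (simp add: f'_def set_integrable_def)
    then show "f' \<tau> \<in> borel_measurable lborel" by (rule borel_measurable_integrable)
    show "((\<lambda>\<tau>. f \<tau> l) has_vector_derivative f' t l) (at t)" if "t \<in> {\<tau>/2<..}" for t l
    proof (cases "0 < l")
      case True
      have p: "l powr (3/2) = l * l powr (1/2)" using True powr_add[of l 1 "1/2"] by simp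
      define k where "k = of_real (l powr (1/2)) / (of_real E - \<i> * of_real l)"
      have "((\<lambda>z. k * exp (- (z * of_real l))) has_field_derivative
          k * (- of_real l * exp (- (of_real t * of_real l)))) (at (of_real t))"
        by (auto intro!: derivative_eq_intros)
      from has_vector_derivative_real_field[OF this]
      have "((\<lambda>\<tau>. f \<tau> l) has_vector_derivative k * (- of_real l * exp (- (of_real t * of_real l)))) (at t)"
        using True by (simp add: f_def k_def exp_of_real[symmetric])
      also have "k * (- of_real l * exp (- (of_real t * of_real l))) = f' t l"
        using True by (simp add: f'_def k_def p exp_of_real[symmetric])
      finally show ?thesis .
    qed (simp add: f_def f'_def)
    show "integrable lborel (\<lambda>l. (1 / E) * (indicator {0<..} l *\<^sub>R (l powr (3/2) * exp (- (\<tau> / 2 * l)))))"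
      using set_integrable_powr_exp[of "3/2" "\<tau> / 2"] \<tau> unfolding set_integrable_def
      by (intro integrable_mult_right) simp
    show "norm (f' t l) \<le> (1 / E) * (indicator {0<..} l *\<^sub>R (l powr (3/2) * exp (- (\<tau> / 2 * l))))"
      if "t \<in> {\<tau>/2<..}" for t l
    proof (cases "0 < l")
      case True
      have "norm (f' t l) = l powr (3/2) * exp (- (t * l)) / norm (of_real E - \<i> * of_real l)"
        using True by (simp add: f'_def norm_divide norm_mult)
      also have "\<dots> \<le> l powr (3/2) * exp (- (\<tau> / 2 * l)) / E"
        using E True that norm_resolvent_ge(1)[of E l] by (intro frac_le mult_left_mono) auto
      finally show ?thesis using True by simp
    qed (simp add: f'_def)
  qed (use \<tau> in auto)
  then show ?thesis
    by (simp add: f_def f'_def bound_state_datum_def[abs_def] set_lebesgue_integral_def)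
qed

text \<open>The operator i d/d\<tau> + E multiplies the integrand by E - i l and so removes the
  denominator; a Gamma integral is left.\<close>

lemma bound_state_datum_ode:
  assumes E: "E > 0" and \<tau>: "\<tau> > 0"
  shows "\<i> * (- (LBINT l:{0<..}. of_real (l powr (3/2) * exp (- (\<tau> * l))) / (of_real E - \<i> * of_real l)))
    + of_real E * bound_state_datum E \<tau> = of_real (Gamma (3/2) / \<tau> powr (3/2))"
proof -
  define h where "h a l = of_real (l powr a * exp (- (\<tau> * l))) / (of_real E - \<i> * of_real l)" for a l
  have hi: "set_integrable lborel {0<..} (h (3/2))" "set_integrable lborel {0<..} (h (1/2))"
    unfolding h_def using set_integrable_datum[OF E _ \<tau>] by auto
  have "\<i> * (- (LBINT l:{0<..}. h (3/2) l)) + of_real E * (LBINT l:{0<..}. h (1/2) l)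
      = (LBINT l:{0<..}. (- \<i>) * h (3/2) l + of_real E * h (1/2) l)"
  proof -
    have "set_integrable lborel {0<..} (\<lambda>l. (- \<i>) * h (3/2) l)" "set_integrable lborel {0<..} (\<lambda>l. of_real E * h (1/2) l)"
      by (intro set_integrable_mult_right hi)+
    then show ?thesis by (simp only: set_integral_add(2) set_integral_mult_right) simp
  qed
  also have "\<dots> = (LBINT l:{0<..}. complex_of_real (l powr (1/2) * exp (- (\<tau> * l))))"
  proof (rule set_lebesgue_integral_cong)
    show "\<forall>l. l \<in> {0<..} \<longrightarrow> (- \<i>) * h (3/2) l + of_real E * h (1/2) l = complex_of_real (l powr (1/2) * exp (- (\<tau> * l)))"
    proof (intro allI impI)
      fix l :: real assume "l \<in> {0<..}"
      then have p: "l powr (3/2) = l * l powr (1/2)" using powr_add[of l 1 "1/2"] by simp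
      show "(- \<i>) * h (3/2) l + of_real E * h (1/2) l = complex_of_real (l powr (1/2) * exp (- (\<tau> * l)))"
        unfolding h_def p using resolvent_neq_0[OF E, of l] by (simp add: divide_simps) (simp add: algebra_simps)
    qed
  qed simp
  also have "\<dots> = of_real (Gamma (3/2) / \<tau> powr (3/2))"
    unfolding set_integral_complex_of_real using \<tau> by (subst set_integral_powr_exp) auto
  finally show ?thesis by (simp only: bound_state_datum_def h_def)
qed

text \<open>The denominator is bounded below by E and by l. The first bound gives the decay at
  infinity, the second the strength of the singularity at 0.\<close>

lemma norm_bound_state_datum_le:
  assumes E: "E > 0" and \<tau>: "\<tau> > 0"
  shows "norm (bound_state_datum E \<tau>) \<le> Gamma (3/2) / E * \<tau> powr (-3/2)"
    and "norm (bound_state_datum E \<tau>) \<le> sqrt pi * \<tau> powr (-1/2)"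
proof -
  have nb: "norm (bound_state_datum E \<tau>) \<le> (LBINT l:{0<..}. l powr (1/2) * exp (- (\<tau> * l)) / norm (of_real E - \<i> * of_real l))"
  proof -
    have "norm (bound_state_datum E \<tau>) \<le> (LINT l|lborel. norm (indicator {0<..} l *\<^sub>R
        (of_real (l powr (1/2) * exp (- (\<tau> * l))) / (of_real E - \<i> * of_real l) :: complex)))"
      unfolding bound_state_datum_def set_lebesgue_integral_def by (rule integral_norm_bound)
    then show ?thesis unfolding set_lebesgue_integral_def by (simp add: norm_divide norm_mult)
  qed
  have hi: "set_integrable lborel {0<..} (\<lambda>l. l powr (1/2) * exp (- (\<tau> * l)) / norm (of_real E - \<i> * of_real l))"
    using set_integrable_norm[OF set_integrable_datum[OF E _ \<tau>, of "1/2"]] by (simp add: norm_divide norm_mult)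
  have "(LBINT l:{0<..}. l powr (1/2) * exp (- (\<tau> * l)) / norm (of_real E - \<i> * of_real l))
      \<le> (LBINT l:{0<..}. 1 / E * (l powr (1/2) * exp (- (\<tau> * l))))"
  proof (rule set_integral_mono[OF hi])
    show "set_integrable lborel {0<..} (\<lambda>l. 1 / E * (l powr (1/2) * exp (- (\<tau> * l))))"
      using \<tau> by (intro set_integrable_mult_right set_integrable_powr_exp) auto
    show "l powr (1/2) * exp (- (\<tau> * l)) / norm (of_real E - \<i> * of_real l) \<le> 1 / E * (l powr (1/2) * exp (- (\<tau> * l)))" for l
      using E norm_resolvent_ge(1)[of E l] by (simp add: frac_le)
  qed
  also have "\<dots> = Gamma (3/2) / E * \<tau> powr (-3/2)"
    unfolding set_integral_mult_right using \<tau> by (subst set_integral_powr_exp) (auto simp: powr_minus_divide)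
  finally show "norm (bound_state_datum E \<tau>) \<le> Gamma (3/2) / E * \<tau> powr (-3/2)" using nb by linarith
  have "(LBINT l:{0<..}. l powr (1/2) * exp (- (\<tau> * l)) / norm (of_real E - \<i> * of_real l))
      \<le> (LBINT l:{0<..}. l powr (-1/2) * exp (- (\<tau> * l)))"
  proof (rule set_integral_mono[OF hi])
    show "set_integrable lborel {0<..} (\<lambda>l. l powr (-1/2) * exp (- (\<tau> * l)))"
      using \<tau> by (intro set_integrable_powr_exp) auto
    fix l :: real assume l: "l \<in> {0<..}"
    then have p: "l powr (1/2) = l * l powr (-1/2)" using powr_add[of l 1 "-1/2"] by simp
    have "l powr (1/2) * exp (- (\<tau> * l)) / norm (of_real E - \<i> * of_real l) \<le> l powr (1/2) * exp (- (\<tau> * l)) / l"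
      using l norm_resolvent_ge(2)[of l E] by (intro divide_left_mono) auto
    also have "\<dots> = l powr (-1/2) * exp (- (\<tau> * l))" unfolding p using l by simp
    finally show "l powr (1/2) * exp (- (\<tau> * l)) / norm (of_real E - \<i> * of_real l) \<le> l powr (-1/2) * exp (- (\<tau> * l))" .
  qed
  also have "\<dots> = sqrt pi * \<tau> powr (-1/2)"
    using \<tau> by (subst set_integral_powr_exp) (auto simp: powr_minus_divide Gamma_one_half_real)
  finally show "norm (bound_state_datum E \<tau>) \<le> sqrt pi * \<tau> powr (-1/2)" using nb by linarith
qed

text \<open>The rotation of the contour is replaced by uniqueness for a differential equation. Both
  sides, suitably normalised, solve i y' + b^2 y = \<tau>^(-3/2), so their difference is a constant
  times exp (i b^2 \<tau>) and has constant modulus. Both sides tend to 0 at infinity, so the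
  constant is 0.\<close>

lemma fresnel_moment_eq_datum:
  assumes b: "b > 0" and \<tau>: "\<tau> > 0"
  shows "fresnel_moment b 1 \<tau> / of_real (\<tau> powr (3/2)) = bound_state_datum (b\<^sup>2) \<tau> / of_real (Gamma (3/2))"
proof -
  define N where "N \<tau> = of_real (\<tau> powr (-3/2)) * fresnel_moment b 1 \<tau>" for \<tau>
  define G where "G \<tau> = bound_state_datum (b\<^sup>2) \<tau>" for \<tau>
  define \<gamma> where "\<gamma> = complex_of_real (Gamma (3/2))"
  have G0: "Gamma (3/2 :: real) > 0" by (rule Gamma_real_pos) simp
  then have \<gamma>0: "\<gamma> \<noteq> 0" unfolding \<gamma>_def by (simp only: of_real_eq_0_iff less_imp_neq[symmetric] not_False_eq_True)
  define \<phi> where "\<phi> \<tau> = exp (- (\<i> * of_real (b\<^sup>2 * \<tau>))) * (N \<tau> - G \<tau> / \<gamma>)" for \<tau>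
  have E: "b\<^sup>2 > 0" using b by simp
  have deriv: "(\<phi> has_vector_derivative 0) (at \<tau>)" if \<tau>: "\<tau> > 0" for \<tau>
  proof -
    define M1 where "M1 = fresnel_moment b 1 \<tau>"
    define M3 where "M3 = fresnel_moment b 3 \<tau>"
    define G' where "G' = - (LBINT l:{0<..}. of_real (l powr (3/2) * exp (- (\<tau> * l))) / (of_real (b\<^sup>2) - \<i> * of_real l))"
    define s where "s = \<tau> powr (-3/2)"
    have "((\<lambda>t. t powr (-3/2)) has_real_derivative (-3/2) * \<tau> powr (-3/2 - 1)) (at \<tau>)"
      using \<tau> by (auto intro!: derivative_eq_intros)
    moreover have "\<tau> powr (-3/2 - 1) = s / \<tau>" using \<tau> powr_diff[of \<tau> "-3/2" 1] by (simp add: s_def)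
    ultimately have d1: "((\<lambda>t. complex_of_real (t powr (-3/2))) has_vector_derivative of_real ((-3/2) * (s / \<tau>))) (at \<tau>)"
      unfolding has_real_derivative_iff_has_vector_derivative
      by (metis bounded_linear.has_vector_derivative[OF bounded_linear_of_real])
    have d2: "(fresnel_moment b 1 has_vector_derivative - (\<i> / of_real (4 * \<tau>\<^sup>2)) * M3) (at \<tau>)"
      using has_vector_derivative_fresnel_moment[OF b \<tau>, of 1] by (simp add: M3_def numeral_3_eq_3)
    have dN: "(N has_vector_derivative of_real s * (- (\<i> / of_real (4 * \<tau>\<^sup>2)) * M3) + of_real ((-3/2) * (s / \<tau>)) * M1) (at \<tau>)"
      unfolding N_def using has_vector_derivative_mult[OF d1 d2] by (simp only: s_def M1_def)
    have dG: "(G has_vector_derivative G') (at \<tau>)"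
      unfolding G_def G'_def by (rule has_vector_derivative_bound_state_datum[OF E \<tau>])
    define N' where "N' = of_real s * (- (\<i> / of_real (4 * \<tau>\<^sup>2)) * M3) + of_real ((-3/2) * (s / \<tau>)) * M1"
    have N: "N \<tau> = of_real s * M1" by (simp add: N_def s_def M1_def)
    have "\<i> * N' + of_real (b\<^sup>2) * N \<tau> =
        of_real s * (M3 / of_real (4 * \<tau>\<^sup>2) + (of_real (b\<^sup>2) - 3 * \<i> / of_real (2 * \<tau>)) * M1)"
      unfolding N'_def N using \<tau> by (simp add: field_simps)
    then have odeN: "\<i> * N' + of_real (b\<^sup>2) * N \<tau> = of_real s"
      using fresnel_moment_identity[OF b \<tau>] by (simp add: M1_def M3_def)
    have odeG: "\<i> * G' + of_real (b\<^sup>2) * G \<tau> = \<gamma> * of_real s"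
      using bound_state_datum_ode[OF E \<tau>] by (simp add: G_def G'_def s_def \<gamma>_def powr_minus_divide)
    have "((\<lambda>z. exp (- (\<i> * (of_real (b\<^sup>2) * z)))) has_field_derivative
        - \<i> * of_real (b\<^sup>2) * exp (- (\<i> * (of_real (b\<^sup>2) * of_real \<tau>)))) (at (of_real \<tau>))"
      by (auto intro!: derivative_eq_intros)
    from has_vector_derivative_real_field[OF this]
    have dE: "((\<lambda>t. exp (- (\<i> * of_real (b\<^sup>2 * t)))) has_vector_derivative
        - \<i> * of_real (b\<^sup>2) * exp (- (\<i> * of_real (b\<^sup>2 * \<tau>)))) (at \<tau>)" by simp
    have dD: "((\<lambda>t. N t - G t / \<gamma>) has_vector_derivative N' - G' / \<gamma>) (at \<tau>)"
      using dN dG unfolding N'_def[symmetric] by (intro derivative_intros)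
    have e: "N' - G' / \<gamma> = \<i> * of_real (b\<^sup>2) * (N \<tau> - G \<tau> / \<gamma>)"
    proof -
      have "\<i> * (N' - G' / \<gamma>) + of_real (b\<^sup>2) * (N \<tau> - G \<tau> / \<gamma>)
          = (\<i> * N' + of_real (b\<^sup>2) * N \<tau>) - (\<i> * G' + of_real (b\<^sup>2) * G \<tau>) / \<gamma>"
        by (simp add: algebra_simps diff_divide_distrib add_divide_distrib)
      also have "\<dots> = 0" unfolding odeN odeG using \<gamma>0 by simp
      finally have "\<i> * (N' - G' / \<gamma>) = - (of_real (b\<^sup>2) * (N \<tau> - G \<tau> / \<gamma>))" by (simp only: add_eq_0_iff2)
      then have "- \<i> * (\<i> * (N' - G' / \<gamma>)) = - \<i> * (- (of_real (b\<^sup>2) * (N \<tau> - G \<tau> / \<gamma>)))" by simp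
      then show ?thesis by (simp flip: mult.assoc)
    qed
    show ?thesis
      unfolding \<phi>_def by (intro has_vector_derivative_eq_rhs[OF has_vector_derivative_mult[OF dE dD]])
        (unfold e, simp)
  qed
  obtain C where C: "\<And>\<tau>. \<tau> > 0 \<Longrightarrow> \<phi> \<tau> = C"
    using has_vector_derivative_zero_constant[of "{0<..}" \<phi>] deriv has_vector_derivative_at_within
    by (metis convex_real_interval(3) greaterThan_iff)
  have M1: "norm (fresnel_moment b 1 \<tau>) \<le> Gamma 2 / b powr 2" for \<tau>
  proof -
    have "norm (fresnel_moment b 1 \<tau>) \<le> (LINT r|lborel. norm (indicator {0<..} r *\<^sub>R
        (of_real (r ^ 1) * exp (\<i> * of_real (r\<^sup>2 / (4 * \<tau>)) - of_real (b * r)) :: complex)))"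
      unfolding fresnel_moment_def set_lebesgue_integral_def by (rule integral_norm_bound)
    also have "\<dots> = (LBINT r:{0<..}. r powr 1 * exp (- (b * r)))"
      unfolding set_lebesgue_integral_def
      by (intro Bochner_Integration.integral_cong refl) (auto simp: indicator_def norm_mult)
    also have "\<dots> = Gamma 2 / b powr 2" using b by (subst set_integral_powr_exp) auto
    finally show ?thesis .
  qed
  have "norm C \<le> (Gamma 2 / b powr 2 + 1 / b\<^sup>2) * \<tau> powr (-3/2)" if \<tau>: "\<tau> > 0" for \<tau>
  proof -
    have "norm C = norm (N \<tau> - G \<tau> / \<gamma>)" using C[OF \<tau>] by (auto simp: \<phi>_def norm_mult)
    also have "\<dots> \<le> norm (N \<tau>) + norm (G \<tau>) / Gamma (3/2)"
      using G0 by (intro order_trans[OF norm_triangle_ineq4]) (simp add: \<gamma>_def norm_divide)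
    also have "norm (N \<tau>) \<le> Gamma 2 / b powr 2 * \<tau> powr (-3/2)"
      using mult_right_mono[OF M1[of \<tau>], of "\<tau> powr (-3/2)"] by (simp add: N_def norm_mult mult.commute)
    also have "norm (G \<tau>) / Gamma (3/2) \<le> 1 / b\<^sup>2 * \<tau> powr (-3/2)"
      using norm_bound_state_datum_le(1)[OF E \<tau>] G0 by (simp add: G_def field_simps)
    finally show ?thesis by (simp add: algebra_simps)
  qed
  then have "norm C \<le> 0"
  proof (intro tendsto_lowerbound[where F = at_top and f = "\<lambda>\<tau>. (Gamma 2 / b powr 2 + 1 / b\<^sup>2) * \<tau> powr (-3/2)"])
    show "((\<lambda>\<tau>. (Gamma 2 / b powr 2 + 1 / b\<^sup>2) * \<tau> powr (-3/2)) \<longlongrightarrow> 0) at_top"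
      by (intro tendsto_mult_right_zero) real_asymp
  qed (auto intro: eventually_mono[OF eventually_gt_at_top[of 0]])
  then have "N \<tau> - G \<tau> / \<gamma> = 0" using C[OF \<tau>] by (auto simp: \<phi>_def)
  then show ?thesis using \<tau> by (simp add: N_def G_def \<gamma>_def powr_minus_divide)
qed

lemma U0_at_origin_phi_ev_eq_datum:
  assumes a: "a < 0"
  obtains \<kappa> where "\<And>\<tau>. \<tau> > 0 \<Longrightarrow>
    U0_at_origin \<tau> (phi_ev a) = \<kappa> * bound_state_datum ((4 * pi * \<bar>a\<bar>)\<^sup>2) \<tau>"
proof
  fix \<tau> :: real assume \<tau>: "\<tau> > 0"
  have eq: "fresnel_moment (4 * pi * \<bar>a\<bar>) 1 \<tau> / of_real (\<tau> powr (3/2))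
      = bound_state_datum ((4 * pi * \<bar>a\<bar>)\<^sup>2) \<tau> / of_real (Gamma (3/2))"
    using a \<tau> by (intro fresnel_moment_eq_datum mult_pos_pos) auto
  show "U0_at_origin \<tau> (phi_ev a) =
      of_real (4 * pi * sqrt (2 * \<bar>a\<bar>)) / csqrt (of_real (4 * pi) * \<i>) ^ 3 / of_real (Gamma (3/2))
      * bound_state_datum ((4 * pi * \<bar>a\<bar>)\<^sup>2) \<tau>"
    unfolding U0_at_origin_phi_ev[OF \<tau> a] eq by (simp only: times_divide_eq_right times_divide_eq_left)
qed

section \<open>Laplace moments of the free datum\<close>

lemma laplace_moment_one:
  assumes w: "Re w > 0"
  shows "laplace_moment m (\<lambda>_. 1) w = 1 / w ^ Suc m"
proof -
  have w0: "w \<noteq> 0" using w by auto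
  define h where "h = (\<lambda>m (t::real). of_real (t ^ m / fact m) * 1 * exp (- (w * of_real t)))"
  have hi: "set_integrable lborel {0<..} (h m)" for m
    unfolding h_def using w
    by (intro laplaceable_integrable laplaceableI[where s = 0 and C = 1] set_borel_measurable_half_line) auto
  have hL: "laplace_moment m (\<lambda>_. 1) w = (LBINT t:{0<..}. h m t)" for m
    by (simp add: laplace_moment_def h_def)
  have nF: "norm (h m t / w) = t ^ m / fact m * exp (- (Re w * t)) / norm w" if "t > 0" for m t
    using that by (simp add: h_def norm_mult norm_divide norm_power)
  have lim: "((\<lambda>t. - (h m t / w)) \<longlongrightarrow> 0) at_top" for m
  proof -
    have "((\<lambda>t. t ^ m / fact m * exp (- (Re w * t)) / norm w) \<longlongrightarrow> 0) at_top"
      using w w0 by real_asymp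
    moreover have "\<forall>\<^sub>F t in at_top. norm (- (h m t / w)) \<le> t ^ m / fact m * exp (- (Re w * t)) / norm w"
      using eventually_gt_at_top[of 0] by eventually_elim (use nF in auto)
    ultimately show ?thesis by (rule Lim_null_comparison[rotated])
  qed
  have lim0: "((\<lambda>t. - (h m t / w)) \<longlongrightarrow> - (h m 0 / w)) (at_right 0)" for m
  proof -
    have "isCont (\<lambda>t. - (h m t / w)) 0" unfolding h_def using w0 by (intro continuous_intros) auto
    then show ?thesis unfolding isCont_def by (rule tendsto_mono[OF at_le, rotated]) auto
  qed
  show ?thesis
  proof (induction m)
    case 0
    have "(LBINT t:{0<..}. h 0 t) = 0 - (- (h 0 0 / w))"
    proof (rule FTC_half_line[OF _ _ hi lim0 lim])
      fix t :: real
      have "((\<lambda>z. - (exp (- (w * z)) / w)) has_field_derivative h 0 t) (at (of_real t))"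
        using w0 by (auto intro!: derivative_eq_intros simp: h_def)
      from has_vector_derivative_real_field[OF this]
      show "((\<lambda>t. - (h 0 t / w)) has_vector_derivative h 0 t) (at t)" by (simp add: h_def)
    qed (auto simp: h_def intro!: continuous_intros)
    then show ?case unfolding hL by (simp add: h_def)
  next
    case (Suc m)
    have "(LBINT t:{0<..}. h (Suc m) t - (1 / w) * h m t) = 0 - (- (h (Suc m) 0 / w))"
    proof (rule FTC_half_line[OF _ _ _ lim0 lim])
      show "set_integrable lborel {0<..} (\<lambda>t. h (Suc m) t - (1 / w) * h m t)"
        by (intro set_integral_diff set_integrable_mult_right hi)
      fix t :: real
      define n where "n = complex_of_nat (Suc m)"
      define e where "e = exp (- (w * of_real t))"
      have n: "n \<noteq> 0" "fact (Suc m) = n * fact m" by (simp_all add: n_def del: of_nat_Suc)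
      have "((\<lambda>z. z ^ Suc m) has_field_derivative n * of_real t ^ m) (at (of_real t))"
        using DERIV_power[OF DERIV_ident, of "Suc m" "of_real t :: complex"] by (simp add: n_def del: of_nat_Suc power_Suc)
      moreover have "((\<lambda>z. exp (- (w * z))) has_field_derivative - w * e) (at (of_real t))"
        by (auto intro!: derivative_eq_intros simp: e_def)
      ultimately have "((\<lambda>z. - (1 / (n * fact m * w)) * (z ^ Suc m * exp (- (w * z)))) has_field_derivative
          - (1 / (n * fact m * w)) * (n * of_real t ^ m * e + - w * e * of_real t ^ Suc m)) (at (of_real t))"
        unfolding e_def by (intro DERIV_cmult DERIV_mult)
      moreover have "- (1 / (n * fact m * w)) * (n * of_real t ^ m * e + - w * e * of_real t ^ Suc m)
          = h (Suc m) t - (1 / w) * h m t"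
        using n(1) w0 unfolding h_def e_def[symmetric] of_real_divide of_real_fact n(2) of_real_power
        by (simp add: field_simps del: power_Suc)
      ultimately have "((\<lambda>z. - (1 / (n * fact m * w)) * (z ^ Suc m * exp (- (w * z)))) has_field_derivative
          h (Suc m) t - (1 / w) * h m t) (at (of_real t))" by simp
      from has_vector_derivative_real_field[OF this]
      show "((\<lambda>t. - (h (Suc m) t / w)) has_vector_derivative h (Suc m) t - (1 / w) * h m t) (at t)"
        unfolding h_def of_real_divide of_real_fact n(2) of_real_power by (simp add: mult_ac del: power_Suc)
    next
      show "continuous_on {0<..} (\<lambda>t. h (Suc m) t - (1 / w) * h m t)"
        unfolding h_def using w0 by (intro continuous_intros) (auto simp del: fact_Suc)
    qed
    moreover have "(LBINT t:{0<..}. h (Suc m) t - (1 / w) * h m t)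
        = (LBINT t:{0<..}. h (Suc m) t) - (1 / w) * (LBINT t:{0<..}. h m t)"
      using set_integral_diff(2)[OF hi set_integrable_mult_right[OF hi]] by (simp only: set_integral_mult_right)
    moreover have "h (Suc m) 0 = 0" by (simp add: h_def)
    ultimately show ?case using Suc unfolding hL by simp
  qed
qed

text \<open>All moment bounds for the datum are reduced to this integral; the antiderivative is an
  arctangent of sqrt l.\<close>

lemma set_integral_inverse_sqrt_shift:
  assumes \<rho>: "\<rho> > 0"
  shows "set_integrable lborel {0<..} (\<lambda>l::real. 1 / (sqrt l * (l + \<rho>)))"
    and "(LBINT l:{0<..}. 1 / (sqrt l * (l + \<rho>))) = pi / sqrt \<rho>"
proof -
  define F where "F l = 2 / sqrt \<rho> * arctan (sqrt l / sqrt \<rho>)" for l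
  have A: "((F \<circ> real_of_ereal) \<longlongrightarrow> 0) (at_right 0)"
  proof -
    have "(F \<longlongrightarrow> 0) (at_right 0)" unfolding F_def using \<rho> by real_asymp
    then show ?thesis by (simp add: zero_ereal_def ereal_tendsto_simps1)
  qed
  have B: "((F \<circ> real_of_ereal) \<longlongrightarrow> pi / sqrt \<rho>) (at_left \<infinity>)"
  proof -
    have "filterlim (\<lambda>l. sqrt l / sqrt \<rho>) at_top at_top" using \<rho> by real_asymp
    then have "((\<lambda>l. arctan (sqrt l / sqrt \<rho>)) \<longlongrightarrow> pi / 2) at_top"
      by (rule filterlim_compose[OF tendsto_arctan_at_top])
    then have "(F \<longlongrightarrow> 2 / sqrt \<rho> * (pi / 2)) at_top" unfolding F_def by (rule tendsto_mult_left)
    then show ?thesis by (simp add: ereal_tendsto_simps1)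
  qed
  have d: "DERIV F l :> 1 / (sqrt l * (l + \<rho>))" if "0 < ereal l" for l
  proof -
    have l: "l > 0" using that by simp
    have "DERIV F l :> 2 / sqrt \<rho> * (inverse (1 + (sqrt l / sqrt \<rho>)\<^sup>2) * (inverse (sqrt l) / 2 / sqrt \<rho>))"
      unfolding F_def using l \<rho>
      by (intro DERIV_cmult DERIV_chain2[where f = arctan] DERIV_arctan DERIV_cdivide DERIV_real_sqrt)
    moreover have "2 / sqrt \<rho> * (inverse (1 + (sqrt l / sqrt \<rho>)\<^sup>2) * (inverse (sqrt l) / 2 / sqrt \<rho>))
        = 1 / (sqrt l * (l + \<rho>))"
    proof -
      define x where "x = sqrt \<rho>"
      have x: "x > 0" "\<rho> = x * x" using \<rho> by (auto simp: x_def)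
      have "1 + (sqrt l / x)\<^sup>2 = (l + x * x) / (x * x)" using x(1) l by (simp add: field_simps power2_eq_square)
      then show ?thesis unfolding x_def[symmetric] unfolding x(2) using x(1) l
        by (simp add: inverse_eq_divide)
    qed
    ultimately show ?thesis by simp
  qed
  have c: "isCont (\<lambda>l. 1 / (sqrt l * (l + \<rho>))) l" if "0 < ereal l" for l
    using that \<rho> by (intro continuous_intros) auto
  have nn: "AE l in lborel. 0 < ereal l \<longrightarrow> ereal l < \<infinity> \<longrightarrow> 0 \<le> 1 / (sqrt l * (l + \<rho>))"
    using \<rho> by auto
  have e: "einterval 0 \<infinity> = {0<..}" by (simp add: einterval_def greaterThan_def)
  show "set_integrable lborel {0<..} (\<lambda>l::real. 1 / (sqrt l * (l + \<rho>)))"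
    using interval_integral_FTC_nonneg(1)[OF _ d c nn A B] unfolding e by simp
  show "(LBINT l:{0<..}. 1 / (sqrt l * (l + \<rho>))) = pi / sqrt \<rho>"
    using interval_integral_FTC_nonneg(2)[OF _ d c nn A B]
    by (simp add: interval_lebesgue_integral_def e)
qed

lemma continuous_on_bound_state_datum:
  assumes "E > 0"
  shows "continuous_on {0<..} (bound_state_datum E)"
  using has_vector_derivative_bound_state_datum[OF assms]
  by (intro continuous_at_imp_continuous_on ballI has_vector_derivative_continuous) auto

text \<open>The m-th moment of exp (- l t) is 1 / (p + l)^(m+1), so Fubini turns the moments of the
  datum into Stieltjes integrals, in which the behaviour near p = 0 is explicit. Joint integrability
  holds because the inner absolute integral is at most sqrt pi t^(-1/2).\<close>

lemma laplace_moment_datum: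
  assumes E: "E > 0" and p: "Re p > 0"
  shows "set_integrable lborel {0<..} (\<lambda>l. of_real (sqrt l) / ((of_real E - \<i> * of_real l) * (p + of_real l) ^ Suc m))"
    and "laplace_moment m (bound_state_datum E) p =
      (LBINT l:{0<..}. of_real (sqrt l) / ((of_real E - \<i> * of_real l) * (p + of_real l) ^ Suc m))"
proof -
  define u where "u t = indicator {0<..} t *\<^sub>R (of_real (t ^ m / fact m) * exp (- (p * of_real t)))" for t :: real
  define v where "v l = indicator {0<..} l *\<^sub>R (of_real (sqrt l) / (of_real E - \<i> * of_real l))" for l :: real
  define f where "f t l = u t * (v l * of_real (exp (- (t * l))))" for t l
  have [measurable]: "u \<in> borel_measurable borel" "v \<in> borel_measurable borel"
    unfolding u_def v_def by measurable
  have vi: "integrable lborel (\<lambda>l. v l * of_real (exp (- (t * l))))" if "t > 0" for t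
  proof -
    have "integrable lborel (\<lambda>l. indicator {0<..} l *\<^sub>R (of_real (l powr (1/2) * exp (- (t * l))) / (of_real E - \<i> * of_real l) :: complex))"
      using set_integrable_datum[OF E _ that, of "1/2"] by (simp add: set_integrable_def)
    then show ?thesis
      by (rule Bochner_Integration.integrable_cong[THEN iffD1, rotated -1])
        (auto simp: v_def indicator_def powr_half_sqrt)
  qed
  have vD: "(LINT l|lborel. v l * of_real (exp (- (t * l)))) = bound_state_datum E t" for t
    unfolding bound_state_datum_def set_lebesgue_integral_def
    by (intro Bochner_Integration.integral_cong refl) (auto simp: v_def indicator_def powr_half_sqrt)
  have vn: "(LINT l|lborel. norm (v l * of_real (exp (- (t * l))))) \<le> sqrt pi * t powr (-1/2)" if t: "t > 0" for t
  proof -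
    have "(LINT l|lborel. norm (v l * of_real (exp (- (t * l))))) \<le> (LINT l|lborel. indicator {0<..} l *\<^sub>R (l powr (-1/2) * exp (- (t * l))))"
    proof (rule integral_mono)
      show "integrable lborel (\<lambda>l. norm (v l * of_real (exp (- (t * l)))))" using vi[OF t] by (rule integrable_norm)
      show "integrable lborel (\<lambda>l. indicator {0<..} l *\<^sub>R (l powr (-1/2) * exp (- (t * l))))"
        using set_integrable_powr_exp[of "-1/2" t] t by (simp add: set_integrable_def)
      show "norm (v l * of_real (exp (- (t * l)))) \<le> indicator {0<..} l *\<^sub>R (l powr (-1/2) * exp (- (t * l)))" for l
      proof (cases "0 < l")
        case True
        have "norm (v l) = sqrt l / norm (of_real E - \<i> * of_real l)" using True by (simp add: v_def norm_divide)
        also have "\<dots> \<le> sqrt l / l" using True norm_resolvent_ge(2)[of l E] by (intro divide_left_mono) auto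
        also have "\<dots> = 1 / sqrt l" using True by (simp add: field_simps)
        also have "\<dots> = l powr (-1/2)" using True by (rule inverse_sqrt_powr)
        finally show ?thesis using True by (simp add: norm_mult mult_right_mono)
      qed (simp add: v_def)
    qed
    also have "\<dots> = sqrt pi * t powr (-1/2)"
      using set_integral_powr_exp[of "-1/2" t] t
      by (simp add: set_lebesgue_integral_def powr_minus_divide Gamma_one_half_real)
    finally show ?thesis .
  qed
  have fint: "integrable (lborel \<Otimes>\<^sub>M lborel) (case_prod f)"
  proof (rule lborel_pair.Fubini_integrable)
    show "case_prod f \<in> borel_measurable (lborel \<Otimes>\<^sub>M lborel)" unfolding f_def by measurable
    show "AE t in lborel. integrable lborel (\<lambda>l. case (t, l) of (t, l) \<Rightarrow> f t l)"
    proof (intro AE_I2)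
      fix t show "integrable lborel (\<lambda>l. case (t, l) of (t, l) \<Rightarrow> f t l)"
        using vi[of t] by (cases "t > 0") (auto simp: f_def u_def)
    qed
    have eq: "(LINT l|lborel. norm (case (t, l) of (t, l) \<Rightarrow> f t l)) = norm (u t) * (LINT l|lborel. norm (v l * of_real (exp (- (t * l)))))" for t
      by (simp add: f_def norm_mult)
    show "integrable lborel (\<lambda>t. LINT l|lborel. norm (case (t, l) of (t, l) \<Rightarrow> f t l))"
      unfolding eq
    proof (rule Bochner_Integration.integrable_bound)
      show "integrable lborel (\<lambda>t. sqrt pi / fact m * (indicator {0<..} t *\<^sub>R (t powr (real m - 1/2) * exp (- (Re p * t)))))"
        using set_integrable_powr_exp[of "real m - 1/2" "Re p"] p unfolding set_integrable_def
        by (intro integrable_mult_right) simp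
      show "(\<lambda>t. norm (u t) * (LINT l|lborel. norm (v l * of_real (exp (- (t * l)))))) \<in> borel_measurable lborel"
        by measurable
      show "AE t in lborel. norm (norm (u t) * (LINT l|lborel. norm (v l * of_real (exp (- (t * l))))))
          \<le> norm (sqrt pi / fact m * (indicator {0<..} t *\<^sub>R (t powr (real m - 1/2) * exp (- (Re p * t)))))"
      proof (intro AE_I2)
        fix t
        show "norm (norm (u t) * (LINT l|lborel. norm (v l * of_real (exp (- (t * l))))))
          \<le> norm (sqrt pi / fact m * (indicator {0<..} t *\<^sub>R (t powr (real m - 1/2) * exp (- (Re p * t)))))"
        proof (cases "t > 0")
          case True
          have nu: "norm (u t) = t ^ m / fact m * exp (- (Re p * t))" using True by (simp add: u_def norm_mult norm_divide norm_power)
          have pw: "t powr (real m - 1/2) = t ^ m * t powr (-1/2)"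
            using True powr_add[of t "real m" "-1/2"] by (simp add: powr_realpow)
          have "norm (u t) * (LINT l|lborel. norm (v l * of_real (exp (- (t * l)))))
              \<le> norm (u t) * (sqrt pi * t powr (-1/2))"
            by (intro mult_left_mono vn True) auto
          also have "\<dots> = sqrt pi / fact m * (t powr (real m - 1/2) * exp (- (Re p * t)))"
            unfolding nu pw by simp
          finally show ?thesis using True by (simp add: abs_mult)
        qed (simp add: u_def)
      qed
    qed
  qed
  have inner: "(LINT t|lborel. f t l) = indicator {0<..} l *\<^sub>R (of_real (sqrt l) / ((of_real E - \<i> * of_real l) * (p + of_real l) ^ Suc m))" for l
  proof (cases "l > 0")
    case True
    have "(LINT t|lborel. f t l) = (LINT t|lborel. v l * (indicator {0<..} t *\<^sub>R (of_real (t ^ m / fact m) * 1 * exp (- ((p + of_real l) * of_real t)))))"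
    proof (intro Bochner_Integration.integral_cong refl)
      fix t :: real
      have "exp (- ((p + of_real l) * of_real t)) = exp (- (p * of_real t)) * of_real (exp (- (t * l)))"
        unfolding exp_of_real[symmetric] exp_add[symmetric] by (simp add: algebra_simps)
      then show "f t l = v l * (indicator {0<..} t *\<^sub>R (of_real (t ^ m / fact m) * 1 * exp (- ((p + of_real l) * of_real t))))"
        by (simp add: f_def u_def scaleR_conv_of_real)
    qed
    also have "\<dots> = v l * laplace_moment m (\<lambda>_. 1) (p + of_real l)"
      unfolding integral_mult_right_zero laplace_moment_def set_lebesgue_integral_def ..
    also have "\<dots> = v l / (p + of_real l) ^ Suc m"
      using True p by (subst laplace_moment_one) auto
    finally show ?thesis using True by (simp add: v_def)
  qed (simp add: f_def v_def)
  have "integrable lborel (\<lambda>l. LINT t|lborel. f t l)"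
    using lborel_pair.integrable_snd[OF fint] by simp
  then show "set_integrable lborel {0<..} (\<lambda>l. of_real (sqrt l) / ((of_real E - \<i> * of_real l) * (p + of_real l) ^ Suc m))"
    unfolding set_integrable_def inner .
  have "laplace_moment m (bound_state_datum E) p = (LINT t|lborel. (LINT l|lborel. f t l))"
    unfolding laplace_moment_def set_lebesgue_integral_def f_def integral_mult_right_zero vD
    by (intro Bochner_Integration.integral_cong refl) (simp add: u_def scaleR_conv_of_real)
  also have "\<dots> = (LINT l|lborel. (LINT t|lborel. f t l))"
    using lborel_pair.Fubini_integral[OF fint] by simp
  finally show "laplace_moment m (bound_state_datum E) p =
      (LBINT l:{0<..}. of_real (sqrt l) / ((of_real E - \<i> * of_real l) * (p + of_real l) ^ Suc m))"
    unfolding inner set_lebesgue_integral_def .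
qed

lemma norm_halfplane_add_ge:
  assumes "0 \<le> Re p" "0 \<le> l"
  shows "l \<le> norm (p + of_real l)" "norm p \<le> norm (p + of_real l)" "(l + norm p) / 2 \<le> norm (p + of_real l)"
proof -
  show 1: "l \<le> norm (p + of_real l)"
    using abs_Re_le_cmod[of "p + of_real l"] assms by simp
  have "(norm p)\<^sup>2 \<le> (norm (p + of_real l))\<^sup>2"
    using assms by (simp add: cmod_power2 power2_sum)
  then show 2: "norm p \<le> norm (p + of_real l)" by (rule power2_le_imp_le) simp
  show "(l + norm p) / 2 \<le> norm (p + of_real l)" using add_mono[OF 1 2] by simp
qed

text \<open>The datum obeys the scale |p|^(1/2-m) that the charge will be shown to obey. For the
  zeroth moment, |p + l| is bounded below by l and the resolvent by (l + E) / 2. For higher moments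
  the resolvent contributes only E; one factor p + l is bounded below by l, one by (l + |p|) / 2,
  and each remaining one by |p|.\<close>

lemma norm_laplace_moment_datum_le:
  assumes E: "E > 0" and p: "Re p > 0"
  shows "norm (laplace_moment 0 (bound_state_datum E) p) \<le> 2 * pi / sqrt E"
    and "norm (laplace_moment (Suc m) (bound_state_datum E) p) \<le> 2 * pi / E / (sqrt (norm p) * norm p ^ m)"
proof -
  define h where "h m l = of_real (sqrt l) / ((of_real E - \<i> * of_real l) * (p + of_real l) ^ Suc m)" for m l
  have \<rho>: "norm p > 0" using p by auto
  have gen: "norm (laplace_moment m (bound_state_datum E) p) \<le> K * (pi / sqrt r)"
    if "r > 0" and b: "\<And>l. l > 0 \<Longrightarrow> norm (h m l) \<le> K * (1 / (sqrt l * (l + r)))" for m K r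
  proof -
    have "norm (laplace_moment m (bound_state_datum E) p) \<le> (LINT l|lborel. norm (indicator {0<..} l *\<^sub>R h m l))"
      unfolding laplace_moment_datum(2)[OF E p] set_lebesgue_integral_def h_def by (rule integral_norm_bound)
    also have "\<dots> \<le> (LINT l|lborel. indicator {0<..} l *\<^sub>R (K * (1 / (sqrt l * (l + r)))))"
    proof (rule integral_mono)
      show "integrable lborel (\<lambda>l. norm (indicator {0<..} l *\<^sub>R h m l))"
        using laplace_moment_datum(1)[OF E p, of m] unfolding set_integrable_def h_def by (rule integrable_norm)
      show "integrable lborel (\<lambda>l. indicator {0<..} l *\<^sub>R (K * (1 / (sqrt l * (l + r)))))"
        using set_integral_inverse_sqrt_shift(1)[OF \<open>r > 0\<close>]
        by (fold set_integrable_def) (intro set_integrable_mult_right)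
      show "norm (indicator {0<..} l *\<^sub>R h m l) \<le> indicator {0<..} l *\<^sub>R (K * (1 / (sqrt l * (l + r))))" for l
        using b[of l] by (simp add: indicator_def)
    qed
    also have "\<dots> = K * (LBINT l:{0<..}. 1 / (sqrt l * (l + r)))"
      by (fold set_lebesgue_integral_def) (rule set_integral_mult_right)
    finally show ?thesis unfolding set_integral_inverse_sqrt_shift(2)[OF \<open>r > 0\<close>] .
  qed
  have nh: "norm (h m l) = sqrt l / (norm (of_real E - \<i> * of_real l) * norm (p + of_real l) ^ Suc m)" if "l > 0" for m l
    using that by (simp add: h_def norm_divide norm_mult norm_power)
  have sl: "sqrt l / l = 1 / sqrt l" if "l > 0" for l :: real using that by (simp add: field_simps)
  have "norm (laplace_moment 0 (bound_state_datum E) p) \<le> 2 * (pi / sqrt E)"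
  proof (rule gen[OF E])
    fix l :: real assume l: "l > 0"
    have "(l + E) / 2 \<le> norm (of_real E - \<i> * of_real l)" using add_mono[OF norm_resolvent_ge(2)[of l E] norm_resolvent_ge(1)[of E l]] l by simp
    then have "norm (h 0 l) \<le> sqrt l / ((l + E) / 2 * l)"
      unfolding nh[OF l] using l E norm_halfplane_add_ge(1)[of p l] p
      by (intro divide_left_mono mult_mono mult_pos_pos) (auto intro: less_le_trans)
    also have "\<dots> = sqrt l / l * (2 / (l + E))" by simp
    also have "\<dots> = 2 * (1 / (sqrt l * (l + E)))" unfolding sl[OF l] by simp
    finally show "norm (h 0 l) \<le> 2 * (1 / (sqrt l * (l + E)))" .
  qed
  then show "norm (laplace_moment 0 (bound_state_datum E) p) \<le> 2 * pi / sqrt E" by simp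
  have "norm (laplace_moment (Suc m) (bound_state_datum E) p) \<le> 2 / (E * norm p ^ m) * (pi / sqrt (norm p))"
  proof (rule gen[OF \<rho>])
    fix l :: real assume l: "l > 0"
    have "E * (l * ((l + norm p) / 2 * norm p ^ m)) \<le> norm (of_real E - \<i> * of_real l) * (norm (p + of_real l) * (norm (p + of_real l) * norm (p + of_real l) ^ m))"
      using l E p norm_resolvent_ge(1)[of E l] norm_halfplane_add_ge[of p l]
      by (intro mult_mono power_mono) auto
    then have "norm (h (Suc m) l) \<le> sqrt l / (E * (l * ((l + norm p) / 2 * norm p ^ m)))"
      unfolding nh[OF l] power_Suc using l E \<rho> less_le_trans[OF l norm_halfplane_add_ge(1)[of p l]] p
        add_pos_nonneg[OF l norm_ge_zero[of p]]
      by (intro divide_left_mono mult_pos_pos zero_less_power) (auto simp: resolvent_neq_0)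
    also have "\<dots> = sqrt l / l * (2 / (E * (l + norm p) * norm p ^ m))" by simp
    also have "\<dots> = 2 / (E * norm p ^ m) * (1 / (sqrt l * (l + norm p)))" unfolding sl[OF l] by simp
    finally show "norm (h (Suc m) l) \<le> 2 / (E * norm p ^ m) * (1 / (sqrt l * (l + norm p)))" .
  qed
  then show "norm (laplace_moment (Suc m) (bound_state_datum E) p) \<le> 2 * pi / E / (sqrt (norm p) * norm p ^ m)"
    by (simp add: mult_ac)
qed

section \<open>Weighted Gronwall inequality\<close>

lemma set_integral_inverse_sqrt:
  fixes t :: real
  assumes t: "t > 0"
  shows "set_integrable lborel {0<..<t} (\<lambda>s. 1 / sqrt s)"
    and "(LBINT s:{0<..<t}. 1 / sqrt s) = 2 * sqrt t"
proof -
  have A: "(((\<lambda>s. 2 * sqrt s) \<circ> real_of_ereal) \<longlongrightarrow> 2 * sqrt 0) (at_right 0)"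
    unfolding zero_ereal_def ereal_tendsto_simps1 by (intro tendsto_intros)
  have B: "(((\<lambda>s. 2 * sqrt s) \<circ> real_of_ereal) \<longlongrightarrow> 2 * sqrt t) (at_left (ereal t))"
    unfolding ereal_tendsto_simps1 by (intro tendsto_intros)
  have d: "DERIV (\<lambda>s. 2 * sqrt s) s :> 1 / sqrt s" if "0 < ereal s" for s
    using that by (auto intro!: derivative_eq_intros simp: divide_simps)
  have c: "isCont (\<lambda>s. 1 / sqrt s) s" if "0 < ereal s" for s
    using that by (intro continuous_intros) auto
  have nn: "AE s in lborel. 0 < ereal s \<longrightarrow> ereal s < ereal t \<longrightarrow> 0 \<le> 1 / sqrt s" by auto
  have e: "einterval 0 (ereal t) = {0<..<t}" by (auto simp: einterval_def)
  have "0 < ereal t" using t by simp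
  note FTC = interval_integral_FTC_nonneg[OF this d c nn A B]
  show "set_integrable lborel {0<..<t} (\<lambda>s. 1 / sqrt s)" using FTC(1) unfolding e by simp
  show "(LBINT s:{0<..<t}. 1 / sqrt s) = 2 * sqrt t"
    using FTC(2) t by (simp add: interval_lebesgue_integral_def e)
qed

lemma set_integral_reflect:
  fixes f :: "real \<Rightarrow> 'a::{banach, second_countable_topology}"
  assumes "set_integrable lborel {0<..<t} f"
  shows "set_integrable lborel {0<..<t} (\<lambda>s. f (t - s))"
    and "(LBINT s:{0<..<t}. f (t - s)) = (LBINT s:{0<..<t}. f s)"
proof -
  have i: "indicator {0<..<t} (t - s) = (indicator {0<..<t} s :: real)" for s
    by (auto simp: indicator_def)
  show "set_integrable lborel {0<..<t} (\<lambda>s. f (t - s))"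
    using lborel_integrable_real_affine[of "\<lambda>s. indicator {0<..<t} s *\<^sub>R f s" "-1" t] assms
    by (simp add: set_integrable_def i)
  show "(LBINT s:{0<..<t}. f (t - s)) = (LBINT s:{0<..<t}. f s)"
    using lborel_integral_real_affine[of "-1" "\<lambda>s. indicator {0<..<t} s *\<^sub>R f s" t]
    by (simp add: set_lebesgue_integral_def i)
qed

text \<open>The exact value is pi, the mass of the arcsine law. The cruder 6 comes from cutting at t
  / 2: on each half one of the two factors is at most sqrt (2 / t).\<close>

lemma set_integral_arcsine:
  fixes t :: real
  assumes t: "t > 0"
  shows "set_integrable lborel {0<..<t} (\<lambda>s. 1 / (sqrt (t - s) * sqrt s))"
    and "(LBINT s:{0<..<t}. 1 / (sqrt (t - s) * sqrt s)) \<le> 6"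
proof -
  have int: "set_integrable lborel {0<..<t} (\<lambda>s. sqrt (2 / t) * (1 / sqrt s + 1 / sqrt (t - s)))"
    using set_integral_inverse_sqrt(1)[OF t] set_integral_reflect(1)[OF set_integral_inverse_sqrt(1)[OF t]]
    by (intro set_integrable_mult_right set_integral_add)
  have le: "1 / (sqrt (t - s) * sqrt s) \<le> sqrt (2 / t) * (1 / sqrt s + 1 / sqrt (t - s))"
    if "s \<in> {0<..<t}" for s
  proof -
    have half: "1 / sqrt x \<le> sqrt (2 / t)" if "t / 2 \<le> x" for x
    proof -
      have "sqrt (1 / x) \<le> sqrt (2 / t)" using that t by (simp add: field_simps)
      then show ?thesis by (simp add: real_sqrt_divide)
    qed
    have pos: "0 < sqrt s" "0 < sqrt (t - s)" using that by auto
    show ?thesis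
    proof (cases "t / 2 \<le> s")
      case True
      have "1 / (sqrt (t - s) * sqrt s) = 1 / sqrt s * (1 / sqrt (t - s))" by simp
      also have "\<dots> \<le> sqrt (2 / t) * (1 / sqrt s + 1 / sqrt (t - s))"
        using half[OF True] pos by (intro mult_mono) auto
      finally show ?thesis .
    next
      case False
      then have "t / 2 \<le> t - s" by simp
      have "1 / (sqrt (t - s) * sqrt s) = 1 / sqrt (t - s) * (1 / sqrt s)" by simp
      also have "\<dots> \<le> sqrt (2 / t) * (1 / sqrt s + 1 / sqrt (t - s))"
        using half[OF \<open>t / 2 \<le> t - s\<close>] pos by (intro mult_mono) auto
      finally show ?thesis .
    qed
  qed
  show int2: "set_integrable lborel {0<..<t} (\<lambda>s. 1 / (sqrt (t - s) * sqrt s))"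
  proof (rule set_integrable_bound[OF int])
    show "set_borel_measurable lborel {0<..<t} (\<lambda>s. 1 / (sqrt (t - s) * sqrt s))"
      unfolding set_borel_measurable_def by measurable
    show "AE s in lborel. s \<in> {0<..<t} \<longrightarrow> norm (1 / (sqrt (t - s) * sqrt s)) \<le> norm (sqrt (2 / t) * (1 / sqrt s + 1 / sqrt (t - s)))"
      using le by (intro AE_I2 impI) (auto intro!: order_trans[OF _ abs_ge_self])
  qed
  have "(LBINT s:{0<..<t}. 1 / (sqrt (t - s) * sqrt s)) \<le> (LBINT s:{0<..<t}. sqrt (2 / t) * (1 / sqrt s + 1 / sqrt (t - s)))"
    by (rule set_integral_mono[OF int2 int le])
  also have "\<dots> = sqrt (2 / t) * (2 * sqrt t + 2 * sqrt t)"
    using set_integral_inverse_sqrt[OF t] set_integral_reflect[OF set_integral_inverse_sqrt(1)[OF t]]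
    by (simp add: set_integral_add)
  also have "\<dots> = 4 * sqrt 2" using t by (simp add: real_sqrt_divide)
  also have "sqrt 2 \<le> 3/2" by (rule real_le_lsqrt) (auto simp: power2_eq_square)
  finally show "(LBINT s:{0<..<t}. 1 / (sqrt (t - s) * sqrt s)) \<le> 6" by simp
qed

lemma set_integral_abel_exp_le:
  fixes t :: real
  assumes t: "t > 0" and \<Lambda>: "\<Lambda> > 0"
  shows "set_integrable lborel {0<..<t} (\<lambda>s. exp (- (\<Lambda> * (t - s))) / sqrt (t - s))"
    and "(LBINT s:{0<..<t}. exp (- (\<Lambda> * (t - s))) / sqrt (t - s)) \<le> sqrt (pi / \<Lambda>)"
proof -
  let ?f = "\<lambda>s. s powr (-1/2) * exp (- (\<Lambda> * s))"
  have int: "set_integrable lborel {0<..} ?f" using \<Lambda> by (intro set_integrable_powr_exp) auto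
  have int2: "set_integrable lborel {0<..<t} ?f"
    by (rule set_integrable_subset[OF int]) auto
  have eq: "exp (- (\<Lambda> * (t - s))) / sqrt (t - s) = ?f (t - s)" if "s \<in> {0<..<t}" for s
    using inverse_sqrt_powr[of "t - s"] that by (simp add: field_simps)
  show "set_integrable lborel {0<..<t} (\<lambda>s. exp (- (\<Lambda> * (t - s))) / sqrt (t - s))"
    using set_integral_reflect(1)[OF int2] by (rule set_integrable_cong[THEN iffD1, rotated -1]) (auto simp: eq)
  have "(LBINT s:{0<..<t}. exp (- (\<Lambda> * (t - s))) / sqrt (t - s)) = (LBINT s:{0<..<t}. ?f (t - s))"
    by (rule set_lebesgue_integral_cong) (auto simp: eq)
  also have "\<dots> = (LBINT s:{0<..<t}. ?f s)" by (rule set_integral_reflect(2)[OF int2])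
  also have "\<dots> \<le> (LBINT s:{0<..}. ?f s)"
    unfolding set_lebesgue_integral_def
    using int int2 by (intro integral_mono) (auto simp: set_integrable_def indicator_def)
  also have "\<dots> = sqrt (pi / \<Lambda>)"
    using \<Lambda> by (subst set_integral_powr_exp) (auto simp: Gamma_one_half_real powr_half_sqrt real_sqrt_divide)
  finally show "(LBINT s:{0<..<t}. exp (- (\<Lambda> * (t - s))) / sqrt (t - s)) \<le> sqrt (pi / \<Lambda>)" .
qed

lemma bounded_initial_segment:
  fixes q :: "real \<Rightarrow> complex"
  assumes q: "continuous_on {0<..} q" "bounded (q ` {0<..1})"
  obtains B where "\<And>s. 0 < s \<Longrightarrow> s \<le> t \<Longrightarrow> norm (q s) \<le> B"
proof -
  have "compact (q ` {1..t})" by (intro compact_continuous_image continuous_on_subset[OF q(1)]) auto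
  then have "bounded (q ` ({0<..1} \<union> {1..t}))" using q(2) by (simp add: image_Un compact_imp_bounded)
  then have "bounded (q ` {0<..t})" by (rule bounded_subset) (intro image_mono, auto)
  then obtain B where "\<forall>x\<in>q ` {0<..t}. norm x \<le> B" unfolding bounded_iff by blast
  then show thesis by (intro that[of B]) auto
qed

text \<open>A growth rate \<open>\<mu>\<close> of the weight costs as much damping, so
  \<open>v\<close> times the solution satisfies the inequality with damping
  \<open>\<Lambda> - \<mu>\<close>. That kernel has mass at most sqrt (pi / (\<Lambda> - \<mu>)),
  hence the supremum M of the weighted solution satisfies M <= A + M / 2. Decaying exponential
  weights serve to bound growth rates, the weight (1 + t)^(3/2) to prove decay.\<close>

lemma weighted_abel_gronwall:
  fixes q :: "real \<Rightarrow> complex" and v a :: "real \<Rightarrow> real"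
  assumes q: "continuous_on {0<..} q" "bounded (q ` {0<..1})"
    and v: "continuous_on {0..} v" "\<And>t. t \<ge> 0 \<Longrightarrow> 0 < v t"
      "\<And>s t. 0 < s \<Longrightarrow> s < t \<Longrightarrow> v t \<le> v s * exp (\<mu> * (t - s))"
    and ineq: "\<And>t. t > 0 \<Longrightarrow> norm (q t) \<le> a t
        + c * (LBINT s:{0<..<t}. exp (- (\<Lambda> * (t - s))) / sqrt (t - s) * norm (q s))"
    and a: "\<And>t. t > 0 \<Longrightarrow> v t * a t \<le> A"
    and c: "0 \<le> c" "\<mu> < \<Lambda>" "c * sqrt (pi / (\<Lambda> - \<mu>)) \<le> 1/2" and t: "t > 0"
  shows "v t * norm (q t) \<le> 2 * A"
proof -
  define W where "W = (\<lambda>s. v s * norm (q s)) ` {0<..t}"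
  obtain B1 where B1: "\<And>s. 0 < s \<Longrightarrow> s \<le> t \<Longrightarrow> norm (q s) \<le> B1"
    using bounded_initial_segment[OF q] by blast
  have "compact (v ` {0..t})" by (intro compact_continuous_image continuous_on_subset[OF v(1)]) auto
  then have "bounded (v ` {0..t})" by (rule compact_imp_bounded)
  then obtain B2 where "\<forall>x\<in>v ` {0..t}. norm x \<le> B2" unfolding bounded_iff by blast
  then have B2: "\<bar>v s\<bar> \<le> B2" if "0 \<le> s" "s \<le> t" for s using that by simp
  \<comment> \<open>Absorbing half of the supremum is legitimate only because it is finite; this
    rests on continuity of \<open>q\<close> away from 0 and boundedness near 0.\<close>
  have "bdd_above W" unfolding W_def
  proof (rule bdd_aboveI2)
    fix s assume "s \<in> {0<..t}"
    then show "v s * norm (q s) \<le> B2 * B1"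
      using B1[of s] B2[of s] v(2)[of s] by (intro mult_mono) auto
  qed
  define M where "M = Sup W"
  have W: "v s * norm (q s) \<le> M" if "0 < s" "s \<le> t" for s
    unfolding M_def using that by (intro cSup_upper \<open>bdd_above W\<close>) (auto simp: W_def)
  have M0: "0 \<le> M" using W[of t] t v(2)[of t] by (meson less_imp_le mult_nonneg_nonneg norm_ge_zero order.refl order_trans)
  have step: "v s * norm (q s) \<le> A + M / 2" if s: "0 < s" "s \<le> t" for s
  proof -
    define d where "d = \<Lambda> - \<mu>"
    have d: "d > 0" using c by (simp add: d_def)
    let ?f = "\<lambda>x. exp (- (\<Lambda> * (s - x))) / sqrt (s - x) * norm (q x)"
    have gi: "set_integrable lborel {0<..<s} (\<lambda>x. M * (exp (- (d * (s - x))) / sqrt (s - x)))"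
      using set_integral_abel_exp_le(1)[OF s(1) d] by (rule set_integrable_mult_right)
    have le: "v s * ?f x \<le> M * (exp (- (d * (s - x))) / sqrt (s - x))" if x: "x \<in> {0<..<s}" for x
    proof -
      have "v s * ?f x \<le> (v x * exp (\<mu> * (s - x))) * ?f x"
        using x s v(3)[of x s] by (intro mult_right_mono) auto
      also have "\<dots> = (v x * norm (q x)) * ((exp (\<mu> * (s - x)) * exp (- (\<Lambda> * (s - x)))) / sqrt (s - x))"
        by (simp add: mult_ac)
      also have "exp (\<mu> * (s - x)) * exp (- (\<Lambda> * (s - x))) = exp (- (d * (s - x)))"
        by (simp add: exp_add[symmetric] d_def algebra_simps)
      also have "(v x * norm (q x)) * (exp (- (d * (s - x))) / sqrt (s - x)) \<le> M * (exp (- (d * (s - x))) / sqrt (s - x))"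
        using x s by (intro mult_right_mono W) auto
      finally show ?thesis .
    qed
    have fi: "set_integrable lborel {0<..<s} (\<lambda>x. v s * ?f x)"
    proof (rule set_integrable_bound[OF gi])
      have "set_borel_measurable lborel {0<..<s} q"
        unfolding set_borel_measurable_def
        using borel_measurable_continuous_on_indicator[OF _ continuous_on_subset[OF q(1)], of "{0<..<s}"]
        by (simp add: subset_iff)
      then have "(\<lambda>x. v s * (exp (- (\<Lambda> * (s - x))) / sqrt (s - x) * norm (indicator {0<..<s} x *\<^sub>R q x))) \<in> borel_measurable lborel"
        unfolding set_borel_measurable_def by measurable
      then show "set_borel_measurable lborel {0<..<s} (\<lambda>x. v s * ?f x)"
        unfolding set_borel_measurable_def
        by (rule measurable_cong[THEN iffD1, rotated]) (auto simp: indicator_def)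
      show "AE x in lborel. x \<in> {0<..<s} \<longrightarrow> norm (v s * ?f x) \<le> norm (M * (exp (- (d * (s - x))) / sqrt (s - x)))"
      proof (intro AE_I2 impI)
        fix x assume x: "x \<in> {0<..<s}"
        have "0 \<le> v s * ?f x" using x v(2)[of s] s by auto
        with le[OF x] show "norm (v s * ?f x) \<le> norm (M * (exp (- (d * (s - x))) / sqrt (s - x)))"
          unfolding real_norm_def by linarith
      qed
    qed
    have "v s * norm (q s) \<le> v s * (a s + c * (LBINT x:{0<..<s}. ?f x))"
      using ineq[OF s(1)] v(2)[of s] s by (intro mult_left_mono) auto
    also have "\<dots> = v s * a s + c * (LBINT x:{0<..<s}. v s * ?f x)"
      by (simp only: set_integral_mult_right distrib_left mult.left_commute)
    also have "\<dots> \<le> A + c * (LBINT x:{0<..<s}. M * (exp (- (d * (s - x))) / sqrt (s - x)))"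
      using a[OF s(1)] c by (intro add_mono mult_left_mono set_integral_mono[OF fi gi] le) auto
    also have "\<dots> = A + M * (c * (LBINT x:{0<..<s}. exp (- (d * (s - x))) / sqrt (s - x)))"
      by (simp only: set_integral_mult_right mult.left_commute)
    also have "\<dots> \<le> A + M * (c * sqrt (pi / d))"
      using set_integral_abel_exp_le(2)[OF s(1) d] M0 c by (intro add_left_mono mult_left_mono) auto
    also have "\<dots> \<le> A + M * (1/2)" using c M0 by (intro add_left_mono mult_left_mono) (auto simp: d_def)
    finally show ?thesis by simp
  qed
  have "M \<le> A + M / 2"
    unfolding M_def[symmetric] using t step by (subst M_def, intro cSup_least) (auto simp: W_def)
  then have "M \<le> 2 * A" by simp
  with W[of t] t show ?thesis by simp
qed

text \<open>The inversion bound is applied to t^m / m! r(t) exp (- \<sigma> t), extended by 0 to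
  negative times; its Fourier transform is the m-th moment on the line Re p = \<sigma>.\<close>

lemma moment_bound_from_laplace:
  fixes r :: "real \<Rightarrow> complex"
  assumes r: "continuous_on {0<..} r" "\<And>t. t > 0 \<Longrightarrow> norm (r t) \<le> C * exp (s0 * t)" and s: "s0 < \<sigma>"
    and m: "m \<ge> 1"
    and K: "(\<integral>\<^sup>+s. ennreal (norm (laplace_moment m r (Complex \<sigma> s))) \<partial>lborel) \<le> ennreal K" "0 \<le> K"
    and t: "t > 0"
  shows "t ^ m / fact m * norm (r t) \<le> K / (2 * pi) * exp (\<sigma> * t)"
proof -
  define h where "h = (\<lambda>t. indicator {0<..} t *\<^sub>R (of_real (t ^ m / fact m) * r t * exp (- (of_real \<sigma> * of_real t))))"
  define \<delta> where "\<delta> = \<sigma> - s0"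
  have \<delta>: "\<delta> > 0" using s by (simp add: \<delta>_def)
  have C0: "0 \<le> C" using r(2)[of 1] by (smt (verit) exp_gt_zero norm_ge_zero zero_le_mult_iff)
  have nh: "norm (h t) \<le> t ^ m / fact m * (C * exp (- (\<delta> * t)))" if "t > 0" for t
  proof -
    have "norm (h t) = t ^ m / fact m * (norm (r t) * exp (- (\<sigma> * t)))"
      using that by (simp add: h_def norm_mult norm_divide norm_power)
    also have "\<dots> \<le> t ^ m / fact m * (C * exp (s0 * t) * exp (- (\<sigma> * t)))"
      using that r(2)[OF that] by (intro mult_left_mono mult_right_mono) auto
    also have "C * exp (s0 * t) * exp (- (\<sigma> * t)) = C * exp (- (\<delta> * t))"
      by (simp add: mult.assoc exp_add[symmetric] \<delta>_def algebra_simps)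
    finally show ?thesis .
  qed
  have "laplaceable \<sigma> r"
  proof (rule laplaceableI[OF set_borel_measurable_half_line[OF r(1)] s])
    fix t :: real assume t: "t > 0"
    have "C * exp (s0 * t) \<le> C * (1 + t powr (-1/2)) * exp (s0 * t)"
      using C0 by (intro mult_right_mono) (auto simp: mult_le_cancel_left1)
    then show "norm (r t) \<le> C * (1 + t powr (-1/2)) * exp (s0 * t)" using r(2)[OF t] by linarith
  qed
  then have hint: "integrable lborel h"
    using laplaceable_integrable[of "of_real \<sigma>" r m] by (simp add: h_def set_integrable_def)
  \<comment> \<open>A single term of the exponential series for \<delta> t dominates the power
    t^m.\<close>
  have hb: "norm (h t) \<le> C / \<delta> ^ m" for t
  proof (cases "t > 0")
    case True
    have "(\<delta> * t) ^ m / fact m \<le> exp (\<delta> * t)"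
    proof -
      have "(\<Sum>k\<in>{m}. (\<delta> * t) ^ k / fact k) \<le> (\<Sum>k. (\<delta> * t) ^ k / fact k)"
        using True \<delta> summable_exp[of "\<delta> * t"] by (intro sum_le_suminf) (auto simp: divide_inverse mult.commute)
      then show ?thesis by (simp add: exp_def divide_inverse mult.commute)
    qed
    then have "t ^ m / fact m * exp (- (\<delta> * t)) \<le> 1 / \<delta> ^ m"
      using \<delta> by (simp add: exp_minus field_simps power_mult_distrib)
    then have "C * (t ^ m / fact m * exp (- (\<delta> * t))) \<le> C * (1 / \<delta> ^ m)" by (rule mult_left_mono[OF _ C0])
    with nh[OF True] show ?thesis by (simp add: mult_ac)
  qed (use C0 \<delta> in \<open>simp add: h_def\<close>)
  have hc: "continuous_on UNIV h"
  proof -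
    have c1: "isCont h t" if "t > 0" for t
    proof -
      have "isCont r t" using r(1) that by (auto simp: continuous_on_eq_continuous_at)
      then have "isCont (\<lambda>t. of_real (t ^ m / fact m) * r t * exp (- (of_real \<sigma> * of_real t))) t"
        by (intro continuous_intros) auto
      moreover have "\<forall>\<^sub>F x in nhds t. h x = of_real (x ^ m / fact m) * r x * exp (- (of_real \<sigma> * of_real x))"
        using eventually_nhds_in_open[of "{0<..}" t] that by (auto elim!: eventually_mono simp: h_def)
      ultimately show ?thesis by (simp add: isCont_cong)
    qed
    have c2: "isCont h t" if "t < 0" for t
    proof -
      have "\<forall>\<^sub>F x in nhds t. h x = 0"
        using eventually_nhds_in_open[of "{..<0}" t] that by (auto elim!: eventually_mono simp: h_def)
      then show ?thesis using isCont_cong[of h "\<lambda>_. 0" t] by simp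
    qed
    \<comment> \<open>The extension by 0 has no jump at the origin because m is at least 1;
      \<open>r\<close> itself need not vanish there.\<close>
    have c3: "isCont h 0"
    proof -
      have "\<bar>t\<bar> ^ m / fact m * C * exp (\<delta> * \<bar>t\<bar>) \<ge> norm (h t)" for t
      proof (cases "t > 0")
        case True
        have "t ^ m / fact m * (C * exp (- (\<delta> * t))) \<le> t ^ m / fact m * (C * exp (\<delta> * t))"
          using True \<delta> C0 by (intro mult_left_mono) (auto intro: order_trans[of _ 0])
        with nh[OF True] True show ?thesis by (simp add: mult_ac)
      qed (use C0 in \<open>simp add: h_def\<close>)
      moreover have "((\<lambda>t. \<bar>t\<bar> ^ m / fact m * C * exp (\<delta> * \<bar>t\<bar>)) \<longlongrightarrow> \<bar>0\<bar> ^ m / fact m * C * exp (\<delta> * \<bar>0\<bar>)) (at 0)"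
        by (intro tendsto_intros) auto
      ultimately have "(h \<longlongrightarrow> 0) (at 0)"
        using m by (intro Lim_null_comparison[of h]) (auto simp: power_0_left intro!: always_eventually)
      then show ?thesis by (simp add: isCont_def h_def)
    qed
    show ?thesis using c1 c2 c3 by (intro continuous_at_imp_continuous_on ballI) (metis linorder_neqE)
  qed
  have fh: "(LINT x|lborel. h x * iexp (- (s * x))) = laplace_moment m r (Complex \<sigma> s)" for s
    unfolding laplace_moment_def set_lebesgue_integral_def
  proof (intro Bochner_Integration.integral_cong refl)
    fix x
    have "exp (- (Complex \<sigma> s * of_real x)) = exp (- (of_real \<sigma> * of_real x)) * iexp (- (s * x))"
      unfolding exp_add[symmetric] by (simp add: Complex_eq algebra_simps)
    then show "h x * iexp (- (s * x)) = indicator {0<..} x *\<^sub>R (of_real (x ^ m / fact m) * r x * exp (- (Complex \<sigma> s * of_real x)))"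
      by (simp add: h_def scaleR_conv_of_real)
  qed
  have "norm (h t) \<le> K / (2 * pi)"
    using norm_le_integral_fourier[OF hc hint hb _ K(2), of t] K(1) by (simp only: fh)
  moreover have "norm (h t) = t ^ m / fact m * norm (r t) * exp (- (\<sigma> * t))"
    using t by (simp add: h_def norm_mult norm_divide norm_power)
  ultimately show ?thesis by (simp add: exp_minus field_simps)
qed

section \<open>The lattice system on the closed half plane\<close>

text \<open>Written as an integral over counting measure so that Fubini and dominated convergence
  apply. The index is n + k because a mode exp (- i k w t) of the interaction moves the Laplace
  variable by + i k w.\<close>

definition lattice_conv :: "(int \<Rightarrow> complex) \<Rightarrow> (int \<Rightarrow> complex) \<Rightarrow> int \<Rightarrow> complex" where
  "lattice_conv c Q n = (LINT k|count_space UNIV. c k * Q (n + k))"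

lemma integrable_lattice_conv:
  fixes c Q :: "int \<Rightarrow> complex"
  assumes "integrable (count_space UNIV) c" and "\<And>n. norm (Q n) \<le> B"
  shows "integrable (count_space UNIV) (\<lambda>k. c k * Q (n + k))"
proof (rule Bochner_Integration.integrable_bound)
  show "integrable (count_space UNIV) (\<lambda>k. B * norm (c k))"
    using assms(1) by simp
  show "AE k in count_space UNIV. norm (c k * Q (n + k)) \<le> norm (B * norm (c k))"
  proof (intro AE_I2)
    fix k
    have "0 \<le> B" using order_trans[OF norm_ge_zero assms(2)[of 0]] .
    then show "norm (c k * Q (n + k)) \<le> norm (B * norm (c k))"
      using mult_right_mono[OF assms(2)[of "n + k"], of "norm (c k)"]
      by (simp add: norm_mult abs_mult mult.commute)
  qed
qed auto

lemma norm_lattice_conv_le: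
  fixes c Q :: "int \<Rightarrow> complex"
  assumes "integrable (count_space UNIV) c" and "\<And>n. norm (Q n) \<le> B"
  shows "norm (lattice_conv c Q n) \<le> B * (LINT k|count_space UNIV. norm (c k))"
proof -
  have "norm (lattice_conv c Q n) \<le> (LINT k|count_space UNIV. norm (c k * Q (n + k)))"
    unfolding lattice_conv_def by (rule integral_norm_bound)
  also have "\<dots> \<le> (LINT k|count_space UNIV. B * norm (c k))"
  proof (rule integral_mono)
    show "norm (c k * Q (n + k)) \<le> B * norm (c k)" for k
      using mult_right_mono[OF assms(2)[of "n + k"], of "norm (c k)"] by (simp add: norm_mult mult.commute)
  qed (use assms(1) integrable_norm[OF integrable_lattice_conv[OF assms]] in simp_all)
  finally show ?thesis by simp
qed

text \<open>Telescoping: with x = sqrt (1 + N) and y = sqrt (2 + N), the two new terms 2 / y are at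
  most 4 (y - x), since y^2 - x^2 = 1.\<close>

lemma sum_inverse_sqrt_le:
  "(\<Sum>n\<in>{- int N..int N}. 1 / sqrt (1 + \<bar>real_of_int n\<bar>)) \<le> 4 * sqrt (1 + real N)"
proof (induction N)
  case (Suc N)
  have eq: "{- int (Suc N)..int (Suc N)} =
      insert (- int (Suc N)) (insert (int (Suc N)) {- int N..int N})" by auto
  define x where "x = sqrt (1 + real N)"
  define y where "y = sqrt (2 + real N)"
  have xy: "0 < x" "x \<le> y" "y * y - x * x = 1" by (auto simp: x_def y_def)
  have "1 = (y - x) * (y + x)" using xy by (simp add: algebra_simps)
  also have "\<dots> \<le> (y - x) * (2 * y)" using xy by (intro mult_left_mono) auto
  finally have "2 / y \<le> 4 * (y - x)" using xy by (simp add: field_simps)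
  moreover have "(\<Sum>n\<in>{- int (Suc N)..int (Suc N)}. 1 / sqrt (1 + \<bar>real_of_int n\<bar>))
      = 2 / y + (\<Sum>n\<in>{- int N..int N}. 1 / sqrt (1 + \<bar>real_of_int n\<bar>))"
    unfolding eq y_def by (subst sum.insert; (subst sum.insert)?) (auto simp: add.commute)
  moreover have "sqrt (1 + real (Suc N)) = y" by (simp add: y_def add.commute)
  ultimately show ?case using Suc.IH by (simp add: x_def)
qed simp

text \<open>The diagonal form of a Hermitian convolution is real up to the boundary terms of the
  truncation, and these are controlled by the decay of \<open>Q\<close>, although \<open>Q\<close> need not be square
  summable.\<close>

lemma Im_truncated_form_tendsto_0:
  fixes c Q :: "int \<Rightarrow> complex"
  assumes c: "integrable (count_space UNIV) c" and herm: "\<And>n. c n = cnj (c (- n))"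
    and Q: "\<And>n. norm (Q n) \<le> b / sqrt (1 + \<bar>real_of_int n\<bar>)"
  shows "(\<lambda>N. Im (\<Sum>n\<in>{- int N..int N}. cnj (Q n) * lattice_conv c Q n)) \<longlonglongrightarrow> 0"
proof -
  have b0: "0 \<le> b" using order_trans[OF norm_ge_zero Q[of 0]] by simp
  have Qb: "norm (Q n) \<le> b" for n
  proof -
    have "b / sqrt (1 + \<bar>real_of_int n\<bar>) \<le> b / 1" using b0 by (intro divide_left_mono) auto
    with Q[of n] show ?thesis by simp
  qed
  define I where "I N = {- int N..int N}" for N
  define S where "S N = (\<Sum>n\<in>I N. cnj (Q n) * lattice_conv c Q n)" for N
  \<comment> \<open>The correlation of \<open>Q\<close> at lag k, cut to the window; the truncated
    form is the sum of \<open>c k * T N k\<close>.\<close>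
  define T where "T N k = (\<Sum>n\<in>I N. cnj (Q n) * Q (n + k))" for N k
  \<comment> \<open>The boundary pairs: n lies inside the window while its partner n + k lies
    outside.\<close>
  define E where "E N k = (\<Sum>n\<in>{n \<in> I N. int N < \<bar>n + k\<bar>}. norm (Q n) * norm (Q (n + k)))" for N k
  have finI [simp]: "finite (I N)" for N by (simp add: I_def)
  have far: "norm (Q m) \<le> b / sqrt (1 + real N)" if "int N < \<bar>m\<bar>" for m N
  proof -
    have "b / sqrt (1 + \<bar>real_of_int m\<bar>) \<le> b / sqrt (1 + real N)"
      using b0 that by (intro divide_left_mono) auto
    with Q[of m] show ?thesis by simp
  qed
  \<comment> \<open>Uniform in the lag: the partner outside contributes at most b / sqrt (1 + N),
    and the sum over the inside grows only like sqrt (1 + N). This bound supplies the dominating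
    function.\<close>
  have E1: "E N k \<le> 4 * b\<^sup>2" for N k
  proof -
    have "E N k \<le> (\<Sum>n\<in>{n \<in> I N. int N < \<bar>n + k\<bar>}. b / sqrt (1 + \<bar>real_of_int n\<bar>) * (b / sqrt (1 + real N)))"
      unfolding E_def using Q far b0 by (intro sum_mono mult_mono) auto
    also have "\<dots> \<le> (\<Sum>n\<in>I N. b / sqrt (1 + \<bar>real_of_int n\<bar>) * (b / sqrt (1 + real N)))"
      using b0 by (intro sum_mono2) auto
    also have "\<dots> = b\<^sup>2 / sqrt (1 + real N) * (\<Sum>n\<in>I N. 1 / sqrt (1 + \<bar>real_of_int n\<bar>))"
      by (simp add: sum_distrib_left power2_eq_square mult_ac)
    also have "\<dots> \<le> b\<^sup>2 / sqrt (1 + real N) * (4 * sqrt (1 + real N))"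
      unfolding I_def by (intro mult_left_mono sum_inverse_sqrt_le) auto
    finally show ?thesis by simp
  qed
  \<comment> \<open>For a fixed lag there are at most |k| boundary pairs, so their sum tends to 0.
    This bound supplies the pointwise limit.\<close>
  have E2: "E N k \<le> \<bar>real_of_int k\<bar> * (b * (b / sqrt (1 + real N)))" for N k
  proof -
    have sub: "{n \<in> I N. int N < \<bar>n + k\<bar>} \<subseteq>
        (if 0 \<le> k then {int N - k + 1..int N} else {- int N..- int N - k - 1})"
      by (auto simp: I_def)
    have "real (card {n \<in> I N. int N < \<bar>n + k\<bar>}) \<le> \<bar>real_of_int k\<bar>"
    proof (cases "0 \<le> k")
      case True
      with card_mono[OF _ sub] have "card {n \<in> I N. int N < \<bar>n + k\<bar>} \<le> nat k" by simp
      with True show ?thesis by linarith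
    next
      case False
      with card_mono[OF _ sub] have "card {n \<in> I N. int N < \<bar>n + k\<bar>} \<le> nat (- k)" by simp
      with False show ?thesis by linarith
    qed
    moreover have "E N k \<le> (\<Sum>n\<in>{n \<in> I N. int N < \<bar>n + k\<bar>}. b * (b / sqrt (1 + real N)))"
      unfolding E_def using Qb far b0 by (intro sum_mono mult_mono) auto
    moreover have "0 \<le> b * (b / sqrt (1 + real N))" using b0 by simp
    ultimately show ?thesis
      by (auto intro: order_trans[OF _ mult_right_mono] simp del: times_divide_eq_right)
  qed
  have E0: "0 \<le> E N k" for N k unfolding E_def by (intro sum_nonneg) auto
  have Elim: "(\<lambda>N. E N k) \<longlonglongrightarrow> 0" for k
  proof (rule tendsto_sandwich[OF _ _ tendsto_const])
    have "filterlim (\<lambda>N. sqrt (1 + real N)) at_top sequentially"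
      by (intro filterlim_compose[OF sqrt_at_top] filterlim_tendsto_add_at_top[OF tendsto_const]
          filterlim_real_sequentially)
    then show "(\<lambda>N. \<bar>real_of_int k\<bar> * (b * (b / sqrt (1 + real N)))) \<longlonglongrightarrow> 0"
      by (intro tendsto_mult_right_zero real_tendsto_divide_at_top[OF tendsto_const])
  qed (use E0 E2 in auto)
  \<comment> \<open>The conjugate of the correlation at lag - k is the same sum over the window
    moved by k; only the symmetric difference of the two windows survives.\<close>
  have Tdiff: "norm (T N k - cnj (T N (- k))) \<le> E N k + E N (- k)" for N k
  proof -
    define J where "J = (\<lambda>n. n - k) ` I N"
    have [simp]: "finite J" by (simp add: J_def)
    have memJ: "n \<in> J \<longleftrightarrow> n + k \<in> I N" for n
      by (auto simp: J_def image_iff intro: bexI[of _ "n + k"])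
    have "cnj (T N (- k)) = (\<Sum>n\<in>I N. cnj (Q (n - k)) * Q n)"
      by (simp add: T_def mult.commute)
    also have "\<dots> = (\<Sum>n\<in>J. cnj (Q n) * Q (n + k))"
      unfolding J_def by (subst sum.reindex) (auto simp: inj_on_def)
    finally have "T N k - cnj (T N (- k)) =
        (\<Sum>n\<in>I N. cnj (Q n) * Q (n + k)) - (\<Sum>n\<in>J. cnj (Q n) * Q (n + k))"
      by (simp add: T_def)
    also have "\<dots> = (\<Sum>n\<in>I N - J. cnj (Q n) * Q (n + k)) - (\<Sum>n\<in>J - I N. cnj (Q n) * Q (n + k))"
      using sum.Int_Diff[of "I N" "\<lambda>n. cnj (Q n) * Q (n + k)" J]
        sum.Int_Diff[of J "\<lambda>n. cnj (Q n) * Q (n + k)" "I N"] by (simp add: Int_commute)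
    finally have "norm (T N k - cnj (T N (- k))) \<le>
        (\<Sum>n\<in>I N - J. norm (Q n) * norm (Q (n + k))) + (\<Sum>n\<in>J - I N. norm (Q n) * norm (Q (n + k)))"
      by (auto intro!: order_trans[OF norm_triangle_ineq4] add_mono order_trans[OF norm_sum]
          simp: norm_mult)
    moreover have "(\<Sum>n\<in>I N - J. norm (Q n) * norm (Q (n + k))) = E N k"
      unfolding E_def by (intro sum.cong) (auto simp: memJ I_def)
    moreover have "(\<Sum>n\<in>J - I N. norm (Q n) * norm (Q (n + k))) = E N (- k)"
      unfolding E_def
      by (rule sum.reindex_bij_witness[of _ "\<lambda>n. n - k" "\<lambda>n. n + k"])
        (auto simp: memJ I_def mult.commute)
    ultimately show ?thesis by simp
  qed
  have Tb: "norm (T N k) \<le> (2 * real N + 1) * b\<^sup>2" for N k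
  proof -
    have "norm (T N k) \<le> (\<Sum>n\<in>I N. b * b)"
      unfolding T_def using Qb b0
      by (intro order_trans[OF norm_sum] sum_mono) (auto simp: norm_mult intro!: mult_mono)
    then show ?thesis by (simp add: I_def power2_eq_square)
  qed
  have intT: "integrable (count_space UNIV) (\<lambda>k. c k * T N k)" for N
    using integrable_lattice_conv[OF c, of "T N" _ 0, OF Tb] by simp
  have intT': "integrable (count_space UNIV) (\<lambda>k. c k * cnj (T N (- k)))" for N
    using integrable_lattice_conv[OF c, of "\<lambda>k. cnj (T N (- k))" "(2 * real N + 1) * b\<^sup>2" 0] Tb by simp
  have ST: "S N = (LINT k|count_space UNIV. c k * T N k)" for N
  proof -
    have "(LINT k|count_space UNIV. c k * T N k) =
        (LINT k|count_space UNIV. (\<Sum>n\<in>I N. cnj (Q n) * (c k * Q (n + k))))"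
      by (simp add: T_def sum_distrib_left mult_ac)
    also have "\<dots> = (\<Sum>n\<in>I N. LINT k|count_space UNIV. cnj (Q n) * (c k * Q (n + k)))"
      using integrable_lattice_conv[OF c Qb]
      by (intro Bochner_Integration.integral_sum integrable_mult_right) auto
    also have "\<dots> = S N" unfolding S_def lattice_conv_def by simp
    finally show ?thesis ..
  qed
  have ST': "cnj (S N) = (LINT k|count_space UNIV. c k * cnj (T N (- k)))" for N
  proof -
    have "cnj (S N) = (LINT k|count_space UNIV. cnj (c k) * cnj (T N k))"
      unfolding ST by (simp flip: Bochner_Integration.integral_cnj)
    also have "\<dots> = (LINT k|count_space UNIV. cnj (c (- k)) * cnj (T N (- k)))"
      by (rule integral_bij_count_space[symmetric]) (auto intro!: bij_betwI[of _ _ _ uminus])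
    finally show ?thesis by (simp add: herm[symmetric])
  qed
  \<comment> \<open>By the Hermitian symmetry of \<open>c\<close> this integral is
    \<open>S N - cnj (S N)\<close>, twice i times the imaginary part that has to vanish in the
    limit.\<close>
  have "(\<lambda>N. LINT k|count_space UNIV. c k * (T N k - cnj (T N (- k)))) \<longlonglongrightarrow>
      (LINT k|count_space (UNIV :: int set). 0)"
  proof (rule integral_dominated_convergence[where w = "\<lambda>k. 8 * b\<^sup>2 * norm (c k)"])
    show "AE k in count_space UNIV. (\<lambda>N. c k * (T N k - cnj (T N (- k)))) \<longlonglongrightarrow> 0"
    proof (intro AE_I2 tendsto_mult_right_zero)
      fix k
      have "(\<lambda>N. E N k + E N (- k)) \<longlonglongrightarrow> 0" using tendsto_add[OF Elim Elim] by simp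
      then show "(\<lambda>N. T N k - cnj (T N (- k))) \<longlonglongrightarrow> 0"
        by (rule Lim_null_comparison[rotated]) (use Tdiff in auto)
    qed
    show "AE k in count_space UNIV. norm (c k * (T N k - cnj (T N (- k)))) \<le> 8 * b\<^sup>2 * norm (c k)" for N
    proof (intro AE_I2)
      fix k
      have "norm (T N k - cnj (T N (- k))) \<le> 8 * b\<^sup>2"
        using Tdiff[of N k] E1[of N k] E1[of N "- k"] by linarith
      then show "norm (c k * (T N k - cnj (T N (- k)))) \<le> 8 * b\<^sup>2 * norm (c k)"
        by (simp add: norm_mult mult.commute mult_left_mono)
    qed
  qed (use c in auto)
  then have "(\<lambda>N. S N - cnj (S N)) \<longlonglongrightarrow> 0"
    unfolding ST' unfolding ST using intT intT' by (simp add: right_diff_distrib)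
  then have "(\<lambda>N. Im (S N - cnj (S N)) / 2) \<longlonglongrightarrow> Im 0 / 2"
    by (intro tendsto_intros) auto
  then have "(\<lambda>N. Im (S N)) \<longlonglongrightarrow> 0" by simp
  then show ?thesis by (simp only: S_def I_def)
qed

text \<open>Square roots of the closed right half plane lie in the sector |arg| <= pi / 4, and the
  edge arg = pi / 4 is reached only from the nonnegative imaginary axis. The gap Re - Im will be the
  weight in the energy identity.\<close>

lemma csqrt_sector:
  assumes "0 \<le> Re z"
  shows "Im (csqrt z) \<le> Re (csqrt z)"
    and "Im (csqrt z) = Re (csqrt z) \<Longrightarrow> Re z = 0 \<and> 0 \<le> Im z"
proof -
  have z: "Re z = (Re (csqrt z))\<^sup>2 - (Im (csqrt z))\<^sup>2" "Im z = 2 * Re (csqrt z) * Im (csqrt z)"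
    using arg_cong[OF power2_csqrt[of z], of Re] arg_cong[OF power2_csqrt[of z], of Im]
    by (simp_all add: power2_eq_square mult_ac del: csqrt.sel)
  have "(Im (csqrt z))\<^sup>2 \<le> (Re (csqrt z))\<^sup>2" using z assms by linarith
  then show "Im (csqrt z) \<le> Re (csqrt z)" by (rule power2_le_imp_le) (rule Re_csqrt)
  show "Im (csqrt z) = Re (csqrt z) \<Longrightarrow> Re z = 0 \<and> 0 \<le> Im z"
    unfolding z by (simp del: csqrt.sel)
qed

text \<open>Because \<open>Q\<close> vanishes to the left of \<open>N\<close>, the equation in row N
  - 1 - j says that the bounded sequence Q(N), Q(N+1), ... annihilates the j-th shift of (c 1, c 2,
  ...). It therefore annihilates the closed span of these shifts in l^1. By genericity that span
  contains e_1, whose pairing with the sequence is Q(N).\<close>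

lemma generic_vanishing:
  fixes c Q :: "int \<Rightarrow> complex"
  assumes c: "integrable (count_space UNIV) c" and gen: "generic c"
    and Q: "\<And>n. norm (Q n) \<le> B"
    and Q0: "\<And>n. n < N \<Longrightarrow> Q n = 0" and A0: "\<And>n. n < N \<Longrightarrow> lattice_conv c Q n = 0"
  shows "Q N = 0"
proof -
  have B0: "0 \<le> B" using order_trans[OF norm_ge_zero Q[of 0]] .
  have small: "norm (Q N) \<le> \<epsilon> * B" if eps: "\<epsilon> > 0" for \<epsilon>
  proof -
    obtain M d where Md: "(\<Sum>k. norm ((if k = 0 then 1 else 0)
        - (\<Sum>j<M. d j * c (int k + int j + 1)))) < \<epsilon>"
      using gen eps unfolding generic_def by blast
    \<comment> \<open>\<open>h\<close> is taken on all integers; its values at negative m do no harm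
      because they multiply entries of \<open>Q\<close> left of \<open>N\<close>, which are
      0.\<close>
    define h where "h m = (\<Sum>j<M. d j * c (m + int j + 1))" for m
    define G where "G m = (if m = 0 then 1 else 0) - h m" for m
    have cshift: "integrable (count_space UNIV) (\<lambda>m. c (m + int j + 1))" for j
      by (subst integrable_bij_count_space[where f = c and g = "\<lambda>m. m + int j + 1" and B = UNIV])
        (auto intro!: c bij_betwI[of _ _ _ "\<lambda>m. m - int j - 1"])
    have hint: "integrable (count_space UNIV) h"
      unfolding h_def using cshift by (intro Bochner_Integration.integrable_sum integrable_mult_right)
    have dint: "integrable (count_space UNIV) (\<lambda>m::int. if m = 0 then 1 else 0 :: complex)"
      using integrable_real_indicator[of "{0::int}" "count_space UNIV", THEN integrable_of_real]
      by (simp add: indicator_def of_bool_def if_distrib cong: if_cong)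
    have Gint: "integrable (count_space UNIV) G"
      unfolding G_def using dint hint by (rule Bochner_Integration.integrable_diff)
    \<comment> \<open>Summability guarantees that the \<open>suminf\<close> in
      \<open>generic\<close> is the true l^1 distance and not a default value.\<close>
    have Gnat: "Infinite_Set_Sum.abs_summable_on (\<lambda>k::nat. G (int k)) UNIV"
    proof -
      have "Infinite_Set_Sum.abs_summable_on G (range int)"
        by (rule Infinite_Set_Sum.abs_summable_on_subset[of _ UNIV])
          (use Gint in \<open>auto simp: Infinite_Set_Sum.abs_summable_on_def\<close>)
      then show ?thesis by (subst abs_summable_on_reindex_iff) auto
    qed
    have hQ: "(LINT m|count_space UNIV. h m * Q (N + m)) = 0"
    proof -
      have cQ: "integrable (count_space UNIV) (\<lambda>m. c (m + int j + 1) * Q (N + m))" for j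
        using integrable_lattice_conv[OF cshift Q] .
      have "(LINT m|count_space UNIV. h m * Q (N + m)) =
          (\<Sum>j<M. d j * (LINT m|count_space UNIV. c (m + int j + 1) * Q (N + m)))"
        unfolding h_def sum_distrib_right mult.assoc
        using cQ by (subst Bochner_Integration.integral_sum) auto
      moreover have "(LINT m|count_space UNIV. c (m + int j + 1) * Q (N + m)) = 0" for j
      proof -
        have "(LINT m|count_space UNIV. c (m + int j + 1) * Q (N + m))
            = (LINT m|count_space UNIV. c (m + int j + 1) * Q ((N - 1 - int j) + (m + int j + 1)))"
          by simp
        also have "\<dots> = lattice_conv c Q (N - 1 - int j)"
          unfolding lattice_conv_def
          by (rule integral_bij_count_space[where f = "\<lambda>k. c k * Q (N - 1 - int j + k)"])
            (auto intro!: bij_betwI[of _ _ _ "\<lambda>m. m - int j - 1"])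
        finally show ?thesis using A0 by simp
      qed
      ultimately show ?thesis by simp
    qed
    have hQi: "integrable (count_space UNIV) (\<lambda>m. h m * Q (N + m))"
      using integrable_lattice_conv[OF hint Q] .
    have dQi: "integrable (count_space UNIV) (\<lambda>m. (if m = 0 then 1 else 0) * Q (N + m))"
      using integrable_lattice_conv[OF dint Q] .
    have "(LINT m|count_space UNIV. (if m = 0 then 1 else 0) * Q (N + m))
        = infsetsum (\<lambda>m. (if m = 0 then 1 else 0) * Q (N + m)) UNIV"
      by (simp add: infsetsum_def)
    also have "\<dots> = infsetsum (\<lambda>m. (if m = 0 then 1 else 0) * Q (N + m)) {0}"
      by (rule infsetsum_cong_neutral) auto
    finally have "Q N = (LINT m|count_space UNIV. (if m = 0 then 1 else 0) * Q (N + m))" by simp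
    also have "\<dots> = (LINT m|count_space UNIV. G m * Q (N + m))"
      unfolding G_def left_diff_distrib using dQi hQi hQ by simp
    finally have "norm (Q N) \<le> (LINT m|count_space UNIV. norm (G m * Q (N + m)))"
      using integral_norm_bound by metis
    also have "\<dots> = infsetsum (\<lambda>m. norm (G m * Q (N + m))) UNIV" by (simp add: infsetsum_def)
    also have "\<dots> = infsetsum (\<lambda>m. norm (G m * Q (N + m))) (range int)"
    proof (rule infsetsum_cong_neutral)
      fix m assume "m \<in> UNIV - range int"
      then have "m < 0" by (metis DiffD2 nat_0_le not_le rangeI)
      then show "norm (G m * Q (N + m)) = 0" using Q0 by simp
    qed auto
    also have "\<dots> = infsetsum (\<lambda>k. norm (G (int k) * Q (N + int k))) UNIV"
      by (subst infsetsum_reindex) (auto simp: inj_on_def)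
    also have "\<dots> \<le> infsetsum (\<lambda>k. norm (G (int k)) * B) UNIV"
    proof (rule infsetsum_mono)
      show *: "Infinite_Set_Sum.abs_summable_on (\<lambda>k. norm (G (int k)) * B) UNIV"
        using Gnat by (intro abs_summable_on_cmult_left) simp
      show "Infinite_Set_Sum.abs_summable_on (\<lambda>k. norm (G (int k) * Q (N + int k))) UNIV"
        by (rule abs_summable_on_comparison_test[OF *])
          (use Q B0 in \<open>auto simp: norm_mult abs_mult intro!: mult_left_mono\<close>)
    qed (use Q in \<open>auto simp: norm_mult intro!: mult_left_mono\<close>)
    also have "\<dots> = infsetsum (\<lambda>k. norm (G (int k))) UNIV * B"
      using Gnat by (subst infsetsum_cmult_left) auto
    also have "infsetsum (\<lambda>k. norm (G (int k))) UNIV = (\<Sum>k. norm (G (int k)))"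
      using Gnat by (subst infsetsum_nat) auto
    also have "\<dots> * B \<le> \<epsilon> * B"
      using Md B0 by (intro mult_right_mono) (auto simp: G_def h_def)
    finally show ?thesis .
  qed
  have "norm (Q N) \<le> 0 + e" if "e > 0" for e
  proof -
    have "norm (Q N) \<le> e / (B + 1) * B" using B0 that by (intro small) auto
    also have "\<dots> \<le> e" using B0 that by (simp add: divide_simps)
    finally show ?thesis by simp
  qed
  then have "norm (Q N) \<le> 0" by (rule field_le_epsilon)
  then show ?thesis by simp
qed


text \<open>A bounded solution first gains decay of order |n|^(-1/2) from its own equation, just
  enough for the boundary terms of the truncated form to vanish. The energy identity then gives a
  sum of nonnegative terms tending to 0, so \<open>Q n\<close> is 0 wherever the weight is positive.
  The weight degenerates only when p_n lies on the nonnegative imaginary axis, so a half line of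
  indices is settled, and genericity proceeds upwards from there.\<close>

lemma lattice_kernel_trivial:
  fixes c Q :: "int \<Rightarrow> complex"
  assumes c: "integrable (count_space UNIV) c" and herm: "\<And>n. c n = cnj (c (- n))"
    and gen: "generic c" and w: "w > 0" and p: "0 \<le> Re p" and B: "\<And>n. norm (Q n) \<le> B"
    and eq: "\<And>n. csqrt (p + \<i> * of_real (of_int n * w)) * Q n
                 + 4 * of_real pi * csqrt \<i> * lattice_conv c Q n = 0"
  shows "Q n = 0"
proof -
  define s where "s n = csqrt (p + \<i> * of_real (of_int n * w))" for n
  define A where "A n = lattice_conv c Q n" for n
  define m where "m = (LINT k|count_space UNIV. norm (c k))"
  have B0: "0 \<le> B" using order_trans[OF norm_ge_zero B[of 0]] .
  have m0: "0 \<le> m" unfolding m_def by simp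
  have Ab: "norm (A n) \<le> B * m" for n
    unfolding A_def m_def by (rule norm_lattice_conv_le[OF c B])
  have ii: "norm (csqrt \<i>) = 1" by (simp del: csqrt_ii)
  have row: "s n * Q n = - (4 * of_real pi * csqrt \<i> * A n)" for n
    using eq[of n] unfolding s_def A_def by (simp only: add_eq_0_iff2)
  \<comment> \<open>Chosen so that 1 + |n| <= K (1 + |p + i n w|), which converts the size of the
    diagonal into decay in n.\<close>
  define K where "K = 1 + (1 + norm p) / w"
  define b where "b = sqrt K * (B + 4 * pi * (B * m))"
  have K0: "0 \<le> K" using w by (simp add: K_def)
  have Qdec: "norm (Q n) \<le> b / sqrt (1 + \<bar>real_of_int n\<bar>)" for n
  proof -
    define z where "z = p + \<i> * of_real (of_int n * w)"
    have "\<bar>real_of_int n\<bar> * w = norm (z - p)" using w by (simp add: z_def norm_mult abs_mult)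
    also have "\<dots> \<le> norm z + norm p" by (rule norm_triangle_ineq4)
    finally have "\<bar>real_of_int n\<bar> \<le> (norm z + norm p) / w" using w by (simp add: field_simps)
    also have "1 + (norm z + norm p) / w \<le> K * (1 + norm z)"
      using w by (simp add: K_def field_simps)
    finally have "1 + \<bar>real_of_int n\<bar> \<le> K * (1 + norm z)" by simp
    then have "sqrt (1 + \<bar>real_of_int n\<bar>) \<le> sqrt (K * (1 + norm z))" by simp
    also have "\<dots> \<le> sqrt K * (1 + sqrt (norm z))"
      using K0 sqrt_add_le_add_sqrt[of 1 "norm z"] by (simp add: real_sqrt_mult mult_left_mono)
    finally have "sqrt (1 + \<bar>real_of_int n\<bar>) * norm (Q n) \<le> sqrt K * (1 + sqrt (norm z)) * norm (Q n)"
      by (intro mult_right_mono) auto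
    also have "\<dots> = sqrt K * (norm (Q n) + norm (s n * Q n))"
      by (simp add: s_def z_def norm_mult algebra_simps)
    also have "norm (s n * Q n) = 4 * pi * norm (A n)"
      unfolding row by (simp add: norm_mult ii del: csqrt_ii)
    also have "sqrt K * (norm (Q n) + 4 * pi * norm (A n)) \<le> b"
      unfolding b_def using B Ab K0 by (intro mult_left_mono add_mono) auto
    finally show ?thesis by (simp add: field_simps)
  qed
  define v where "v n = Re (s n) - Im (s n)" for n
  have v0: "0 \<le> v n" for n
    using csqrt_sector(1)[of "p + \<i> * of_real (of_int n * w)"] p
    by (simp add: v_def s_def del: csqrt.sel)
  \<comment> \<open>The row is multiplied by (1 - i) times the conjugate of \<open>Q n\<close>. The
    rotation makes the coupling real, since (1 - i) csqrt i = sqrt 2, so the imaginary part of the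
    coupling term is a multiple of that of the Hermitian form.\<close>
  have energy: "v n * (norm (Q n))\<^sup>2 = 4 * pi * sqrt 2 * Im (cnj (Q n) * A n)" for n
  proof -
    have "(1 - \<i>) * (s n * Q n * cnj (Q n)) = - (4 * of_real pi * ((1 - \<i>) * csqrt \<i>)) * (cnj (Q n) * A n)"
      unfolding row by (simp add: mult_ac del: csqrt_ii)
    also have "(1 - \<i>) * csqrt \<i> = of_real (sqrt 2)"
      by (simp add: field_simps complex_eq_iff real_sqrt_mult_self)
    finally have "(1 - \<i>) * (s n * (Q n * cnj (Q n))) = - of_real (4 * pi * sqrt 2) * (cnj (Q n) * A n)"
      by (simp add: mult.assoc)
    then have "(1 - \<i>) * (s n * of_real ((norm (Q n))\<^sup>2)) = - of_real (4 * pi * sqrt 2) * (cnj (Q n) * A n)"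
      by (simp only: complex_norm_square)
    from arg_cong[OF this, of Im] show ?thesis
      by (simp add: v_def algebra_simps)
  qed
  have lim: "(\<lambda>N. \<Sum>n\<in>{- int N..int N}. v n * (norm (Q n))\<^sup>2) \<longlonglongrightarrow> 0"
    using tendsto_mult_left[OF Im_truncated_form_tendsto_0[OF c herm Qdec], of "4 * pi * sqrt 2"]
    by (simp add: energy sum_distrib_left A_def)
  have vQ: "v n * (norm (Q n))\<^sup>2 = 0" for n
  proof -
    have "v n * (norm (Q n))\<^sup>2 \<le> 0"
    proof (rule LIMSEQ_le_const[OF lim], intro exI allI impI)
      fix N assume "nat \<bar>n\<bar> \<le> N"
      then show "v n * (norm (Q n))\<^sup>2 \<le> (\<Sum>n\<in>{- int N..int N}. v n * (norm (Q n))\<^sup>2)"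
        using v0 by (intro member_le_sum) auto
    qed
    moreover have "0 \<le> v n * (norm (Q n))\<^sup>2" using v0 by simp
    ultimately show ?thesis by linarith
  qed
  have van: "Q n = 0" if "0 < Re p \<or> Im p + of_int n * w < 0" for n
  proof -
    have "v n \<noteq> 0"
      using csqrt_sector(2)[of "p + \<i> * of_real (of_int n * w)"] p that
      by (auto simp: v_def s_def simp del: csqrt.sel)
    with vQ[of n] show ?thesis by simp
  qed
  \<comment> \<open>The first index for which the imaginary part of p + i n w is not
    negative.\<close>
  define n0 where "n0 = \<lceil>- Im p / w\<rceil>"
  have n0: "Q n = 0" if "n < n0" for n
  proof -
    have "real_of_int n < - Im p / w" using that unfolding n0_def by linarith
    then show ?thesis using w by (intro van) (simp add: field_simps)
  qed
  \<comment> \<open>In a row where \<open>Q n\<close> is already 0 the diagonal term drops out, and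
    the equation reduces to vanishing of the convolution, as \<open>generic_vanishing\<close>
    demands.\<close>
  have step: "\<forall>n < n0 + int j. Q n = 0" for j
  proof (induction j)
    case (Suc j)
    have "lattice_conv c Q n = 0" if "n < n0 + int j" for n
      using eq[of n] Suc that by (simp del: csqrt_ii)
    then have "Q (n0 + int j) = 0"
      using Suc by - (rule generic_vanishing[OF c gen B, of "n0 + int j"], blast+)
    moreover have "n < n0 + int j \<or> n = n0 + int j" if "n < n0 + int (Suc j)" for n
      using that by linarith
    ultimately show ?case using Suc by blast
  qed (use n0 in auto)
  have "n < n0 + int (nat (n - n0 + 1))" by linarith
  with step[of "nat (n - n0 + 1)"] show ?thesis by blast
qed

text \<open>The branch cut meets the closed right half plane only at 0, and there continuity follows
  from |csqrt z| = sqrt |z|.\<close>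

lemma tendsto_csqrt_halfplane:
  assumes "(f \<longlongrightarrow> z) F" and "0 \<le> Re z"
  shows "((\<lambda>x. csqrt (f x)) \<longlongrightarrow> csqrt z) F"
proof (cases "z = 0")
  case True
  have "((\<lambda>x. sqrt (norm (f x))) \<longlongrightarrow> sqrt (norm z)) F"
    by (intro tendsto_intros assms)
  then have "((\<lambda>x. norm (csqrt (f x))) \<longlongrightarrow> 0) F" using True by simp
  then show ?thesis using True tendsto_norm_zero_cancel by (metis csqrt_0)
next
  case False
  then have "z \<notin> \<real>\<^sub>\<le>\<^sub>0" using assms(2) by (auto simp: complex_nonpos_Reals_iff complex_eq_iff)
  then show ?thesis
    using assms(1) continuous_at_csqrt isCont_tendsto_compose by blast
qed

lemma lattice_conv_tendsto:
  fixes c :: "int \<Rightarrow> complex" and Q :: "nat \<Rightarrow> int \<Rightarrow> complex"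
  assumes c: "integrable (count_space UNIV) c" and B: "\<And>j n. norm (Q j n) \<le> B"
    and lim: "\<And>n. (\<lambda>j. Q j n) \<longlonglongrightarrow> Q' n"
  shows "(\<lambda>j. lattice_conv c (Q j) n) \<longlonglongrightarrow> lattice_conv c Q' n"
  unfolding lattice_conv_def
proof (rule integral_dominated_convergence[where w = "\<lambda>k. B * norm (c k)"])
  show "AE k in count_space UNIV. norm (c k * Q j (n + k)) \<le> B * norm (c k)" for j
  proof (intro AE_I2)
    fix k
    show "norm (c k * Q j (n + k)) \<le> B * norm (c k)"
      using mult_right_mono[OF B[of j "n + k"], of "norm (c k)"] by (simp add: norm_mult mult.commute)
  qed
qed (use c lim in \<open>auto intro!: tendsto_mult_left\<close>)

text \<open>Tychonoff; in this topology sequences converge entry by entry, which is why mass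
  escaping to infinity has to be excluded separately.\<close>

lemma compact_int_polydisc: "compact {Q :: int \<Rightarrow> complex. \<forall>n. norm (Q n) \<le> 1}"
proof -
  have "compactin (product_topology (\<lambda>_. euclidean) UNIV) (PiE UNIV (\<lambda>_::int. cball (0::complex) 1))"
    by (subst compactin_PiE) auto
  moreover have "PiE UNIV (\<lambda>_::int. cball (0::complex) 1) = {Q. \<forall>n. norm (Q n) \<le> 1}" by auto
  ultimately show ?thesis by (simp add: euclidean_product_topology)
qed

text \<open>If no constant worked, there would be normalised sequences with rows tending to 0. An
  entrywise limit lies in the kernel and is therefore 0. On the other hand the diagonal grows like
  sqrt |n|, so entries larger than 1/2 are confined to a fixed window and cannot all tend to 0. The
  bound \<open>B\<close> enters only through its finiteness, and \<open>C\<close> is independent of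
  it.\<close>

lemma lattice_a_priori_bound:
  fixes c :: "int \<Rightarrow> complex"
  assumes c: "integrable (count_space UNIV) c" and herm: "\<And>n. c n = cnj (c (- n))"
    and gen: "generic c" and w: "w > 0"
  shows "\<exists>C>0. \<forall>p Q M B. 0 \<le> Re p \<longrightarrow> Re p \<le> R \<longrightarrow> \<bar>Im p\<bar> \<le> w \<longrightarrow> (\<forall>n. norm (Q n) \<le> B) \<longrightarrow>
    (\<forall>n. norm (csqrt (p + \<i> * of_real (of_int n * w)) * Q n
                 + 4 * of_real pi * csqrt \<i> * lattice_conv c Q n)
          \<le> M * max 1 (sqrt (norm (p + \<i> * of_real (of_int n * w))))) \<longrightarrow> (\<forall>n. norm (Q n) \<le> C * M)"
proof (rule ccontr)
  define z where "z p n = p + \<i> * of_real (of_int n * w)" for p and n :: int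
  define row where "row p Q n = csqrt (z p n) * Q n + 4 * of_real pi * csqrt \<i> * lattice_conv c Q n" for p Q n
  define P where "P = {p. 0 \<le> Re p \<and> Re p \<le> R \<and> \<bar>Im p\<bar> \<le> w}"
  define K where "K = {Q :: int \<Rightarrow> complex. \<forall>n. norm (Q n) \<le> 1}"
  define m where "m = (LINT k|count_space UNIV. norm (c k))"
  assume contr: "\<not> ?thesis"
  have "\<exists>p Q. p \<in> P \<and> Q \<in> K \<and> (\<exists>n. norm (Q n) > 1/2) \<and>
      (\<forall>n. norm (row p Q n) \<le> 1 / (real j + 1) * max 1 (sqrt (norm (z p n))))" for j :: nat
  proof -
    have "0 < real j + 1" by simp
    with contr obtain p Q M B n0 where p: "p \<in> P" and B: "\<And>n. norm (Q n) \<le> B"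
      and rw: "\<And>n. norm (row p Q n) \<le> M * max 1 (sqrt (norm (z p n)))"
      and n0: "\<not> norm (Q n0) \<le> (real j + 1) * M"
      unfolding row_def z_def P_def by blast
    \<comment> \<open>The supremum is finite because of \<open>B\<close>; dividing by it removes
      \<open>B\<close> from the estimate.\<close>
    define s where "s = (SUP n. norm (Q n))"
    have bdd: "bdd_above (range (\<lambda>n. norm (Q n)))" using B by (intro bdd_aboveI2)
    have Qs: "norm (Q n) \<le> s" for n unfolding s_def by (intro cSUP_upper bdd) auto
    have "0 \<le> M * max 1 (sqrt (norm (z p 0)))" using rw[of 0] norm_ge_zero order_trans by blast
    then have M0: "0 \<le> M" by (simp add: zero_le_mult_iff)
    have sM: "(real j + 1) * M < s" using n0 Qs[of n0] by linarith
    have s0: "0 < s" using sM M0 by (smt (verit) mult_nonneg_nonneg of_nat_0_le_iff)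
    obtain n1 where n1: "s / 2 < norm (Q n1)"
      using less_cSUP_iff[of UNIV "\<lambda>n. norm (Q n)" "s / 2"] bdd s0 unfolding s_def by auto
    define Q' where "Q' n = Q n / of_real s" for n
    have "row p Q' n = row p Q n / of_real s" for n
      by (simp add: row_def lattice_conv_def Q'_def add_divide_distrib del: csqrt_ii)
    then have "norm (row p Q' n) \<le> M / s * max 1 (sqrt (norm (z p n)))" for n
      using rw[of n] s0 by (simp add: norm_divide divide_right_mono)
    moreover have "M / s * max 1 (sqrt (norm (z p n))) \<le> 1 / (real j + 1) * max 1 (sqrt (norm (z p n)))" for n
      using s0 sM by (intro mult_right_mono) (auto simp: field_simps)
    ultimately have "norm (row p Q' n) \<le> 1 / (real j + 1) * max 1 (sqrt (norm (z p n)))" for n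
      by (meson order_trans)
    moreover have "Q' \<in> K" using Qs s0 by (auto simp: K_def Q'_def norm_divide)
    moreover have "norm (Q' n1) > 1/2" using n1 s0 by (simp add: Q'_def norm_divide field_simps)
    ultimately show ?thesis using p by blast
  qed
  then obtain p Q where pP: "\<And>j::nat. p j \<in> P" and QK: "\<And>j. Q j \<in> K"
    and big: "\<And>j. \<exists>n. norm (Q j n) > 1/2"
    and small: "\<And>j n. norm (row (p j) (Q j) n) \<le> 1 / (real j + 1) * max 1 (sqrt (norm (z (p j) n)))"
    by metis
  \<comment> \<open>The box includes the edge Re p = 0, so the limit may lie on the imaginary axis;
    the resulting bound is uniform up to it.\<close>
  have "P = cbox (Complex 0 (- w)) (Complex R w)" by (auto simp: P_def in_cbox_complex_iff)
  then have "compact (P \<times> K)" unfolding K_def by (intro compact_Times compact_int_polydisc) auto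
  then have "seq_compact (P \<times> K)" by (rule compact_imp_seq_compact)
  then obtain l r where lK: "l \<in> P \<times> K" and r: "strict_mono r"
    and lim: "((\<lambda>j. (p j, Q j)) \<circ> r) \<longlonglongrightarrow> l"
    using pP QK by (elim seq_compactE[of _ "\<lambda>j. (p j, Q j)"]) auto
  obtain p' Q' where l: "l = (p', Q')" by force
  have p': "p' \<in> P" and Q'K: "Q' \<in> K" using lK l by auto
  have plim: "(\<lambda>j. p (r j)) \<longlonglongrightarrow> p'" using tendsto_fst[OF lim] by (simp add: l)
  have "(\<lambda>j. Q (r j)) \<longlonglongrightarrow> Q'" using tendsto_snd[OF lim] by (simp add: l)
  from continuous_on_tendsto_compose[OF continuous_on_product_coordinates this]
  have Qlim: "(\<lambda>j. Q (r j) n) \<longlonglongrightarrow> Q' n" for n by simp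
  have Q1: "norm (Q j n) \<le> 1" for j n using QK[of j] by (simp add: K_def)
  have zlim: "(\<lambda>j. z (p (r j)) n) \<longlonglongrightarrow> z p' n" for n
    unfolding z_def by (intro tendsto_intros plim)
  have rowlim: "(\<lambda>j. row (p (r j)) (Q (r j)) n) \<longlonglongrightarrow> row p' Q' n" for n
    unfolding row_def using p'
    by (intro tendsto_intros tendsto_csqrt_halfplane zlim Qlim lattice_conv_tendsto[OF c Q1])
      (auto simp: z_def P_def)
  have row0: "row p' Q' n = 0" for n
  proof -
    have rt: "filterlim r at_top sequentially" using r by (rule filterlim_subseq)
    have "(\<lambda>j. 1 / (real (r j) + 1)) \<longlonglongrightarrow> 0"
      using filterlim_compose[OF LIMSEQ_inverse_real_of_nat rt] by (simp add: inverse_eq_divide add.commute)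
    then have "(\<lambda>j. 1 / (real (r j) + 1) * max 1 (sqrt (norm (z (p (r j)) n)))) \<longlonglongrightarrow> 0 * max 1 (sqrt (norm (z p' n)))"
      by (intro tendsto_intros zlim)
    then have "(\<lambda>j. 1 / (real (r j) + 1) * max 1 (sqrt (norm (z (p (r j)) n)))) \<longlonglongrightarrow> 0" by simp
    then have "(\<lambda>j. row (p (r j)) (Q (r j)) n) \<longlonglongrightarrow> 0"
      by (rule Lim_null_comparison[rotated]) (use small in auto)
    then show ?thesis using rowlim LIMSEQ_unique by blast
  qed
  have Q'0: "Q' n = 0" for n
  proof (rule lattice_kernel_trivial[OF c herm gen w])
    show "0 \<le> Re p'" using p' by (simp add: P_def)
    show "norm (Q' n) \<le> 1" for n using Q'K by (simp add: K_def)
    show "csqrt (p' + \<i> * of_real (of_int n * w)) * Q' n + 4 * of_real pi * csqrt \<i> * lattice_conv c Q' n = 0" for n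
      using row0[of n] by (simp only: row_def z_def)
  qed
  have m0: "0 \<le> m" by (simp add: m_def)
  \<comment> \<open>Outside this window sqrt |p_n| >= 16 (pi m + 1), so the convolution term 4 pi m
    is at most a quarter of the diagonal. For j >= 8 the row error is at most an eighth of it, and
    1/4 + 1/8 < 1/2.\<close>
  define N where "N = nat \<lceil>((16 * (pi * m + 1))\<^sup>2 + w) / w\<rceil> + 1"
  have loc: "\<bar>n\<bar> \<le> int N" if j: "j \<ge> 8" and n: "norm (Q j n) > 1/2" for j n
  proof (rule ccontr)
    assume "\<not> \<bar>n\<bar> \<le> int N"
    then have "((16 * (pi * m + 1))\<^sup>2 + w) / w \<le> \<bar>real_of_int n\<bar>" unfolding N_def by linarith
    then have "(16 * (pi * m + 1))\<^sup>2 + w \<le> \<bar>real_of_int n * w\<bar>"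
      using w by (simp add: field_simps abs_mult)
    also have "\<dots> \<le> \<bar>Im (z (p j) n)\<bar> + w"
      using pP[of j] by (auto simp: z_def P_def)
    finally have "(16 * (pi * m + 1))\<^sup>2 \<le> norm (z (p j) n)"
      using abs_Im_le_cmod[of "z (p j) n"] by linarith
    then have big: "16 * (pi * m + 1) \<le> sqrt (norm (z (p j) n))" by (simp add: real_le_rsqrt)
    then have "16 \<le> sqrt (norm (z (p j) n))" using m0 by (smt (verit) mult_nonneg_nonneg pi_ge_zero)
    have "sqrt (norm (z (p j) n)) * norm (Q j n)
        = norm (row (p j) (Q j) n - 4 * of_real pi * csqrt \<i> * lattice_conv c (Q j) n)"
      by (simp add: row_def norm_mult del: csqrt_ii)
    also have "\<dots> \<le> norm (row (p j) (Q j) n) + 4 * pi * norm (lattice_conv c (Q j) n)"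
      by (rule order_trans[OF norm_triangle_ineq4]) (simp add: norm_mult del: csqrt_ii)
    also have "\<dots> \<le> 1 / (real j + 1) * sqrt (norm (z (p j) n)) + 4 * pi * (1 * m)"
      using small[of j n] \<open>16 \<le> _\<close> norm_lattice_conv_le[OF c, of "Q j" 1 n] Q1 unfolding m_def
      by (intro add_mono mult_left_mono) auto
    also have "\<dots> \<le> 1/8 * sqrt (norm (z (p j) n)) + 1/4 * sqrt (norm (z (p j) n))"
      using big j m0 by (intro add_mono mult_right_mono) (auto simp: field_simps)
    also have "\<dots> < sqrt (norm (z (p j) n)) * (1/2)" using \<open>16 \<le> _\<close> by linarith
    finally have "norm (Q j n) < 1/2"
      by (rule mult_left_less_imp_less) simp
    with n show False by simp
  qed
  have "\<forall>\<^sub>F j in sequentially. \<forall>n\<in>{- int N..int N}. norm (Q (r j) n) < 1/2"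
  proof (intro eventually_ball_finite ballI)
    fix n
    have "(\<lambda>j. norm (Q (r j) n)) \<longlonglongrightarrow> 0" using tendsto_norm_zero[of "\<lambda>j. Q (r j) n"] Qlim[of n] Q'0 by simp
    then show "\<forall>\<^sub>F j in sequentially. norm (Q (r j) n) < 1/2" by (rule order_tendstoD) simp
  qed simp
  moreover have "\<forall>\<^sub>F j in sequentially. 8 \<le> r j"
    using filterlim_subseq[OF r] by (simp add: filterlim_at_top)
  ultimately have "\<forall>\<^sub>F j::nat in sequentially. False"
  proof eventually_elim
    case (elim j)
    obtain n where n: "norm (Q (r j) n) > 1/2" using big by blast
    then have "n \<in> {- int N..int N}" using loc[OF elim(2) n] by auto
    then show False using elim(1) n by force
  qed
  then show False by simp
qed

section \<open>The charge equation\<close>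

text \<open>Taylor coefficients of (1 - x)^(1/2), the reciprocal of the series with coefficients
  \<open>abel_coeff\<close>.\<close>

definition half_coeff :: "nat \<Rightarrow> real" where
  "half_coeff i = (-1) ^ i * ((1/2) gchoose i)"

lemma half_coeff_0 [simp]: "half_coeff 0 = 1"
  by (simp add: half_coeff_def)

lemma abs_half_coeff_le: "\<bar>half_coeff i\<bar> \<le> 1"
proof (induction i)
  case (Suc i)
  have "half_coeff (Suc i) = half_coeff i * ((real i - 1/2) / (real i + 1))"
    by (simp add: half_coeff_def gbinomial_prod_rev field_simps)
  moreover have "\<bar>(real i - 1/2) / (real i + 1)\<bar> \<le> 1" by (simp add: abs_le_iff)
  ultimately show ?case using Suc by (simp only: abs_mult) (rule mult_le_one, auto)
qed simp

lemma half_coeff_abel_coeff: "(\<Sum>i\<le>n. half_coeff i * abel_coeff (n - i)) = (if n = 0 then 1 else 0)"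
proof -
  have "(\<Sum>i\<le>n. half_coeff i * abel_coeff (n - i)) = (\<Sum>i\<le>n. (-1) ^ n * ((1/2 gchoose i) * (-1/2 gchoose (n - i))))"
  proof (intro sum.cong refl)
    fix i assume "i \<in> {..n}"
    then have "(-1 :: real) ^ n = (-1) ^ i * (-1) ^ (n - i)" by (simp flip: power_add)
    then show "half_coeff i * abel_coeff (n - i) = (-1) ^ n * ((1/2 gchoose i) * (-1/2 gchoose (n - i)))"
      by (simp add: half_coeff_def abel_coeff_def mult_ac)
  qed
  also have "\<dots> = (-1) ^ n * ((1/2 + - 1/2) gchoose n :: real)"
    by (simp only: gbinomial_Vandermonde sum_distrib_left[symmetric] atLeast0AtMost[symmetric])
  finally show ?thesis by (cases n) auto
qed

text \<open>In generating functions over the moment index, the Abel kernel acts as multiplication by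
  (1 - x / z)^(-1/2) / s. Multiplication by s (1 - x / z)^(1/2) undoes it, so Abel's equation is
  inverted without a fractional derivative of the charge.\<close>

lemma abel_moment_inversion:
  fixes G Q :: "nat \<Rightarrow> complex"
  assumes z: "z \<noteq> 0" "s \<noteq> 0"
    and Q: "\<And>m. Q m = K * (\<Sum>i\<le>m. of_real (abel_coeff i) / (z ^ i * s) * G (m - i))"
  shows "K * G m = s * (\<Sum>i\<le>m. of_real (half_coeff i) / z ^ i * Q (m - i))"
proof -
  define Cf where "Cf = Abs_fps (\<lambda>i. of_real (abel_coeff i) / z ^ i)"
  define Bf where "Bf = Abs_fps (\<lambda>i. of_real (half_coeff i) / z ^ i)"
  define Gf where "Gf = Abs_fps G"
  define Qf where "Qf = Abs_fps Q"
  have BC: "Bf * Cf = 1"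
  proof (rule fps_ext)
    fix n
    have "fps_nth (Bf * Cf) n = (\<Sum>i\<le>n. of_real (half_coeff i * abel_coeff (n - i)) / z ^ n)"
      unfolding fps_mult_nth atLeast0AtMost
    proof (intro sum.cong refl)
      fix i assume "i \<in> {..n}"
      then have "z ^ n = z ^ i * z ^ (n - i)" by (simp flip: power_add)
      then show "fps_nth Bf i * fps_nth Cf (n - i) = of_real (half_coeff i * abel_coeff (n - i)) / z ^ n"
        by (simp add: Bf_def Cf_def)
    qed
    also have "\<dots> = of_real (\<Sum>i\<le>n. half_coeff i * abel_coeff (n - i)) / z ^ n"
      by (simp add: sum_divide_distrib)
    also have "\<dots> = fps_nth (1 :: complex fps) n" unfolding half_coeff_abel_coeff by (cases n) auto
    finally show "fps_nth (Bf * Cf) n = fps_nth 1 n" .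
  qed
  have "Qf = fps_const (K / s) * (Cf * Gf)"
  proof (rule fps_ext)
    fix n
    show "fps_nth Qf n = fps_nth (fps_const (K / s) * (Cf * Gf)) n"
      unfolding fps_mult_left_const_nth fps_mult_nth[of Cf Gf] atLeast0AtMost
      by (simp add: Qf_def Cf_def Gf_def Q sum_distrib_left mult_ac)
  qed
  then have "Bf * Qf = fps_const (K / s) * (Bf * Cf * Gf)" by (simp only: mult_ac)
  then have "fps_nth (Bf * Qf) m = K / s * G m" by (simp add: BC Gf_def)
  then have "(\<Sum>i\<le>m. of_real (half_coeff i) / z ^ i * Q (m - i)) = K / s * G m"
    unfolding fps_mult_nth atLeast0AtMost by (simp add: Bf_def Qf_def)
  then show ?thesis using z by simp
qed

text \<open>Each mode exp (- i k w t) of \<open>\<alpha>\<close> only moves the Laplace variable by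
  i k w. The shift is imaginary, so the absolute value of the integrand does not depend on k, and
  summability of \<open>c\<close> permits the exchange of sum and integral.\<close>

lemma laplace_moment_lattice:
  fixes q :: "real \<Rightarrow> complex" and c :: "int \<Rightarrow> complex" and \<alpha> :: "real \<Rightarrow> real"
  assumes c: "integrable (count_space UNIV) c"
    and \<alpha>: "\<And>t. of_real (\<alpha> t) = (LINT k|count_space UNIV. c k * exp (- (\<i> * of_real (of_int k * w) * of_real t)))"
    and q: "laplaceable (Re p) q"
  shows "laplace_moment m (\<lambda>t. of_real (\<alpha> t) * q t) (p + \<i> * of_real (of_int n * w))
    = lattice_conv c (\<lambda>k. laplace_moment m q (p + \<i> * of_real (of_int k * w))) n"
proof -
  interpret CL: pair_sigma_finite "count_space (UNIV :: int set)" lborel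
    by (intro pair_sigma_finite.intro sigma_finite_measure_count_space lborel.sigma_finite_measure_axioms)
  define z where "z k = p + \<i> * of_real (of_int k * w)" for k :: int
  define u where "u k t = indicator {0<..} t *\<^sub>R (of_real (t ^ m / fact m) * q t * exp (- (z k * of_real t)))" for k and t :: real
  have ui: "integrable lborel (u k)" for k
    using laplaceable_integrable[of "z k" q m] q by (simp add: z_def u_def[abs_def] set_integrable_def)
  have un: "norm (u k t) = norm (u 0 t)" for k t
    by (simp add: u_def z_def norm_mult norm_divide norm_power)
  have us: "c k * exp (- (\<i> * of_real (of_int k * w) * of_real t)) * u n t = c k * u (n + k) t" for k t
  proof -
    have "exp (- (\<i> * of_real (of_int k * w) * of_real t)) * exp (- (z n * of_real t)) = exp (- (z (n + k) * of_real t))"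
      unfolding exp_add[symmetric] by (simp add: z_def algebra_simps)
    then show ?thesis by (simp add: u_def scaleR_conv_of_real)
  qed
  have fint: "integrable (count_space UNIV \<Otimes>\<^sub>M lborel) (\<lambda>(k, t). c k * u (n + k) t)"
  proof (rule CL.Fubini_integrable)
    show "(\<lambda>(k, t). c k * u (n + k) t) \<in> borel_measurable (count_space UNIV \<Otimes>\<^sub>M lborel)"
      by (rule measurable_pair_measure_countable1) (use ui in auto)
    show "AE k in count_space UNIV. integrable lborel (\<lambda>t. case (k, t) of (k, t) \<Rightarrow> c k * u (n + k) t)"
      using ui by auto
    show "integrable (count_space UNIV) (\<lambda>k. LINT t|lborel. norm (case (k, t) of (k, t) \<Rightarrow> c k * u (n + k) t))"
    proof -
      have "(LINT t|lborel. norm (case (k, t) of (k, t) \<Rightarrow> c k * u (n + k) t)) = norm (c k) * (LINT t|lborel. norm (u 0 t))" for k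
        by (simp only: case_prod_conv norm_mult un[of "n + k"] integral_mult_right_zero)
      then show ?thesis using c by simp
    qed
  qed
  have "laplace_moment m (\<lambda>t. of_real (\<alpha> t) * q t) (z n) = (LINT t|lborel. of_real (\<alpha> t) * u n t)"
    unfolding laplace_moment_def set_lebesgue_integral_def
    by (intro Bochner_Integration.integral_cong refl) (simp add: u_def scaleR_conv_of_real)
  also have "\<dots> = (LINT t|lborel. (LINT k|count_space UNIV. c k * u (n + k) t))"
    unfolding \<alpha> integral_mult_left_zero[symmetric] us ..
  also have "\<dots> = (LINT k|count_space UNIV. (LINT t|lborel. c k * u (n + k) t))"
    using CL.Fubini_integral[OF fint] by simp
  also have "\<dots> = lattice_conv c (\<lambda>k. laplace_moment m q (z k)) n"
    unfolding lattice_conv_def laplace_moment_def set_lebesgue_integral_def u_def integral_mult_right_zero ..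
  finally show ?thesis by (simp only: z_def)
qed

section \<open>Absolute convergence of convolutions with the Abel kernel\<close>

lemma set_integrable_abel_conv:
  fixes g :: "real \<Rightarrow> complex"
  assumes t: "t > 0" and \<Lambda>: "\<Lambda> \<ge> 0" and g: "continuous_on {0<..} g"
    and B: "\<And>s. 0 < s \<Longrightarrow> s < t \<Longrightarrow> norm (g s) \<le> B * (1 + 1 / sqrt s)"
  shows "set_integrable lborel {0<..<t} (\<lambda>s. abel_kernel \<Lambda> (t - s) * g s)"
proof (rule set_integrable_bound)
  show "set_integrable lborel {0<..<t} (\<lambda>s. B * (1 / sqrt (t - s) + 1 / (sqrt (t - s) * sqrt s)))"
    using set_integral_reflect(1)[OF set_integral_inverse_sqrt(1)[OF t]] set_integral_arcsine(1)[OF t]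
    by (intro set_integrable_mult_right set_integral_add)
  have "continuous_on {0<..<t} (\<lambda>s. abel_kernel \<Lambda> (t - s) * g s)"
    unfolding abel_kernel_def by (intro continuous_intros continuous_on_subset[OF g]) auto
  from borel_measurable_continuous_on_indicator[OF _ this]
  show "set_borel_measurable lborel {0<..<t} (\<lambda>s. abel_kernel \<Lambda> (t - s) * g s)"
    by (simp add: set_borel_measurable_def)
  show "AE s in lborel. s \<in> {0<..<t} \<longrightarrow> norm (abel_kernel \<Lambda> (t - s) * g s)
      \<le> norm (B * (1 / sqrt (t - s) + 1 / (sqrt (t - s) * sqrt s)))"
  proof (intro AE_I2 impI)
    fix s assume s: "s \<in> {0<..<t}"
    have "norm (abel_kernel \<Lambda> (t - s)) \<le> 1 / sqrt (t - s)"
      using s \<Lambda> by (simp add: abel_kernel_def norm_divide divide_right_mono)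
    then have "norm (abel_kernel \<Lambda> (t - s) * g s) \<le> 1 / sqrt (t - s) * (B * (1 + 1 / sqrt s))"
      unfolding norm_mult using B[of s] s by (intro mult_mono) auto
    also have "\<dots> = B * (1 / sqrt (t - s) + 1 / (sqrt (t - s) * sqrt s))"
      by (simp add: distrib_left add_divide_distrib mult_ac)
    finally show "norm (abel_kernel \<Lambda> (t - s) * g s) \<le> norm (B * (1 / sqrt (t - s) + 1 / (sqrt (t - s) * sqrt s)))"
      unfolding real_norm_def by linarith
  qed
qed

lemma norm_half_conv_abel_le:
  fixes g :: "real \<Rightarrow> complex"
  assumes int: "set_integrable lborel {0<..<t} (\<lambda>s. abel_kernel \<Lambda> (t - s) * g s)"
    and f: "set_integrable lborel {0<..<t} f"
      "\<And>s. 0 < s \<Longrightarrow> s < t \<Longrightarrow> exp (- (\<Lambda> * (t - s))) / sqrt (t - s) * norm (g s) \<le> f s"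
  shows "norm (half_conv (abel_kernel \<Lambda>) g t) \<le> (LBINT s:{0<..<t}. f s)"
proof -
  have "norm (half_conv (abel_kernel \<Lambda>) g t) \<le> (LBINT s:{0<..<t}. norm (abel_kernel \<Lambda> (t - s) * g s))"
    unfolding half_conv_def set_lebesgue_integral_def
    by (rule order_trans[OF integral_norm_bound]) (simp add: norm_mult)
  also have "\<dots> \<le> (LBINT s:{0<..<t}. f s)"
    using f(2) by (intro set_integral_mono set_integrable_norm int f(1)) (auto simp: norm_mult abel_kernel_def norm_divide)
  finally show ?thesis .
qed

text \<open>The analytic core of the charge equation: \<open>w\<close> is the frequency,
  \<open>E\<close> the binding energy, and \<open>\<kappa>\<close> the constant between the evolved
  bound state at the origin and \<open>bound_state_datum\<close>. The wave function itself no longer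
  appears.\<close>

locale charge_problem =
  fixes \<alpha> :: "real \<Rightarrow> real" and w E :: real and c :: "int \<Rightarrow> complex" and \<kappa> :: complex
    and q :: "real \<Rightarrow> complex"
  assumes w: "w > 0" and E: "E > 0"
    and c: "integrable (count_space UNIV) c" and herm: "\<And>n. c n = cnj (c (- n))" and gen: "generic c"
    and \<alpha>: "\<And>t. of_real (\<alpha> t) = (LINT k|count_space UNIV. c k * exp (- (\<i> * of_real (of_int k * w) * of_real t)))"
    and \<alpha>_cont: "continuous_on UNIV \<alpha>"
    and q_cont: "continuous_on {0<..} q" and q_bdd: "bounded (q ` {0<..1})"
    and q_eq: "\<And>t. t > 0 \<Longrightarrow> q t = 4 * csqrt (of_real pi * \<i>) *
        half_conv (abel_kernel 0) (\<lambda>s. \<kappa> * bound_state_datum E s - of_real (\<alpha> s) * q s) t"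
begin

definition "\<gamma> = 4 * csqrt (of_real pi * \<i>)"

definition "source s = \<kappa> * bound_state_datum E s - of_real (\<alpha> s) * q s"

definition "csum = (LINT k|count_space UNIV. norm (c k))"

definition "growth s \<longleftrightarrow> (\<exists>C. \<forall>t>0. norm (q t) \<le> C * exp (s * t))"

lemma csum_nonneg: "0 \<le> csum"
  by (simp add: csum_def)

lemma \<gamma>_sqrt_pi: "\<gamma> * of_real (sqrt pi) = 4 * of_real pi * csqrt \<i>"
proof -
  have "csqrt (of_real pi * \<i>) = of_real (sqrt pi) * csqrt \<i>" by (rule csqrt_scale) simp
  moreover have "complex_of_real (sqrt pi) * of_real (sqrt pi) = of_real pi"
    by (simp flip: of_real_mult)
  ultimately show ?thesis by (simp add: \<gamma>_def mult_ac del: csqrt_ii)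
qed

section \<open>Elementary bounds for the source and its Abel convolutions\<close>

lemma abs_\<alpha>_le: "\<bar>\<alpha> t\<bar> \<le> csum"
proof -
  have "\<bar>\<alpha> t\<bar> = norm (LINT k|count_space UNIV. c k * exp (- (\<i> * of_real (of_int k * w) * of_real t)))"
    unfolding \<alpha>[symmetric] by simp
  also have "\<dots> \<le> (LINT k|count_space UNIV. norm (c k * exp (- (\<i> * of_real (of_int k * w) * of_real t))))"
    by (rule integral_norm_bound)
  finally show ?thesis by (simp add: norm_mult csum_def)
qed

lemma continuous_\<alpha>q: "continuous_on {0<..} (\<lambda>s. of_real (\<alpha> s) * q s)"
  by (intro continuous_intros q_cont continuous_on_subset[OF \<alpha>_cont]) auto

lemma continuous_source: "continuous_on {0<..} source"
  unfolding source_def by (intro continuous_intros continuous_on_bound_state_datum E continuous_\<alpha>q)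

lemma norm_datum_le:
  assumes "s > 0"
  shows "norm (bound_state_datum E s) \<le> sqrt pi / sqrt s"
proof -
  have "sqrt pi / sqrt s = sqrt pi * (1 / sqrt s)" by simp
  then show ?thesis
    using norm_bound_state_datum_le(2)[OF E assms] by (simp only: inverse_sqrt_powr[OF assms])
qed

lemma norm_\<alpha>q_le: "norm (of_real (\<alpha> s) * q s) \<le> csum * norm (q s)"
  using mult_right_mono[OF abs_\<alpha>_le[of s], of "norm (q s)"] by (simp add: norm_mult)

lemma integrable_conv_datum:
  assumes "t > 0" "\<Lambda> \<ge> 0"
  shows "set_integrable lborel {0<..<t} (\<lambda>s. abel_kernel \<Lambda> (t - s) * bound_state_datum E s)"
proof (rule set_integrable_abel_conv[OF assms continuous_on_bound_state_datum[OF E]])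
  fix s assume "0 < s" "s < t"
  then show "norm (bound_state_datum E s) \<le> sqrt pi * (1 + 1 / sqrt s)"
    using norm_datum_le[of s] by (auto simp: distrib_left intro: order_trans)
qed

lemma integrable_conv_\<alpha>q:
  assumes "t > 0" "\<Lambda> \<ge> 0"
  shows "set_integrable lborel {0<..<t} (\<lambda>s. abel_kernel \<Lambda> (t - s) * (of_real (\<alpha> s) * q s))"
proof -
  obtain B where B: "\<And>s. 0 < s \<Longrightarrow> s \<le> t \<Longrightarrow> norm (q s) \<le> B"
    using bounded_initial_segment[OF q_cont q_bdd] by blast
  show ?thesis
  proof (rule set_integrable_abel_conv[OF assms continuous_\<alpha>q])
    fix s assume s: "0 < s" "s < t"
    have B0: "0 \<le> B" using B[of s] s norm_ge_zero order_trans by (metis less_imp_le)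
    have "norm (of_real (\<alpha> s) * q s) \<le> csum * B"
      using norm_\<alpha>q_le[of s] B[of s] s csum_nonneg by (meson less_imp_le mult_left_mono order_trans)
    also have "\<dots> \<le> csum * B * (1 + 1 / sqrt s)"
      using mult_left_mono[of 1 "1 + 1 / sqrt s" "csum * B"] csum_nonneg B0 s by simp
    finally show "norm (of_real (\<alpha> s) * q s) \<le> csum * B * (1 + 1 / sqrt s)" .
  qed
qed

lemma half_conv_source:
  assumes "t > 0" "\<Lambda> \<ge> 0"
  shows "half_conv (abel_kernel \<Lambda>) source t =
    \<kappa> * half_conv (abel_kernel \<Lambda>) (bound_state_datum E) t
    - half_conv (abel_kernel \<Lambda>) (\<lambda>s. of_real (\<alpha> s) * q s) t"
proof -
  have "half_conv (abel_kernel \<Lambda>) source t = (LBINT s:{0<..<t}. \<kappa> * (abel_kernel \<Lambda> (t - s) * bound_state_datum E s)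
      - abel_kernel \<Lambda> (t - s) * (of_real (\<alpha> s) * q s))"
    unfolding half_conv_def source_def by (simp add: algebra_simps)
  also have "\<dots> = \<kappa> * half_conv (abel_kernel \<Lambda>) (bound_state_datum E) t
      - half_conv (abel_kernel \<Lambda>) (\<lambda>s. of_real (\<alpha> s) * q s) t"
    unfolding half_conv_def set_integral_mult_right[symmetric]
    by (rule set_integral_diff(2)[OF set_integrable_mult_right[OF integrable_conv_datum[OF assms]] integrable_conv_\<alpha>q[OF assms]])
  finally show ?thesis .
qed

lemma norm_conv_datum_le:
  assumes "t > 0" "\<Lambda> \<ge> 0"
  shows "norm (half_conv (abel_kernel \<Lambda>) (bound_state_datum E) t) \<le> 6 * sqrt pi"
proof -
  have "norm (half_conv (abel_kernel \<Lambda>) (bound_state_datum E) t) \<le> (LBINT s:{0<..<t}. sqrt pi * (1 / (sqrt (t - s) * sqrt s)))"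
  proof (rule norm_half_conv_abel_le[OF integrable_conv_datum[OF assms]])
    show "set_integrable lborel {0<..<t} (\<lambda>s. sqrt pi * (1 / (sqrt (t - s) * sqrt s)))"
      by (intro set_integrable_mult_right set_integral_arcsine(1) assms)
    fix s assume s: "0 < s" "s < t"
    have "exp (- (\<Lambda> * (t - s))) / sqrt (t - s) * norm (bound_state_datum E s) \<le> 1 / sqrt (t - s) * (sqrt pi / sqrt s)"
      using s assms norm_datum_le[of s] by (intro mult_mono divide_right_mono) auto
    then show "exp (- (\<Lambda> * (t - s))) / sqrt (t - s) * norm (bound_state_datum E s) \<le> sqrt pi * (1 / (sqrt (t - s) * sqrt s))"
      by (simp add: mult_ac)
  qed
  also have "\<dots> = sqrt pi * (LBINT s:{0<..<t}. 1 / (sqrt (t - s) * sqrt s))" by (rule set_integral_mult_right)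
  also have "\<dots> \<le> sqrt pi * 6" using assms by (intro mult_left_mono set_integral_arcsine(2)) auto
  finally show ?thesis by simp
qed

lemma norm_conv_\<alpha>q_le:
  assumes "t > 0" "\<Lambda> \<ge> 0"
  shows "norm (half_conv (abel_kernel \<Lambda>) (\<lambda>s. of_real (\<alpha> s) * q s) t)
    \<le> csum * (LBINT s:{0<..<t}. exp (- (\<Lambda> * (t - s))) / sqrt (t - s) * norm (q s))"
proof -
  obtain B where B: "\<And>s. 0 < s \<Longrightarrow> s \<le> t \<Longrightarrow> norm (q s) \<le> B"
    using bounded_initial_segment[OF q_cont q_bdd] by blast
  have "set_integrable lborel {0<..<t} (\<lambda>s. abel_kernel \<Lambda> (t - s) * q s)"
  proof (rule set_integrable_abel_conv[OF assms q_cont])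
    fix s assume s: "0 < s" "s < t"
    have "0 \<le> B" using B[of s] s norm_ge_zero order_trans by (metis less_imp_le)
    then have "B \<le> B * (1 + 1 / sqrt s)" using s by (simp add: mult_le_cancel_left1)
    then show "norm (q s) \<le> B * (1 + 1 / sqrt s)" using B[of s] s by linarith
  qed
  from set_integrable_norm[OF this]
  have qi: "set_integrable lborel {0<..<t} (\<lambda>s. exp (- (\<Lambda> * (t - s))) / sqrt (t - s) * norm (q s))"
    by (rule set_integrable_cong[THEN iffD1, rotated -1]) (auto simp: norm_mult abel_kernel_def norm_divide)
  have "norm (half_conv (abel_kernel \<Lambda>) (\<lambda>s. of_real (\<alpha> s) * q s) t)
      \<le> (LBINT s:{0<..<t}. csum * (exp (- (\<Lambda> * (t - s))) / sqrt (t - s) * norm (q s)))"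
  proof (rule norm_half_conv_abel_le[OF integrable_conv_\<alpha>q[OF assms] set_integrable_mult_right[OF qi]])
    fix s assume s: "0 < s" "s < t"
    have "exp (- (\<Lambda> * (t - s))) / sqrt (t - s) * norm (of_real (\<alpha> s) * q s)
        \<le> exp (- (\<Lambda> * (t - s))) / sqrt (t - s) * (csum * norm (q s))"
      using s norm_\<alpha>q_le[of s] by (intro mult_left_mono) auto
    then show "exp (- (\<Lambda> * (t - s))) / sqrt (t - s) * norm (of_real (\<alpha> s) * q s)
        \<le> csum * (exp (- (\<Lambda> * (t - s))) / sqrt (t - s) * norm (q s))" by (simp only: mult_ac)
  qed
  then show ?thesis by (simp only: set_integral_mult_right)
qed

lemma q_eq': "t > 0 \<Longrightarrow> q t = \<gamma> * half_conv (abel_kernel 0) source t"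
  using q_eq[of t] by (simp add: \<gamma>_def source_def[abs_def])

text \<open>Gronwall for the undamped kernel with an exponential weight: the weight plays the role
  of the damping. This is what makes Laplace transforms available at all.\<close>

lemma initial_growth: "\<exists>s>0. growth s"
proof -
  define C where "C = norm \<gamma> * csum"
  \<comment> \<open>Large enough for C sqrt (pi / \<sigma>) <= 1/2; the summand 1 keeps it
    positive.\<close>
  define \<sigma> where "\<sigma> = 4 * pi * C\<^sup>2 + 1"
  define A where "A = norm \<gamma> * (norm \<kappa> * (6 * sqrt pi))"
  have C0: "0 \<le> C" using csum_nonneg by (simp add: C_def)
  have \<sigma>0: "\<sigma> > 0" by (simp add: \<sigma>_def add_nonneg_pos)
  have A0: "0 \<le> A" by (simp add: A_def)
  have "exp (- (\<sigma> * t)) * norm (q t) \<le> 2 * A" if t: "t > 0" for t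
  proof (rule weighted_abel_gronwall[OF q_cont q_bdd, where v = "\<lambda>t. exp (- (\<sigma> * t))" and a = "\<lambda>_. A" and \<Lambda> = 0 and \<mu> = "- \<sigma>" and c = C])
    fix t :: real assume t: "t > 0"
    have "norm (q t) = norm \<gamma> * norm (\<kappa> * half_conv (abel_kernel 0) (bound_state_datum E) t
        - half_conv (abel_kernel 0) (\<lambda>s. of_real (\<alpha> s) * q s) t)"
      using q_eq'[OF t] half_conv_source[OF t, of 0] by (simp add: norm_mult)
    also have "\<dots> \<le> norm \<gamma> * (norm \<kappa> * (6 * sqrt pi) + csum * (LBINT s:{0<..<t}. exp (- (0 * (t - s))) / sqrt (t - s) * norm (q s)))"
      using norm_conv_datum_le[OF t, of 0] norm_conv_\<alpha>q_le[OF t, of 0]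
      by (intro mult_left_mono order_trans[OF norm_triangle_ineq4] add_mono) (auto simp: norm_mult mult_left_mono)
    finally show "norm (q t) \<le> A + C * (LBINT s:{0<..<t}. exp (- (0 * (t - s))) / sqrt (t - s) * norm (q s))"
      by (simp add: A_def C_def distrib_left mult.assoc)
    show "exp (- (\<sigma> * t)) * A \<le> A" using t \<sigma>0 A0 by (intro mult_left_le_one_le) auto
  next
    have "C\<^sup>2 * pi / \<sigma> \<le> (1/2)\<^sup>2" using \<sigma>0 by (simp add: \<sigma>_def divide_simps power2_eq_square)
    then have "sqrt (C\<^sup>2 * (pi / \<sigma>)) \<le> sqrt ((1/2)\<^sup>2)" by (intro real_sqrt_le_mono) simp
    then have "sqrt (C\<^sup>2 * (pi / \<sigma>)) \<le> 1/2" by (simp only: real_sqrt_abs abs_of_nonneg zero_le_divide_1_iff zero_le_numeral)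
    moreover have "sqrt (C\<^sup>2 * (pi / \<sigma>)) = C * sqrt (pi / \<sigma>)"
      using C0 by (simp only: real_sqrt_mult real_sqrt_abs abs_of_nonneg)
    ultimately show "C * sqrt (pi / (0 - - \<sigma>)) \<le> 1/2" by simp
  qed (use C0 \<sigma>0 t in \<open>auto intro!: continuous_intros simp: exp_add[symmetric] algebra_simps\<close>)
  then have le: "exp (\<sigma> * t) * (exp (- (\<sigma> * t)) * norm (q t)) \<le> exp (\<sigma> * t) * (2 * A)" if "t > 0" for t
    using that by (intro mult_left_mono) auto
  have "norm (q t) \<le> 2 * A * exp (\<sigma> * t)" if "t > 0" for t
    using le[OF that] by (simp only: mult.assoc[symmetric] exp_minus_inverse mult_1_left) (simp add: mult_ac)
  then show ?thesis using \<sigma>0 unfolding growth_def by blast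
qed

lemma growth_mono: "growth s \<Longrightarrow> s \<le> s' \<Longrightarrow> growth s'"
proof -
  assume "growth s" and le: "s \<le> s'"
  then obtain C where C: "\<And>t. t > 0 \<Longrightarrow> norm (q t) \<le> C * exp (s * t)" by (auto simp: growth_def)
  have "norm (q t) \<le> \<bar>C\<bar> * exp (s' * t)" if t: "t > 0" for t
  proof -
    have "C * exp (s * t) \<le> \<bar>C\<bar> * exp (s' * t)" using t le by (intro mult_mono) auto
    with C[OF t] show ?thesis by linarith
  qed
  then show "growth s'" unfolding growth_def by blast
qed

lemma laplaceable_datum: "\<sigma> > 0 \<Longrightarrow> laplaceable \<sigma> (bound_state_datum E)"
proof (rule laplaceableI[OF set_borel_measurable_half_line[OF continuous_on_bound_state_datum[OF E]]])
  fix t :: real assume "t > 0"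
  then show "norm (bound_state_datum E t) \<le> sqrt pi * (1 + t powr (-1/2)) * exp (0 * t)"
    using norm_bound_state_datum_le(2)[OF E, of t] by (auto simp: distrib_left intro: order_trans)
qed

lemma source_bound:
  assumes "growth s" "s \<ge> 0"
  shows "\<exists>B\<ge>0. \<forall>t>0. norm (source t) \<le> B * (1 + t powr (-1/2)) * exp (s * t)
    \<and> norm (q t) \<le> B * exp (s * t)"
proof -
  obtain C where C: "\<And>t. t > 0 \<Longrightarrow> norm (q t) \<le> C * exp (s * t)" using assms by (auto simp: growth_def)
  define B where "B = norm \<kappa> * sqrt pi + csum * \<bar>C\<bar> + \<bar>C\<bar>"
  have B0: "0 \<le> B" using csum_nonneg by (simp add: B_def)
  have "norm (source t) \<le> B * (1 + t powr (-1/2)) * exp (s * t) \<and> norm (q t) \<le> B * exp (s * t)" if t: "t > 0" for t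
  proof
    have e: "1 \<le> exp (s * t)" using t assms by simp
    have q: "norm (q t) \<le> \<bar>C\<bar> * exp (s * t)"
      using C[OF t] by (smt (verit) exp_gt_zero mult_right_mono)
    have "\<bar>C\<bar> \<le> B" using csum_nonneg by (simp add: B_def)
    then show "norm (q t) \<le> B * exp (s * t)" using q by (meson exp_ge_zero mult_right_mono order_trans)
    have "norm (source t) \<le> norm \<kappa> * norm (bound_state_datum E t) + csum * norm (q t)"
      unfolding source_def by (intro order_trans[OF norm_triangle_ineq4] add_mono norm_\<alpha>q_le) (simp add: norm_mult)
    also have "\<dots> \<le> norm \<kappa> * (sqrt pi * t powr (-1/2)) + csum * (\<bar>C\<bar> * exp (s * t))"
      using norm_bound_state_datum_le(2)[OF E t] q csum_nonneg by (intro add_mono mult_left_mono) auto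
    also have "\<dots> \<le> norm \<kappa> * sqrt pi * ((1 + t powr (-1/2)) * exp (s * t)) + csum * \<bar>C\<bar> * ((1 + t powr (-1/2)) * exp (s * t))"
    proof (intro add_mono)
      have "t powr (-1/2) \<le> (1 + t powr (-1/2)) * exp (s * t)"
        using mult_mono[of "t powr (-1/2)" "1 + t powr (-1/2)" 1 "exp (s * t)"] e by simp
      then show "norm \<kappa> * (sqrt pi * t powr (-1/2)) \<le> norm \<kappa> * sqrt pi * ((1 + t powr (-1/2)) * exp (s * t))"
        by (simp add: mult.assoc mult_left_mono)
      have "exp (s * t) \<le> (1 + t powr (-1/2)) * exp (s * t)" by (simp add: algebra_simps)
      then show "csum * (\<bar>C\<bar> * exp (s * t)) \<le> csum * \<bar>C\<bar> * ((1 + t powr (-1/2)) * exp (s * t))"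
        using csum_nonneg by (simp add: mult.assoc mult_left_mono)
    qed
    also have "\<dots> = (norm \<kappa> * sqrt pi + csum * \<bar>C\<bar>) * ((1 + t powr (-1/2)) * exp (s * t))" by (simp add: algebra_simps)
    also have "\<dots> \<le> B * ((1 + t powr (-1/2)) * exp (s * t))" by (intro mult_right_mono) (auto simp: B_def)
    finally show "norm (source t) \<le> B * (1 + t powr (-1/2)) * exp (s * t)" by (simp add: mult.assoc)
  qed
  then show ?thesis using B0 by blast
qed

lemma laplaceable_source_q:
  assumes "growth s" "s \<ge> 0" "s < \<sigma>"
  shows "laplaceable \<sigma> source" "laplaceable \<sigma> q" "laplaceable \<sigma> (\<lambda>t. of_real (\<alpha> t) * q t)"
proof -
  obtain B where B0: "0 \<le> B" and B: "\<And>t. t > 0 \<Longrightarrow> norm (source t) \<le> B * (1 + t powr (-1/2)) * exp (s * t)"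
      and Bq: "\<And>t. t > 0 \<Longrightarrow> norm (q t) \<le> B * exp (s * t)"
    using source_bound[OF assms(1,2)] by blast
  show "laplaceable \<sigma> source"
    by (rule laplaceableI[OF set_borel_measurable_half_line[OF continuous_source] assms(3) B])
  have le: "x * exp (s * t) \<le> x * (1 + t powr (-1/2)) * exp (s * t)" if "0 \<le> x" for x t
    using that by (intro mult_right_mono) (auto simp: mult_le_cancel_left1)
  show "laplaceable \<sigma> q"
    by (rule laplaceableI[OF set_borel_measurable_half_line[OF q_cont] assms(3)])
      (use Bq le[OF B0] in \<open>blast intro: order_trans\<close>)
  have "norm (of_real (\<alpha> t) * q t) \<le> csum * B * exp (s * t)" if "t > 0" for t
    using norm_\<alpha>q_le[of t] mult_left_mono[OF Bq[OF that] csum_nonneg] by simp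
  moreover have "0 \<le> csum * B" using B0 csum_nonneg by simp
  ultimately show "laplaceable \<sigma> (\<lambda>t. of_real (\<alpha> t) * q t)"
    by (intro laplaceableI[OF set_borel_measurable_half_line[OF continuous_\<alpha>q] assms(3)])
      (use le in \<open>blast intro: order_trans\<close>)
qed

end

section \<open>Linearity of the moments and the scale of their bounds\<close>

lemma laplace_moment_cong:
  assumes "\<And>t. t > 0 \<Longrightarrow> f t = g t"
  shows "laplace_moment m f p = laplace_moment m g p"
  unfolding laplace_moment_def by (rule set_lebesgue_integral_cong) (use assms in auto)

lemma laplace_moment_cmult: "laplace_moment m (\<lambda>t. a * f t) p = a * laplace_moment m f p"
  unfolding laplace_moment_def set_integral_mult_right[symmetric] by (simp only: mult_ac)

lemma laplace_moment_diff:
  assumes "laplaceable (Re p) f" "laplaceable (Re p) g"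
  shows "laplace_moment m (\<lambda>t. f t - g t) p = laplace_moment m f p - laplace_moment m g p"
  unfolding laplace_moment_def
  using set_integral_diff(2)[OF laplaceable_integrable[OF assms(1), of m] laplaceable_integrable[OF assms(2), of m]]
  by (simp only: left_diff_distrib right_diff_distrib)

lemma laplaceable_diff:
  assumes "laplaceable \<sigma> f" "laplaceable \<sigma> g"
  shows "laplaceable \<sigma> (\<lambda>t. f t - g t)"
  using assms unfolding laplaceable_def right_diff_distrib by (intro allI set_integral_diff) auto

text \<open>The size \<rho>^(1/2-m) of the m-th derivative of a function of sqrt p at distance
  \<rho> from 0; the exception at m = 0 stands for mere boundedness.\<close>

definition decay_scale :: "real \<Rightarrow> nat \<Rightarrow> real" where
  "decay_scale \<rho> m = (case m of 0 \<Rightarrow> 1 | Suc k \<Rightarrow> 1 / (sqrt \<rho> * \<rho> ^ k))"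

lemma decay_scale_simps [simp]:
  "decay_scale \<rho> 0 = 1" "decay_scale \<rho> (Suc k) = 1 / (sqrt \<rho> * \<rho> ^ k)"
  by (simp_all add: decay_scale_def)

lemma decay_scale_nonneg: "\<rho> > 0 \<Longrightarrow> 0 \<le> decay_scale \<rho> m"
  by (cases m) auto

lemma decay_scale_antimono: "0 < \<rho> \<Longrightarrow> \<rho> \<le> \<rho>' \<Longrightarrow> decay_scale \<rho>' m \<le> decay_scale \<rho> m"
  by (cases m) (auto intro!: divide_left_mono mult_mono power_mono mult_pos_pos)

text \<open>Two positive indices yield one surplus factor sqrt \<rho>, which is bounded when p stays
  in a bounded region. Cauchy products of moments thus remain on the same scale.\<close>

lemma decay_scale_mult_le:
  assumes \<rho>: "\<rho> > 0" and B: "1 \<le> B" "sqrt \<rho> \<le> B"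
  shows "decay_scale \<rho> i * decay_scale \<rho> j \<le> B * decay_scale \<rho> (i + j)"
proof (cases "i = 0 \<or> j = 0")
  case True
  then have "decay_scale \<rho> i * decay_scale \<rho> j = 1 * decay_scale \<rho> (i + j)" by auto
  also have "\<dots> \<le> B * decay_scale \<rho> (i + j)" using B decay_scale_nonneg[OF \<rho>] by (intro mult_right_mono)
  finally show ?thesis .
next
  case False
  then obtain a b where ab: "i = Suc a" "j = Suc b" by (meson not0_implies_Suc)
  have "decay_scale \<rho> i * decay_scale \<rho> j = sqrt \<rho> * decay_scale \<rho> (i + j)"
    using \<rho> by (simp add: ab power_add field_simps)
  also have "\<dots> \<le> B * decay_scale \<rho> (i + j)" using B decay_scale_nonneg[OF \<rho>] by (intro mult_right_mono)
  finally show ?thesis .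
qed

lemma norm_csqrt_div_power: "z \<noteq> 0 \<Longrightarrow> norm (csqrt z / z ^ Suc k) = decay_scale (norm z) (Suc k)"
  using real_div_sqrt[of "norm z"] by (simp add: norm_divide norm_mult norm_power field_simps)

text \<open>With |Im p| <= w / 2 the point p is the lattice point nearest to 0, so bounds in |p|
  hold along the whole lattice, and all other points recede linearly in n.\<close>

lemma lattice_point_norm:
  fixes n :: int
  assumes "\<bar>Im p\<bar> \<le> w / 2" "w > 0"
  shows "norm p \<le> norm (p + \<i> * of_real (of_int n * w))"
    and "n \<noteq> 0 \<Longrightarrow> (1 + \<bar>real_of_int n\<bar>) * (w / 4) \<le> norm (p + \<i> * of_real (of_int n * w))"
proof -
  have im: "\<bar>real_of_int n\<bar> * w - w / 2 \<le> \<bar>Im p + of_int n * w\<bar>"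
  proof -
    have "\<bar>real_of_int n * w\<bar> \<le> \<bar>Im p + of_int n * w\<bar> + \<bar>Im p\<bar>" by linarith
    then show ?thesis using assms by (simp add: abs_mult)
  qed
  show "norm p \<le> norm (p + \<i> * of_real (of_int n * w))"
  proof (cases "n = 0")
    case False
    then have "1 \<le> \<bar>real_of_int n\<bar>" by linarith
    then have "w \<le> \<bar>real_of_int n\<bar> * w" using assms by simp
    then have "\<bar>Im p\<bar> \<le> \<bar>Im p + of_int n * w\<bar>" using im assms by linarith
    then have "(Im p)\<^sup>2 \<le> (Im p + of_int n * w)\<^sup>2" by (simp add: abs_le_square_iff)
    then have "(norm p)\<^sup>2 \<le> (norm (p + \<i> * of_real (of_int n * w)))\<^sup>2" by (simp add: cmod_power2)
    then show ?thesis by (rule power2_le_imp_le) simp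
  qed simp
  show "(1 + \<bar>real_of_int n\<bar>) * (w / 4) \<le> norm (p + \<i> * of_real (of_int n * w))" if "n \<noteq> 0"
  proof -
    have "1 \<le> \<bar>real_of_int n\<bar>" using that by linarith
    then have "w \<le> \<bar>real_of_int n\<bar> * w" using assms by simp
    moreover have "(1 + \<bar>real_of_int n\<bar>) * (w / 4) = w / 4 + (\<bar>real_of_int n\<bar> * w) / 4"
      by (simp add: algebra_simps)
    ultimately have "(1 + \<bar>real_of_int n\<bar>) * (w / 4) \<le> \<bar>real_of_int n\<bar> * w - w / 2" by linarith
    with im abs_Im_le_cmod[of "p + \<i> * of_real (of_int n * w)"] show ?thesis by simp
  qed
qed

lemma sum_geometric_shift: "(\<Sum>j<m. (D::real) * (1 + D) ^ j) = (1 + D) ^ m - 1"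
  by (induction m) (auto simp: algebra_simps)

context charge_problem
begin

text \<open>The charge is \<open>\<gamma>\<close> times the Abel convolution of the source; this is
  the relation solved for the source on the level of moments.\<close>

lemma moment_equation:
  assumes g: "growth s" "0 \<le> s" "s < Re p"
  shows "4 * of_real pi * csqrt \<i> * laplace_moment m source p
    = csqrt p * (\<Sum>i\<le>m. of_real (half_coeff i) / p ^ i * laplace_moment (m - i) q p)"
proof -
  have p0: "p \<noteq> 0" "csqrt p \<noteq> 0" using g by (auto simp del: csqrt.sel)
  have "laplace_moment m q p = (\<gamma> * of_real (sqrt pi)) *
      (\<Sum>i\<le>m. of_real (abel_coeff i) / (p ^ i * csqrt p) * laplace_moment (m - i) source p)" for m
  proof -
    have "laplace_moment m q p = laplace_moment m (\<lambda>t. \<gamma> * half_conv (abel_kernel 0) source t) p"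
      by (intro laplace_moment_cong q_eq')
    also have "\<dots> = \<gamma> * (\<Sum>i\<le>m. laplace_moment i (abel_kernel 0) p * laplace_moment (m - i) source p)"
      unfolding laplace_moment_cmult using g
      by (subst laplace_moment_half_conv) (auto intro: laplaceable_abel_kernel laplaceable_source_q)
    also have "\<dots> = (\<gamma> * of_real (sqrt pi)) *
      (\<Sum>i\<le>m. of_real (abel_coeff i) / (p ^ i * csqrt p) * laplace_moment (m - i) source p)"
      using g by (simp add: laplace_moment_abel_kernel sum_distrib_left mult_ac del: csqrt.sel)
    finally show ?thesis .
  qed
  from abel_moment_inversion[OF p0 this] show ?thesis by (simp only: \<gamma>_sqrt_pi)
qed

lemma moment_source:
  assumes g: "growth s" "0 \<le> s" "s < Re p"
  shows "laplace_moment m source (p + \<i> * of_real (of_int n * w)) =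
    \<kappa> * laplace_moment m (bound_state_datum E) (p + \<i> * of_real (of_int n * w))
    - lattice_conv c (\<lambda>k. laplace_moment m q (p + \<i> * of_real (of_int k * w))) n"
proof -
  let ?z = "p + \<i> * of_real (of_int n * w)"
  have rz: "Re ?z = Re p" by simp
  have lD: "laplaceable (Re p) (\<lambda>s. \<kappa> * bound_state_datum E s)"
    using laplaceable_datum[of "Re p"] g unfolding laplaceable_def
    by (auto simp: mult.left_commute[of _ \<kappa>] intro!: set_integrable_mult_right)
  have "laplace_moment m source ?z = laplace_moment m (\<lambda>s. \<kappa> * bound_state_datum E s) ?z
      - laplace_moment m (\<lambda>t. of_real (\<alpha> t) * q t) ?z"
    unfolding source_def using lD laplaceable_source_q(3)[OF g] rz by (intro laplace_moment_diff) simp_all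
  then show ?thesis
    unfolding laplace_moment_cmult using laplace_moment_lattice[OF c \<alpha> laplaceable_source_q(2)[OF g]] by simp
qed

text \<open>In the inverted Abel relation the term i = 0 is the diagonal of the system, and the
  other terms contain lower moments only. Hence the same operator governs every moment, and lower
  moments enter merely as data.\<close>

lemma lattice_row:
  assumes g: "growth s" "0 \<le> s" "s < Re p"
  defines "z \<equiv> \<lambda>n::int. p + \<i> * of_real (of_int n * w)"
  shows "csqrt (z n) * laplace_moment m q (z n)
      + 4 * of_real pi * csqrt \<i> * lattice_conv c (\<lambda>k. laplace_moment m q (z k)) n
    = 4 * of_real pi * csqrt \<i> * (\<kappa> * laplace_moment m (bound_state_datum E) (z n))
      - (\<Sum>i<m. of_real (half_coeff (Suc i)) * (csqrt (z n) / z n ^ Suc i) * laplace_moment (m - Suc i) q (z n))"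
proof -
  have rz: "s < Re (z n)" using g by (simp add: z_def)
  have "4 * of_real pi * csqrt \<i> * laplace_moment m source (z n)
    = csqrt (z n) * (\<Sum>i\<le>m. of_real (half_coeff i) / z n ^ i * laplace_moment (m - i) q (z n))"
    by (rule moment_equation[OF g(1,2) rz])
  also have "(\<Sum>i\<le>m. of_real (half_coeff i) / z n ^ i * laplace_moment (m - i) q (z n)) =
      laplace_moment m q (z n) + (\<Sum>i<m. of_real (half_coeff (Suc i)) / z n ^ Suc i * laplace_moment (m - Suc i) q (z n))"
    by (subst sum.atMost_shift) simp
  also have "csqrt (z n) * \<dots> = csqrt (z n) * laplace_moment m q (z n)
      + (\<Sum>i<m. of_real (half_coeff (Suc i)) * (csqrt (z n) / z n ^ Suc i) * laplace_moment (m - Suc i) q (z n))"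
    by (simp add: distrib_left sum_distrib_left mult_ac del: csqrt.sel)
  finally have "csqrt (z n) * laplace_moment m q (z n) = 4 * of_real pi * csqrt \<i> * laplace_moment m source (z n)
      - (\<Sum>i<m. of_real (half_coeff (Suc i)) * (csqrt (z n) / z n ^ Suc i) * laplace_moment (m - Suc i) q (z n))"
    by (simp add: eq_diff_eq del: csqrt.sel csqrt_ii)
  moreover have "laplace_moment m source (z n) = \<kappa> * laplace_moment m (bound_state_datum E) (z n)
      - lattice_conv c (\<lambda>k. laplace_moment m q (z k)) n"
    unfolding z_def by (rule moment_source[OF g])
  ultimately show ?thesis by (simp add: right_diff_distrib del: csqrt.sel csqrt_ii)
qed

text \<open>Bounded in n because the shift of p is imaginary; this gives the finiteness that the a
  priori bound presupposes.\<close>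

lemma norm_moment_le:
  assumes "laplaceable (Re p) f"
  shows "norm (laplace_moment m f (p + \<i> * of_real (of_int n * w)))
    \<le> (LBINT t:{0<..}. norm (of_real (t ^ m / fact m) * f t * exp (- (p * of_real t))))"
proof -
  have "norm (laplace_moment m f (p + \<i> * of_real (of_int n * w)))
      \<le> (LINT t|lborel. norm (indicator {0<..} t *\<^sub>R (of_real (t ^ m / fact m) * f t * exp (- ((p + \<i> * of_real (of_int n * w)) * of_real t)))))"
    unfolding laplace_moment_def set_lebesgue_integral_def by (rule integral_norm_bound)
  then show ?thesis unfolding set_lebesgue_integral_def by (simp add: norm_mult norm_divide norm_power)
qed

text \<open>Strong induction on the moment, with the a priori bound applied to each row system. The
  shape D (1 + D)^m reproduces itself: summing it over all lower moments gives (1 + D)^m - 1.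
  \<open>D\<close> depends on \<open>R\<close> but not on the growth rate \<open>s\<close>, which is
  what later allows the rate to be lowered.\<close>

lemma moment_bounds:
  "\<exists>D\<ge>1. \<forall>s p m (n::int). growth s \<longrightarrow> 0 \<le> s \<longrightarrow> s < Re p \<longrightarrow> Re p \<le> R \<longrightarrow> \<bar>Im p\<bar> \<le> w / 2 \<longrightarrow>
    norm (laplace_moment m q (p + \<i> * of_real (of_int n * w))) \<le> D * (1 + D) ^ m * decay_scale (norm p) m \<and>
    norm (laplace_moment m source (p + \<i> * of_real (of_int n * w))) \<le> D * (1 + D) ^ m * decay_scale (norm p) m"
proof -
  obtain C where C: "C > 0" and AP0: "\<forall>p Q M B. 0 \<le> Re p \<longrightarrow> Re p \<le> R \<longrightarrow> \<bar>Im p\<bar> \<le> w \<longrightarrow> (\<forall>n. norm (Q n) \<le> B) \<longrightarrow>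
    (\<forall>n. norm (csqrt (p + \<i> * of_real (of_int n * w)) * Q n
                 + 4 * of_real pi * csqrt \<i> * lattice_conv c Q n)
          \<le> M * max 1 (sqrt (norm (p + \<i> * of_real (of_int n * w))))) \<longrightarrow> (\<forall>n. norm (Q n) \<le> C * M)"
    using lattice_a_priori_bound[OF c herm gen w, of R] by blast
  note AP = AP0[rule_format]
  define c1 where "c1 = max (2 * pi / sqrt E) (2 * pi / E)"
  define c2 where "c2 = 4 * pi * (norm \<kappa> * c1)"
  define B where "B = max 1 (sqrt (\<bar>R\<bar> + w))"
  \<comment> \<open>\<open>c2\<close> bounds the contribution of the datum, \<open>B\<close> that of
    the lower moments per unit of the geometric sum; \<open>C\<close> is the a priori
    constant.\<close>
  define D where "D = C * (c2 + B)"
  define D' where "D' = norm \<kappa> * c1 + csum * D"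
  have c10: "0 \<le> c1" using E by (simp add: c1_def le_max_iff_disj)
  have c20: "0 \<le> c2" using c10 by (simp add: c2_def)
  have B1: "1 \<le> B" by (simp add: B_def)
  have D0: "0 \<le> D" using C c20 B1 by (simp add: D_def)
  have datum: "norm (laplace_moment m (bound_state_datum E) z) \<le> c1 * decay_scale (norm z) m" if "Re z > 0" for z m
  proof (cases m)
    case 0
    then show ?thesis using norm_laplace_moment_datum_le(1)[OF E that] by (simp add: c1_def)
  next
    case (Suc k)
    have "2 * pi / E / (sqrt (norm z) * norm z ^ k) \<le> c1 / (sqrt (norm z) * norm z ^ k)"
      by (intro divide_right_mono) (auto simp: c1_def)
    then show ?thesis using norm_laplace_moment_datum_le(2)[OF E that, of k] Suc by simp
  qed
  have both: "norm (laplace_moment m q (p + \<i> * of_real (of_int n * w))) \<le> D * (1 + D) ^ m * decay_scale (norm p) m \<and>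
      norm (laplace_moment m source (p + \<i> * of_real (of_int n * w))) \<le> D' * (1 + D) ^ m * decay_scale (norm p) m"
    if g: "growth s" "0 \<le> s" "s < Re p" and pR: "Re p \<le> R" "\<bar>Im p\<bar> \<le> w / 2" for s p m n
  proof -
    define z where "z k = p + \<i> * of_real (of_int k * w)" for k :: int
    define \<rho> where "\<rho> = norm p"
    have rz: "Re (z k) > 0" for k using g by (simp add: z_def)
    have z0: "z k \<noteq> 0" for k using rz[of k] by auto
    have zpos: "0 < norm (z k)" for k using z0 by simp
    have p0: "p \<noteq> 0" using g by auto
    have \<rho>0: "\<rho> > 0" using p0 by (simp add: \<rho>_def)
    have z\<rho>: "\<rho> \<le> norm (z k)" for k unfolding \<rho>_def z_def by (rule lattice_point_norm(1)[OF pR(2) w])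
    have "\<rho> \<le> \<bar>R\<bar> + w" using cmod_le[of p] g pR w by (simp add: \<rho>_def)
    then have \<rho>B: "sqrt \<rho> \<le> B" by (simp add: B_def le_max_iff_disj)
    have dat: "norm (laplace_moment m (bound_state_datum E) (z k)) \<le> c1 * decay_scale \<rho> m" for m k
    proof -
      have "decay_scale (norm (z k)) m \<le> decay_scale \<rho> m" by (rule decay_scale_antimono[OF \<rho>0 z\<rho>])
      then have "c1 * decay_scale (norm (z k)) m \<le> c1 * decay_scale \<rho> m" by (rule mult_left_mono[OF _ c10])
      with datum[OF rz, of m k] show ?thesis by linarith
    qed
    have q: "\<forall>k. norm (laplace_moment m q (z k)) \<le> D * (1 + D) ^ m * decay_scale \<rho> m" for m
    proof (induction m rule: less_induct)
      case (less m)
      \<comment> \<open>The geometric sum of the lower moments in closed form; the datum accounts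
        for \<open>c2\<close>.\<close>
      define M where "M = (c2 + B * ((1 + D) ^ m - 1)) * decay_scale \<rho> m"
      have row: "norm (csqrt (p + \<i> * of_real (of_int k * w)) * laplace_moment m q (z k)
          + 4 * of_real pi * csqrt \<i> * lattice_conv c (\<lambda>k. laplace_moment m q (z k)) k)
          \<le> M * max 1 (sqrt (norm (p + \<i> * of_real (of_int k * w))))" for k
      proof -
        have bnd: "norm (csqrt (z k) * laplace_moment m q (z k)
            + 4 * of_real pi * csqrt \<i> * lattice_conv c (\<lambda>k. laplace_moment m q (z k)) k)
          \<le> norm (4 * of_real pi * csqrt \<i> * (\<kappa> * laplace_moment m (bound_state_datum E) (z k)))
           + norm (\<Sum>i<m. of_real (half_coeff (Suc i)) * (csqrt (z k) / z k ^ Suc i) * laplace_moment (m - Suc i) q (z k))"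
          unfolding z_def lattice_row[OF g] by (rule norm_triangle_ineq4)
        have bnd1: "norm (4 * of_real pi * csqrt \<i> * (\<kappa> * laplace_moment m (bound_state_datum E) (z k))) \<le> c2 * decay_scale \<rho> m"
          using mult_left_mono[OF dat[of m k], of "4 * pi * norm \<kappa>"]
          by (simp add: c2_def norm_mult mult_ac del: csqrt_ii)
        have bnd2: "norm (\<Sum>i<m. of_real (half_coeff (Suc i)) * (csqrt (z k) / z k ^ Suc i) * laplace_moment (m - Suc i) q (z k))
            \<le> (\<Sum>i<m. B * decay_scale \<rho> m * (D * (1 + D) ^ (m - Suc i)))"
        proof (intro order_trans[OF norm_sum] sum_mono)
          fix i assume i: "i \<in> {..<m}"
          have "norm (of_real (half_coeff (Suc i)) * (csqrt (z k) / z k ^ Suc i) * laplace_moment (m - Suc i) q (z k))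
              \<le> 1 * decay_scale \<rho> (Suc i) * (D * (1 + D) ^ (m - Suc i) * decay_scale \<rho> (m - Suc i))"
            unfolding norm_mult norm_csqrt_div_power[OF z0]
          proof (intro mult_mono)
            show "norm (of_real (half_coeff (Suc i)) :: complex) \<le> 1" using abs_half_coeff_le[of "Suc i"] by simp
            show "decay_scale (norm (z k)) (Suc i) \<le> decay_scale \<rho> (Suc i)" by (rule decay_scale_antimono[OF \<rho>0 z\<rho>])
            show "norm (laplace_moment (m - Suc i) q (z k)) \<le> D * (1 + D) ^ (m - Suc i) * decay_scale \<rho> (m - Suc i)"
              using less.IH[of "m - Suc i"] i by auto
          qed (use \<rho>0 zpos[of k] decay_scale_nonneg in \<open>auto simp del: decay_scale_simps\<close>)
          also have "\<dots> = (decay_scale \<rho> (Suc i) * decay_scale \<rho> (m - Suc i)) * (D * (1 + D) ^ (m - Suc i))" by simp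
          also have "\<dots> \<le> (B * decay_scale \<rho> (Suc i + (m - Suc i))) * (D * (1 + D) ^ (m - Suc i))"
            using D0 by (intro mult_right_mono decay_scale_mult_le[OF \<rho>0 B1 \<rho>B]) auto
          also have "Suc i + (m - Suc i) = m" using i by auto
          finally show "norm (of_real (half_coeff (Suc i)) * (csqrt (z k) / z k ^ Suc i) * laplace_moment (m - Suc i) q (z k))
              \<le> B * decay_scale \<rho> m * (D * (1 + D) ^ (m - Suc i))" .
        qed
        have "(\<Sum>i<m. B * decay_scale \<rho> m * (D * (1 + D) ^ (m - Suc i))) = B * decay_scale \<rho> m * ((1 + D) ^ m - 1)"
          unfolding sum_distrib_left[symmetric] sum_geometric_shift[symmetric]
          by (subst sum.nat_diff_reindex) simp
        with bnd bnd1 bnd2 have "norm (csqrt (z k) * laplace_moment m q (z k)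
            + 4 * of_real pi * csqrt \<i> * lattice_conv c (\<lambda>k. laplace_moment m q (z k)) k)
          \<le> c2 * decay_scale \<rho> m + B * decay_scale \<rho> m * ((1 + D) ^ m - 1)" by linarith
        also have "c2 * decay_scale \<rho> m + B * decay_scale \<rho> m * ((1 + D) ^ m - 1) = M"
          by (simp add: M_def algebra_simps)
        also have "\<dots> \<le> M * max 1 (sqrt (norm (z k)))"
        proof -
          have "1 \<le> (1 + D) ^ m" using D0 by simp
          then have "0 \<le> M" unfolding M_def using c20 B1 decay_scale_nonneg[OF \<rho>0, of m] by simp
          then show ?thesis using mult_left_mono[of 1 "max 1 (sqrt (norm (z k)))" M] by simp
        qed
        finally show ?thesis by (simp only: z_def)
      qed
      have CM: "C * M \<le> D * (1 + D) ^ m * decay_scale \<rho> m"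
      proof -
        have "1 \<le> (1 + D) ^ m" using D0 by simp
        then have "c2 + B * ((1 + D) ^ m - 1) \<le> (c2 + B) * (1 + D) ^ m"
          using mult_left_mono[OF \<open>1 \<le> (1 + D) ^ m\<close> c20] B1 by (simp add: algebra_simps)
        then have "C * ((c2 + B * ((1 + D) ^ m - 1)) * decay_scale \<rho> m) \<le> C * ((c2 + B) * (1 + D) ^ m * decay_scale \<rho> m)"
          using C decay_scale_nonneg[OF \<rho>0, of m] by (intro mult_left_mono mult_right_mono) auto
        then show ?thesis by (simp add: M_def D_def mult_ac)
      qed
      \<comment> \<open>The absolute moments of \<open>q\<close> on the line only certify
        boundedness in k here; their size does not enter the conclusion.\<close>
      have "norm (laplace_moment m q (z k)) \<le> C * M" for k
        by (rule AP[where Q = "\<lambda>k. laplace_moment m q (z k)" and p = p, OF _ pR(1) _ _ row])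
          (use g pR w norm_moment_le[OF laplaceable_source_q(2)[OF g], of m] in \<open>auto simp: z_def\<close>)
      with CM show ?case by (meson order_trans)
    qed
    have src: "norm (laplace_moment m source (z n)) \<le> D' * (1 + D) ^ m * decay_scale \<rho> m"
    proof -
      have "laplace_moment m source (z n) = \<kappa> * laplace_moment m (bound_state_datum E) (z n)
          - lattice_conv c (\<lambda>k. laplace_moment m q (z k)) n"
        unfolding z_def by (rule moment_source[OF g])
      then have "norm (laplace_moment m source (z n)) \<le> norm \<kappa> * norm (laplace_moment m (bound_state_datum E) (z n))
          + norm (lattice_conv c (\<lambda>k. laplace_moment m q (z k)) n)"
        using norm_triangle_ineq4[of "\<kappa> * laplace_moment m (bound_state_datum E) (z n)"] by (simp only: norm_mult)
      also have "\<dots> \<le> norm \<kappa> * (c1 * decay_scale \<rho> m) + (D * (1 + D) ^ m * decay_scale \<rho> m) * csum"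
        unfolding csum_def using q by (intro add_mono mult_left_mono dat norm_lattice_conv_le[OF c]) auto
      finally have "norm (laplace_moment m source (z n))
          \<le> norm \<kappa> * (c1 * decay_scale \<rho> m) + (D * (1 + D) ^ m * decay_scale \<rho> m) * csum" .
      moreover have "norm \<kappa> * (c1 * decay_scale \<rho> m) \<le> norm \<kappa> * c1 * (1 + D) ^ m * decay_scale \<rho> m"
      proof -
        have "norm \<kappa> * c1 * 1 \<le> norm \<kappa> * c1 * (1 + D) ^ m" using c10 D0 by (intro mult_left_mono) auto
        then have "norm \<kappa> * c1 * 1 * decay_scale \<rho> m \<le> norm \<kappa> * c1 * (1 + D) ^ m * decay_scale \<rho> m"
          by (rule mult_right_mono[OF _ decay_scale_nonneg[OF \<rho>0]])
        then show ?thesis by (simp add: mult.assoc)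
      qed
      moreover have "norm \<kappa> * c1 * (1 + D) ^ m * decay_scale \<rho> m + (D * (1 + D) ^ m * decay_scale \<rho> m) * csum
          = D' * (1 + D) ^ m * decay_scale \<rho> m" by (simp add: D'_def algebra_simps)
      ultimately show ?thesis by linarith
    qed
    show ?thesis using q[of m] src by (auto simp: z_def \<rho>_def)
  qed
  define D2 where "D2 = 1 + D + D'"
  have D'0: "0 \<le> D'" using c10 D0 csum_nonneg by (simp add: D'_def)
  have mono: "x * (1 + D) ^ m * decay_scale (norm p) m \<le> D2 * (1 + D2) ^ m * decay_scale (norm p) m"
    if "0 \<le> x" "x \<le> D2" "p \<noteq> 0" for x m p
    using that D0 D'0 decay_scale_nonneg[of "norm p" m]
    by (intro mult_right_mono mult_mono power_mono) (auto simp: D2_def)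
  show ?thesis
  proof (intro exI[of _ D2] conjI allI impI)
    show "1 \<le> D2" using D0 D'0 by (simp add: D2_def)
    fix s p m and n :: int
    assume g: "growth s" "0 \<le> s" "s < Re p" and pR: "Re p \<le> R" "\<bar>Im p\<bar> \<le> w / 2"
    have p0: "p \<noteq> 0" using g by auto
    show "norm (laplace_moment m q (p + \<i> * of_real (of_int n * w))) \<le> D2 * (1 + D2) ^ m * decay_scale (norm p) m"
      using both[OF g pR, of m n] mono[OF D0 _ p0, of m] D'0 D0 by (auto simp: D2_def intro: order_trans)
    show "norm (laplace_moment m source (p + \<i> * of_real (of_int n * w))) \<le> D2 * (1 + D2) ^ m * decay_scale (norm p) m"
      using both[OF g pR, of m n] mono[OF D'0 _ p0, of m] D'0 D0 by (auto simp: D2_def intro: order_trans)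
  qed
qed

end

section \<open>The undamped part of the kernel\<close>

definition lattice_weight :: "nat \<Rightarrow> real" where
  "lattice_weight k = 1 / ((1 + real k) * sqrt (1 + real k))"

lemma summable_lattice_weight: "summable lattice_weight"
proof -
  have "lattice_weight = (\<lambda>k. real (Suc k) powr (-3/2))"
  proof
    fix k
    have "real (Suc k) powr (3/2) = real (Suc k) * sqrt (real (Suc k))"
      using powr_add[of "real (Suc k)" 1 "1/2"] by (simp add: powr_half_sqrt del: of_nat_Suc)
    then have "real (Suc k) powr (-3/2) = 1 / (real (Suc k) * sqrt (real (Suc k)))"
      using powr_minus_divide[of "real (Suc k)" "3/2"] by (simp del: of_nat_Suc)
    then show "lattice_weight k = real (Suc k) powr (-3/2)" by (simp add: lattice_weight_def)
  qed
  moreover have "summable (\<lambda>k. real (Suc k) powr (-3/2))"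
    using summable_real_powr_iff[of "-3/2"] by (subst summable_Suc_iff) simp
  ultimately show ?thesis by (simp only:)
qed

lemma lattice_weight_nonneg: "0 \<le> lattice_weight k"
  by (simp add: lattice_weight_def)

text \<open>A majorant of |\<sigma> + i x|^(-3/2), up to a factor below 3, with an elementary
  antiderivative on each side of 0.\<close>

definition cusp :: "real \<Rightarrow> real \<Rightarrow> real" where
  "cusp \<sigma> x = 1 / ((\<sigma> + \<bar>x\<bar>) * sqrt (\<sigma> + \<bar>x\<bar>))"

lemma borel_measurable_cusp [measurable]: "cusp \<sigma> \<in> borel_measurable borel"
  unfolding cusp_def by measurable

lemma nn_integral_cusp:
  assumes \<sigma>: "\<sigma> > 0"
  shows "(\<integral>\<^sup>+x. ennreal (cusp \<sigma> (a + x)) \<partial>lborel) \<le> ennreal (4 / sqrt \<sigma>)"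
proof -
  have half: "(\<integral>\<^sup>+x. ennreal (1 / ((\<sigma> + x) * sqrt (\<sigma> + x))) * indicator {0..} x \<partial>lborel) = ennreal (0 - (- 2 / sqrt (\<sigma> + 0)))"
  proof (rule nn_integral_FTC_atLeast)
    show "((\<lambda>x. - 2 / sqrt (\<sigma> + x)) \<longlongrightarrow> 0) at_top" by real_asymp
    fix x :: real assume "0 \<le> x"
    then have x: "\<sigma> + x > 0" using \<sigma> by simp
    then have "DERIV (\<lambda>x. - 2 / sqrt (\<sigma> + x)) x :> 2 * (inverse (sqrt (\<sigma> + x)) / 2) / (sqrt (\<sigma> + x))\<^sup>2"
      by (auto intro!: derivative_eq_intros simp: power2_eq_square)
    moreover have "2 * (inverse (sqrt (\<sigma> + x)) / 2) / (sqrt (\<sigma> + x))\<^sup>2 = 1 / ((\<sigma> + x) * sqrt (\<sigma> + x))"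
      using x by (simp add: inverse_eq_divide)
    ultimately show "DERIV (\<lambda>x. - 2 / sqrt (\<sigma> + x)) x :> 1 / ((\<sigma> + x) * sqrt (\<sigma> + x))" by simp
    show "0 \<le> 1 / ((\<sigma> + x) * sqrt (\<sigma> + x))" using x by simp
  qed measurable
  define h where "h x = ennreal (1 / ((\<sigma> + x) * sqrt (\<sigma> + x))) * indicator {0..} x" for x :: real
  have [measurable]: "h \<in> borel_measurable borel" unfolding h_def by measurable
  have hI: "(\<integral>\<^sup>+x. h x \<partial>lborel) = ennreal (2 / sqrt \<sigma>)" unfolding h_def using half by simp
  have "(\<integral>\<^sup>+x. ennreal (cusp \<sigma> (a + x)) \<partial>lborel) = (\<integral>\<^sup>+x. ennreal (cusp \<sigma> x) \<partial>lborel)"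
    using nn_integral_real_affine[of "\<lambda>x. ennreal (cusp \<sigma> x)" 1 a] by simp
  also have "\<dots> \<le> (\<integral>\<^sup>+x. h x + h (0 + (-1) * x) \<partial>lborel)"
    by (intro nn_integral_mono) (auto simp: h_def cusp_def indicator_def)
  also have "\<dots> = (\<integral>\<^sup>+x. h x \<partial>lborel) + (\<integral>\<^sup>+x. h (0 + (-1) * x) \<partial>lborel)"
    by (intro nn_integral_add) measurable
  also have "(\<integral>\<^sup>+x. h (0 + (-1) * x) \<partial>lborel) = (\<integral>\<^sup>+x. h x \<partial>lborel)"
    using nn_integral_real_affine[of h "-1" 0] by simp
  finally show ?thesis using \<sigma> by (simp add: hI ennreal_plus[symmetric] del: ennreal_plus)
qed

text \<open>Damping moves the branch point from 0 to -\<Lambda>. For \<Lambda> >= 1 the transform is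
  evaluated at points of modulus at least 1, and the surplus powers can be discarded.\<close>

lemma abel_kernel_moment_bound:
  assumes \<Lambda>: "\<Lambda> \<ge> 1" and p: "Re p > 0"
  shows "norm (laplace_moment i (abel_kernel \<Lambda>) p) \<le> sqrt pi * decay_scale (norm p) i"
proof -
  define z where "z = p + of_real \<Lambda>"
  have z: "\<Lambda> \<le> norm z" "norm p \<le> norm z"
    unfolding z_def using norm_halfplane_add_ge[of p \<Lambda>] p \<Lambda> by auto
  have p0: "norm p > 0" using p by auto
  have "norm (laplace_moment i (abel_kernel \<Lambda>) p) = sqrt pi * abel_coeff i / (norm z ^ i * sqrt (norm z))"
    using p \<Lambda> abel_coeff_bounds[of i]
    by (simp add: laplace_moment_abel_kernel norm_divide norm_mult norm_power z_def[symmetric] del: csqrt.sel)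
  also have "\<dots> \<le> sqrt pi * 1 / (norm z ^ i * sqrt (norm z))"
    using abel_coeff_bounds[of i] by (intro divide_right_mono mult_left_mono) auto
  also have "\<dots> = sqrt pi * (1 / (norm z ^ i * sqrt (norm z)))" by simp
  also have "\<dots> \<le> sqrt pi * decay_scale (norm p) i"
  proof (intro mult_left_mono)
    show "1 / (norm z ^ i * sqrt (norm z)) \<le> decay_scale (norm p) i"
    proof (cases i)
      case 0
      have "1 \<le> norm z" using z \<Lambda> by linarith
      then have "1 \<le> sqrt (norm z)" by simp
      with 0 show ?thesis by (simp add: divide_le_eq)
    next
      case (Suc k)
      have "sqrt (norm p) * norm p ^ k \<le> sqrt (norm z) * norm z ^ k"
        using z by (intro mult_mono power_mono) auto
      also have "\<dots> \<le> sqrt (norm z) * norm z ^ k * norm z"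
      proof -
        have "1 \<le> norm z" using z \<Lambda> by linarith
        from mult_left_mono[OF this, of "sqrt (norm z) * norm z ^ k"] show ?thesis by simp
      qed
      finally have "sqrt (norm p) * norm p ^ k \<le> norm z ^ i * sqrt (norm z)" by (simp add: Suc mult_ac)
      moreover have "0 < sqrt (norm p) * norm p ^ k" "0 < norm z ^ i * sqrt (norm z)"
        using p0 less_le_trans[OF p0 z(2)] by simp_all
      ultimately have "1 / (norm z ^ i * sqrt (norm z)) \<le> 1 / (sqrt (norm p) * norm p ^ k)"
        by (intro divide_left_mono) auto
      then show ?thesis by (simp add: Suc mult_ac)
    qed
  qed auto
  finally show ?thesis .
qed

text \<open>The gain |z|^(-3/2) makes the sum over the lattice converge. For i = 0 it comes from 1 /
  sqrt z - 1 / sqrt y = (y - z) / (sqrt z sqrt y (sqrt y + sqrt z)) with y - z = \<Lambda>. For i >=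
  1 each of the two terms is already small enough by itself.\<close>

lemma abel_kernel_moment_diff_bound:
  assumes \<Lambda>: "\<Lambda> \<ge> 1" and z: "Re z > 0" and \<rho>: "0 < \<rho>" "\<rho> \<le> norm z" and B: "1 \<le> B" "sqrt \<rho> \<le> B"
  shows "norm (laplace_moment i (abel_kernel 0) z - laplace_moment i (abel_kernel \<Lambda>) z)
    \<le> 2 * sqrt pi * \<Lambda> * B * decay_scale \<rho> i / (norm z * sqrt (norm z))"
proof -
  define y where "y = z + of_real \<Lambda>"
  have y: "norm z \<le> norm y" unfolding y_def using norm_halfplane_add_ge(2)[of z \<Lambda>] z \<Lambda> by simp
  have z0: "norm z > 0" "z \<noteq> 0" "y \<noteq> 0" using z y by auto
  have L0: "laplace_moment i (abel_kernel 0) z = of_real (sqrt pi * abel_coeff i) / (z ^ i * csqrt z)"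
    using laplace_moment_abel_kernel[of z 0 i] z by simp
  have L1: "laplace_moment i (abel_kernel \<Lambda>) z = of_real (sqrt pi * abel_coeff i) / (y ^ i * csqrt y)"
    using laplace_moment_abel_kernel[of z \<Lambda> i] z \<Lambda> by (simp add: y_def)
  have c: "norm (of_real (sqrt pi * abel_coeff i) :: complex) \<le> sqrt pi"
    using abel_coeff_bounds[of i] by (simp add: norm_mult mult_left_le)
  have D0: "0 \<le> decay_scale \<rho> i" by (rule decay_scale_nonneg[OF \<rho>(1)])
  have "norm (1 / (z ^ i * csqrt z) - 1 / (y ^ i * csqrt y)) \<le> 2 * \<Lambda> * B * decay_scale \<rho> i / (norm z * sqrt (norm z))"
  proof (cases i)
    case 0
    have s0: "csqrt z \<noteq> 0" "csqrt y \<noteq> 0" using z0 by (simp_all del: csqrt.sel)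
    have "(csqrt y)\<^sup>2 - (csqrt z)\<^sup>2 = of_real \<Lambda>" by (simp add: y_def)
    then have eq: "(csqrt y - csqrt z) * (csqrt y + csqrt z) = of_real \<Lambda>"
      by (simp add: power2_eq_square algebra_simps del: csqrt.sel)
    \<comment> \<open>No cancellation in the sum: y and z have the same imaginary part, so their
      square roots have imaginary parts of equal sign, and the real parts are positive.\<close>
    have "(norm (csqrt z))\<^sup>2 \<le> (norm (csqrt y + csqrt z))\<^sup>2"
    proof -
      have "0 \<le> Im (csqrt y) * Im (csqrt z)"
      proof -
        have "Im y = 2 * Re (csqrt y) * Im (csqrt y)" "Im z = 2 * Re (csqrt z) * Im (csqrt z)"
          using arg_cong[OF power2_csqrt[of y], of Im] arg_cong[OF power2_csqrt[of z], of Im]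
          by (simp_all add: power2_eq_square mult_ac del: csqrt.sel)
        moreover have "Im y = Im z" by (simp add: y_def)
        moreover have "0 < Re (csqrt y)" "0 < Re (csqrt z)"
        proof -
          have "Re x = (Re (csqrt x))\<^sup>2 - (Im (csqrt x))\<^sup>2" for x
            using arg_cong[OF power2_csqrt[of x], of Re] by (simp add: power2_eq_square del: csqrt.sel)
          moreover have "0 < Re y" using z \<Lambda> by (simp add: y_def)
          ultimately have "Re (csqrt y) \<noteq> 0" "Re (csqrt z) \<noteq> 0" using z
            by (metis diff_0 neg_0_le_iff_le not_le power_zero_numeral zero_le_power2 less_le_not_le diff_le_0_iff_le)+
          then show "0 < Re (csqrt y)" "0 < Re (csqrt z)" using Re_csqrt[of y] Re_csqrt[of z] by linarith+
        qed
        ultimately show ?thesis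
          by (smt (verit) mult_nonneg_nonneg mult_nonpos_nonpos mult_pos_neg mult_pos_pos)
      qed
      then show ?thesis using Re_csqrt[of y] Re_csqrt[of z]
        by (simp add: cmod_power2 power2_sum del: csqrt.sel norm_csqrt)
    qed
    then have sum: "norm (csqrt z) \<le> norm (csqrt y + csqrt z)" by (rule power2_le_imp_le) simp
    have "1 / csqrt z - 1 / csqrt y = (csqrt y - csqrt z) / (csqrt z * csqrt y)"
      using s0 by (simp add: diff_frac_eq del: csqrt.sel)
    moreover have "norm (csqrt y - csqrt z) * norm (csqrt y + csqrt z) = \<Lambda>"
      using arg_cong[OF eq, of norm] \<Lambda> by (simp add: norm_mult del: csqrt.sel)
    moreover have "norm (csqrt y - csqrt z) * norm (csqrt z) \<le> norm (csqrt y - csqrt z) * norm (csqrt y + csqrt z)"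
      by (intro mult_left_mono sum) simp
    ultimately have "norm (1 / csqrt z - 1 / csqrt y) * (norm (csqrt z) * norm (csqrt z)) * norm (csqrt y) \<le> \<Lambda>"
      using s0 by (simp add: norm_divide norm_mult del: csqrt.sel norm_csqrt)
    then have le: "norm (1 / csqrt z - 1 / csqrt y) * (norm z * sqrt (norm y)) \<le> \<Lambda>"
      by (simp add: mult_ac del: csqrt.sel)
    have "norm (1 / csqrt z - 1 / csqrt y) * (norm z * sqrt (norm z)) \<le> norm (1 / csqrt z - 1 / csqrt y) * (norm z * sqrt (norm y))"
      using y by (intro mult_left_mono) auto
    also have "\<dots> \<le> \<Lambda>" by (rule le)
    also have "\<dots> \<le> 2 * \<Lambda> * B" using \<Lambda> B mult_left_mono[of 1 "2 * B" \<Lambda>] by simp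
    finally show ?thesis using z0 0 by (simp add: pos_le_divide_eq del: csqrt.sel)
  next
    case (Suc k)
    have "norm (1 / (z ^ i * csqrt z) - 1 / (y ^ i * csqrt y)) \<le> norm (1 / (z ^ i * csqrt z)) + norm (1 / (y ^ i * csqrt y))"
      by (rule norm_triangle_ineq4)
    also have "\<dots> = 1 / (norm z ^ i * sqrt (norm z)) + 1 / (norm y ^ i * sqrt (norm y))"
      by (simp add: norm_divide norm_mult norm_power del: csqrt.sel)
    also have "1 / (norm y ^ i * sqrt (norm y)) \<le> 1 / (norm z ^ i * sqrt (norm z))"
      using z0 y by (intro divide_left_mono mult_mono power_mono mult_pos_pos) auto
    also have "1 / (norm z ^ i * sqrt (norm z)) + 1 / (norm z ^ i * sqrt (norm z)) = 2 * (1 / norm z ^ k) / (norm z * sqrt (norm z))"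
      by (simp add: Suc)
    also have "\<dots> \<le> 2 * (B * decay_scale \<rho> i) / (norm z * sqrt (norm z))"
    proof (intro divide_right_mono mult_left_mono)
      have "1 / norm z ^ k \<le> 1 / \<rho> ^ k" using \<rho> z0 by (intro divide_left_mono power_mono mult_pos_pos) auto
      also have "\<dots> = sqrt \<rho> * decay_scale \<rho> i" using \<rho> by (simp add: Suc)
      also have "\<dots> \<le> B * decay_scale \<rho> i" by (intro mult_right_mono B D0)
      finally show "1 / norm z ^ k \<le> B * decay_scale \<rho> i" .
    qed auto
    also have "\<dots> \<le> \<Lambda> * (2 * (B * decay_scale \<rho> i)) / (norm z * sqrt (norm z))"
      using mult_right_mono[of 1 \<Lambda> "2 * (B * decay_scale \<rho> i)"] \<Lambda> B D0 by (intro divide_right_mono) auto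
    finally show ?thesis by (simp add: mult_ac)
  qed
  then have "norm (of_real (sqrt pi * abel_coeff i) :: complex) * norm (1 / (z ^ i * csqrt z) - 1 / (y ^ i * csqrt y))
      \<le> sqrt pi * (2 * \<Lambda> * B * decay_scale \<rho> i / (norm z * sqrt (norm z)))"
    by (intro mult_mono c) auto
  then show ?thesis unfolding L0 L1
    by (simp add: norm_mult[symmetric] right_diff_distrib mult_ac del: csqrt.sel)
qed

section \<open>Growth, continuity and moments of the contribution of the kernel difference\<close>

context charge_problem
begin

definition "rest \<Lambda> t = \<gamma> * half_conv (\<lambda>x. abel_kernel 0 x - abel_kernel \<Lambda> x) source t"

lemma integrable_conv_source:
  assumes "t > 0" "\<Lambda> \<ge> 0"
  shows "set_integrable lborel {0<..<t} (\<lambda>s. abel_kernel \<Lambda> (t - s) * source s)"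
proof -
  have "set_integrable lborel {0<..<t} (\<lambda>s. \<kappa> * (abel_kernel \<Lambda> (t - s) * bound_state_datum E s)
      - abel_kernel \<Lambda> (t - s) * (of_real (\<alpha> s) * q s))"
    by (rule set_integral_diff(1)[OF set_integrable_mult_right[OF integrable_conv_datum[OF assms]] integrable_conv_\<alpha>q[OF assms]])
  then show ?thesis by (simp add: source_def algebra_simps)
qed

lemma rest_eq:
  assumes "t > 0" "\<Lambda> \<ge> 0"
  shows "rest \<Lambda> t = q t - \<gamma> * half_conv (abel_kernel \<Lambda>) source t"
proof -
  have "half_conv (\<lambda>x. abel_kernel 0 x - abel_kernel \<Lambda> x) source t
      = half_conv (abel_kernel 0) source t - half_conv (abel_kernel \<Lambda>) source t"
    unfolding half_conv_def left_diff_distrib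
    using assms by (intro set_integral_diff(2) integrable_conv_source) auto
  then show ?thesis using q_eq'[OF assms(1)] by (simp add: rest_def right_diff_distrib)
qed

lemma rest_growth:
  assumes g: "growth s" "0 \<le> s" and \<Lambda>: "\<Lambda> > 0"
  shows "\<exists>C. \<forall>t>0. norm (rest \<Lambda> t) \<le> C * exp (s * t)"
proof -
  obtain B where B0: "0 \<le> B" and B: "\<And>t. t > 0 \<Longrightarrow> norm (q t) \<le> B * exp (s * t)"
    using source_bound[OF g] by blast
  define C where "C = B + norm \<gamma> * (norm \<kappa> * (6 * sqrt pi) + csum * (B * sqrt (pi / \<Lambda>)))"
  have "norm (rest \<Lambda> t) \<le> C * exp (s * t)" if t: "t > 0" for t
  proof -
    have e: "1 \<le> exp (s * t)" using t g by simp
    have int: "(LBINT x:{0<..<t}. exp (- (\<Lambda> * (t - x))) / sqrt (t - x) * norm (q x)) \<le> B * exp (s * t) * sqrt (pi / \<Lambda>)"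
    proof -
      have gi: "set_integrable lborel {0<..<t} (\<lambda>x. B * exp (s * t) * (exp (- (\<Lambda> * (t - x))) / sqrt (t - x)))"
        by (intro set_integrable_mult_right set_integral_abel_exp_le(1) t \<Lambda>)
      have le: "exp (- (\<Lambda> * (t - x))) / sqrt (t - x) * norm (q x) \<le> B * exp (s * t) * (exp (- (\<Lambda> * (t - x))) / sqrt (t - x))"
        if x: "x \<in> {0<..<t}" for x
      proof -
        have "norm (q x) \<le> B * exp (s * x)" using B x by simp
        also have "\<dots> \<le> B * exp (s * t)" using x g B0 by (intro mult_left_mono) (auto intro: mult_left_mono)
        finally have "exp (- (\<Lambda> * (t - x))) / sqrt (t - x) * norm (q x) \<le> exp (- (\<Lambda> * (t - x))) / sqrt (t - x) * (B * exp (s * t))"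
          using x by (intro mult_left_mono) auto
        then show ?thesis by (simp only: mult_ac)
      qed
      have fi: "set_integrable lborel {0<..<t} (\<lambda>x. exp (- (\<Lambda> * (t - x))) / sqrt (t - x) * norm (q x))"
      proof (rule set_integrable_bound[OF gi])
        have "continuous_on {0<..<t} (\<lambda>x. exp (- (\<Lambda> * (t - x))) / sqrt (t - x) * norm (q x))"
          by (intro continuous_intros continuous_on_subset[OF q_cont]) auto
        from borel_measurable_continuous_on_indicator[OF _ this]
        show "set_borel_measurable lborel {0<..<t} (\<lambda>x. exp (- (\<Lambda> * (t - x))) / sqrt (t - x) * norm (q x))"
          by (simp add: set_borel_measurable_def)
        show "AE x in lborel. x \<in> {0<..<t} \<longrightarrow> norm (exp (- (\<Lambda> * (t - x))) / sqrt (t - x) * norm (q x))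
            \<le> norm (B * exp (s * t) * (exp (- (\<Lambda> * (t - x))) / sqrt (t - x)))"
        proof (intro AE_I2 impI)
          fix x assume x: "x \<in> {0<..<t}"
          have "0 \<le> exp (- (\<Lambda> * (t - x))) / sqrt (t - x) * norm (q x)" using x by simp
          with le[OF x] show "norm (exp (- (\<Lambda> * (t - x))) / sqrt (t - x) * norm (q x))
            \<le> norm (B * exp (s * t) * (exp (- (\<Lambda> * (t - x))) / sqrt (t - x)))"
            unfolding real_norm_def by linarith
        qed
      qed
      have "(LBINT x:{0<..<t}. exp (- (\<Lambda> * (t - x))) / sqrt (t - x) * norm (q x))
          \<le> (LBINT x:{0<..<t}. B * exp (s * t) * (exp (- (\<Lambda> * (t - x))) / sqrt (t - x)))"
        by (rule set_integral_mono[OF fi gi le])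
      also have "\<dots> = B * exp (s * t) * (LBINT x:{0<..<t}. exp (- (\<Lambda> * (t - x))) / sqrt (t - x))"
        by (rule set_integral_mult_right)
      also have "\<dots> \<le> B * exp (s * t) * sqrt (pi / \<Lambda>)"
        using B0 by (intro mult_left_mono set_integral_abel_exp_le(2) t \<Lambda>) auto
      finally show ?thesis .
    qed
    have "norm (rest \<Lambda> t) \<le> norm (q t) + norm \<gamma> * (norm \<kappa> * norm (half_conv (abel_kernel \<Lambda>) (bound_state_datum E) t)
        + norm (half_conv (abel_kernel \<Lambda>) (\<lambda>s. of_real (\<alpha> s) * q s) t))"
    proof -
      have "norm (\<kappa> * half_conv (abel_kernel \<Lambda>) (bound_state_datum E) t - half_conv (abel_kernel \<Lambda>) (\<lambda>s. of_real (\<alpha> s) * q s) t)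
        \<le> norm \<kappa> * norm (half_conv (abel_kernel \<Lambda>) (bound_state_datum E) t) + norm (half_conv (abel_kernel \<Lambda>) (\<lambda>s. of_real (\<alpha> s) * q s) t)"
        by (rule order_trans[OF norm_triangle_ineq4]) (simp add: norm_mult)
      then show ?thesis
        unfolding rest_eq[OF t less_imp_le[OF \<Lambda>]] half_conv_source[OF t less_imp_le[OF \<Lambda>]]
        by (intro order_trans[OF norm_triangle_ineq4] add_left_mono) (simp add: norm_mult mult_left_mono)
    qed
    also have "\<dots> \<le> B * exp (s * t) + norm \<gamma> * (norm \<kappa> * (6 * sqrt pi) + csum * (B * exp (s * t) * sqrt (pi / \<Lambda>)))"
      using B[OF t] norm_conv_datum_le[OF t less_imp_le[OF \<Lambda>]] int csum_nonneg
        order_trans[OF norm_conv_\<alpha>q_le[OF t less_imp_le[OF \<Lambda>]] mult_left_mono[OF int csum_nonneg]]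
      by (intro add_mono mult_left_mono) auto
    also have "\<dots> \<le> C * exp (s * t)"
    proof -
      have "norm \<gamma> * (norm \<kappa> * (6 * sqrt pi)) * 1 \<le> norm \<gamma> * (norm \<kappa> * (6 * sqrt pi)) * exp (s * t)"
        using e by (intro mult_left_mono) auto
      then show ?thesis by (simp add: C_def algebra_simps)
    qed
    finally show ?thesis .
  qed
  then show ?thesis by blast
qed

text \<open>The two singularities t^(-1/2) cancel in the kernel difference, which is at most
  \<Lambda> sqrt t and so extends continuously by 0 to the whole line. The convolution with the
  locally integrable source is then continuous by dominated convergence.\<close>

lemma continuous_rest:
  assumes \<Lambda>: "\<Lambda> \<ge> 0"
  shows "continuous_on {0<..} (rest \<Lambda>)"
proof -
  define kr where "kr x = (if x > 0 then abel_kernel 0 x - abel_kernel \<Lambda> x else 0)" for x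
  have kre: "kr x = of_real ((1 - exp (- (\<Lambda> * x))) / sqrt x)" if "x > 0" for x
    using that by (simp add: kr_def abel_kernel_def diff_divide_distrib)
  have krb: "norm (kr x) \<le> \<Lambda> * sqrt \<bar>x\<bar>" for x
  proof (cases "x > 0")
    case True
    have "1 - exp (- (\<Lambda> * x)) \<le> \<Lambda> * x" using exp_ge_add_one_self[of "- (\<Lambda> * x)"] by simp
    moreover have "0 \<le> 1 - exp (- (\<Lambda> * x))" using True \<Lambda> by simp
    ultimately have "norm (kr x) \<le> \<Lambda> * x / sqrt x"
      unfolding kre[OF True] norm_of_real using True by (simp add: divide_right_mono)
    also have "\<dots> = \<Lambda> * sqrt x" using real_div_sqrt[of x] True by (simp only: times_divide_eq_right[symmetric] less_imp_le)
    finally show ?thesis using True by simp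
  qed (simp add: kr_def \<Lambda>)
  have krc: "continuous_on UNIV kr"
  proof (intro continuous_at_imp_continuous_on ballI)
    fix x :: real
    consider "x > 0" | "x < 0" | "x = 0" by linarith
    then show "isCont kr x"
    proof cases
      case 1
      have "isCont (\<lambda>x. of_real ((1 - exp (- (\<Lambda> * x))) / sqrt x) :: complex) x"
        using 1 by (intro continuous_intros) auto
      moreover have "\<forall>\<^sub>F y in nhds x. kr y = of_real ((1 - exp (- (\<Lambda> * y))) / sqrt y)"
        using eventually_nhds_in_open[of "{0<..}" x] 1 by (auto elim!: eventually_mono simp: kre)
      ultimately show ?thesis by (simp add: isCont_cong)
    next
      case 2
      have "\<forall>\<^sub>F y in nhds x. kr y = 0"
        using eventually_nhds_in_open[of "{..<0}" x] 2 by (auto elim!: eventually_mono simp: kr_def)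
      then show ?thesis by (simp add: isCont_cong)
    next
      case 3
      have "((\<lambda>x. \<Lambda> * sqrt \<bar>x\<bar>) \<longlongrightarrow> \<Lambda> * sqrt \<bar>0\<bar>) (at 0)" by (intro tendsto_intros)
      then have "((\<lambda>x. \<Lambda> * sqrt \<bar>x\<bar>) \<longlongrightarrow> 0) (at 0)" by simp
      then have "(kr \<longlongrightarrow> 0) (at 0)"
        by (rule Lim_null_comparison[rotated]) (use krb in auto)
      then show ?thesis using 3 by (simp add: isCont_def kr_def)
    qed
  qed
  \<comment> \<open>The extended kernel vanishes for negative arguments, so the moving interval of
    integration can be replaced by a fixed one.\<close>
  have rep: "rest \<Lambda> t = \<gamma> * (LINT s|lborel. indicator {0<..<b} s *\<^sub>R (kr (t - s) * source s))" if "t \<le> b" for t b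
    unfolding rest_def half_conv_def set_lebesgue_integral_def
    by (intro arg_cong[where f = "(*) \<gamma>"] Bochner_Integration.integral_cong refl)
      (use that in \<open>auto simp: indicator_def kr_def\<close>)
  obtain s0 where s0: "s0 > 0" "growth s0" using initial_growth by blast
  obtain B where "B \<ge> 0" and B: "\<And>t. t > 0 \<Longrightarrow> norm (source t) \<le> B * (1 + t powr (-1/2)) * exp (s0 * t)"
    using source_bound[OF s0(2) less_imp_le[OF s0(1)]] by blast
  have si: "set_integrable lborel {0<..<b} source" for b
  proof (rule set_integrable_bound)
    show "set_integrable lborel {0<..<b} (\<lambda>s. B * exp (s0 * b) * (1 + s powr (-1/2)))"
    proof (cases "b > 0")
      case True
      have "set_integrable lborel {0<..<b} (\<lambda>s. s powr (-1/2))"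
        using set_integral_inverse_sqrt(1)[OF True]
        by (rule set_integrable_cong[THEN iffD1, rotated -1]) (auto simp: inverse_sqrt_powr)
      moreover have "set_integrable lborel {0<..<b} (\<lambda>s. 1::real)"
        using True by (auto simp: set_integrable_def intro!: integrable_real_indicator)
      ultimately show ?thesis by (intro set_integrable_mult_right set_integral_add)
    qed simp
    have "continuous_on {0<..<b} source" by (rule continuous_on_subset[OF continuous_source]) auto
    from borel_measurable_continuous_on_indicator[OF _ this]
    show "set_borel_measurable lborel {0<..<b} source" by (simp add: set_borel_measurable_def)
    show "AE s in lborel. s \<in> {0<..<b} \<longrightarrow> norm (source s) \<le> norm (B * exp (s0 * b) * (1 + s powr (-1/2)))"
    proof (intro AE_I2 impI)
      fix s assume s: "s \<in> {0<..<b}"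
      have "norm (source s) \<le> B * (1 + s powr (-1/2)) * exp (s0 * s)" using B[of s] s by simp
      also have "\<dots> \<le> B * (1 + s powr (-1/2)) * exp (s0 * b)"
        using s s0 \<open>B \<ge> 0\<close> by (intro mult_left_mono) auto
      also have "\<dots> = B * exp (s0 * b) * (1 + s powr (-1/2))" by (simp only: mult_ac)
      also have "\<dots> \<le> \<bar>\<dots>\<bar>" by (rule abs_ge_self)
      finally show "norm (source s) \<le> norm (B * exp (s0 * b) * (1 + s powr (-1/2)))"
        unfolding real_norm_def .
    qed
  qed
  show ?thesis
  proof (rule continuous_at_imp_continuous_on, intro ballI)
    fix t :: real assume "t \<in> {0<..}"
    define b where "b = t + 1"
    have "((\<lambda>x. LINT s|lborel. indicator {0<..<b} s *\<^sub>R (kr (x - s) * source s)) \<longlongrightarrow>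
        (LINT s|lborel. indicator {0<..<b} s *\<^sub>R (kr (t - s) * source s))) (at t within {t - 1<..<t + 1})"
      unfolding tendsto_at_iff_sequentially comp_def
    proof (intro allI impI)
      fix X :: "nat \<Rightarrow> real" assume X: "\<forall>i. X i \<in> {t - 1<..<t + 1} - {t}" "X \<longlonglongrightarrow> t"
      show "(\<lambda>i. LINT s|lborel. indicator {0<..<b} s *\<^sub>R (kr (X i - s) * source s)) \<longlonglongrightarrow>
        (LINT s|lborel. indicator {0<..<b} s *\<^sub>R (kr (t - s) * source s))"
      proof (rule integral_dominated_convergence[where w = "\<lambda>s. \<Lambda> * sqrt (\<bar>t\<bar> + 1 + \<bar>b\<bar>) * norm (indicator {0<..<b} s *\<^sub>R source s)"])
        have [measurable]: "kr \<in> borel_measurable borel" using krc by (rule borel_measurable_continuous_onI)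
        have sm [measurable]: "(\<lambda>s. indicator {0<..<b} s *\<^sub>R source s) \<in> borel_measurable borel"
          using si[of b] by (simp add: set_integrable_def)
        have "(\<lambda>s. kr (x - s) * (indicator {0<..<b} s *\<^sub>R source s)) \<in> borel_measurable lborel" for x by measurable
        then show "(\<lambda>s. indicator {0<..<b} s *\<^sub>R (kr (t - s) * source s)) \<in> borel_measurable lborel"
          "(\<lambda>s. indicator {0<..<b} s *\<^sub>R (kr (X i - s) * source s)) \<in> borel_measurable lborel" for i
          by simp_all
        show "integrable lborel (\<lambda>s. \<Lambda> * sqrt (\<bar>t\<bar> + 1 + \<bar>b\<bar>) * norm (indicator {0<..<b} s *\<^sub>R source s))"
          using si[of b] unfolding set_integrable_def by (intro integrable_mult_right integrable_norm)
        show "AE s in lborel. (\<lambda>i. indicator {0<..<b} s *\<^sub>R (kr (X i - s) * source s)) \<longlonglongrightarrow> indicator {0<..<b} s *\<^sub>R (kr (t - s) * source s)"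
        proof (intro AE_I2 tendsto_intros)
          fix s
          have "(\<lambda>i. X i - s) \<longlonglongrightarrow> t - s" by (intro tendsto_intros X(2))
          then show "(\<lambda>i. kr (X i - s)) \<longlonglongrightarrow> kr (t - s)"
            by (rule continuous_on_tendsto_compose[OF krc]) auto
        qed
        show "AE s in lborel. norm (indicator {0<..<b} s *\<^sub>R (kr (X i - s) * source s))
            \<le> \<Lambda> * sqrt (\<bar>t\<bar> + 1 + \<bar>b\<bar>) * norm (indicator {0<..<b} s *\<^sub>R source s)" for i
        proof (intro AE_I2)
          fix s
          show "norm (indicator {0<..<b} s *\<^sub>R (kr (X i - s) * source s))
            \<le> \<Lambda> * sqrt (\<bar>t\<bar> + 1 + \<bar>b\<bar>) * norm (indicator {0<..<b} s *\<^sub>R source s)"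
          proof (cases "s \<in> {0<..<b}")
            case True
            have "t - 1 < X i" "X i < t + 1" using X(1) by auto
            then have "\<bar>X i - s\<bar> \<le> \<bar>t\<bar> + 1 + \<bar>b\<bar>" using True by auto
            then have "\<Lambda> * sqrt \<bar>X i - s\<bar> \<le> \<Lambda> * sqrt (\<bar>t\<bar> + 1 + \<bar>b\<bar>)" using \<Lambda> by (intro mult_left_mono) auto
            with krb[of "X i - s"] have "norm (kr (X i - s)) \<le> \<Lambda> * sqrt (\<bar>t\<bar> + 1 + \<bar>b\<bar>)" by linarith
            then show ?thesis using True by (simp add: norm_mult mult_right_mono)
          qed simp
        qed
      qed
    qed
    moreover have "at t within {t - 1<..<t + 1} = at t" by (rule at_within_open) auto
    ultimately have "((\<lambda>x. LINT s|lborel. indicator {0<..<b} s *\<^sub>R (kr (x - s) * source s)) \<longlongrightarrow>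
        (LINT s|lborel. indicator {0<..<b} s *\<^sub>R (kr (t - s) * source s))) (at t)" by (simp only:)
    then have "((\<lambda>x. \<gamma> * (LINT s|lborel. indicator {0<..<b} s *\<^sub>R (kr (x - s) * source s))) \<longlongrightarrow> rest \<Lambda> t) (at t)"
      using rep[of t b] by (auto simp: b_def intro!: tendsto_mult_left)
    moreover have "\<forall>\<^sub>F x in at t. \<gamma> * (LINT s|lborel. indicator {0<..<b} s *\<^sub>R (kr (x - s) * source s)) = rest \<Lambda> x"
      using eventually_at_in_open'[of "{t - 1<..<t + 1}" t]
      by (auto elim!: eventually_mono simp: rep[of _ b] b_def)
    ultimately show "isCont (rest \<Lambda>) t" unfolding isCont_def by (rule Lim_transform_eventually)
  qed
qed

lemma rest_moment:
  assumes g: "growth s" "0 \<le> s" "s < Re p" and \<Lambda>: "\<Lambda> > 0"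
  shows "laplace_moment m (rest \<Lambda>) p =
      \<gamma> * (\<Sum>i\<le>m. (laplace_moment i (abel_kernel 0) p - laplace_moment i (abel_kernel \<Lambda>) p) * laplace_moment (m - i) source p)"
    and "laplace_moment m (rest \<Lambda>) p =
      laplace_moment m q p - \<gamma> * (\<Sum>i\<le>m. laplace_moment i (abel_kernel \<Lambda>) p * laplace_moment (m - i) source p)"
proof -
  have a: "laplaceable (Re p) (abel_kernel 0)" "laplaceable (Re p) (abel_kernel \<Lambda>)"
    using g \<Lambda> by (auto intro!: laplaceable_abel_kernel)
  have src: "laplaceable (Re p) source" by (rule laplaceable_source_q(1)[OF g])
  show 1: "laplace_moment m (rest \<Lambda>) p =
      \<gamma> * (\<Sum>i\<le>m. (laplace_moment i (abel_kernel 0) p - laplace_moment i (abel_kernel \<Lambda>) p) * laplace_moment (m - i) source p)"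
    unfolding rest_def laplace_moment_cmult
    by (subst laplace_moment_half_conv[OF laplaceable_diff[OF a] src]) (simp add: laplace_moment_diff[OF a])
  have "laplace_moment m q p = laplace_moment m (\<lambda>t. \<gamma> * half_conv (abel_kernel 0) source t) p"
    by (intro laplace_moment_cong q_eq')
  also have "\<dots> = \<gamma> * (\<Sum>i\<le>m. laplace_moment i (abel_kernel 0) p * laplace_moment (m - i) source p)"
    unfolding laplace_moment_cmult by (subst laplace_moment_half_conv[OF a(1) src]) simp
  finally show "laplace_moment m (rest \<Lambda>) p =
      laplace_moment m q p - \<gamma> * (\<Sum>i\<le>m. laplace_moment i (abel_kernel \<Lambda>) p * laplace_moment (m - i) source p)"
    unfolding 1 by (simp add: left_diff_distrib sum_subtractf right_diff_distrib)
qed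

text \<open>The moment bounds for charge and source carry no decay along the lattice; the factor
  |p_n|^(-3/2) of the kernel difference provides it as a summable weight. \<open>C\<close> and
  \<open>K\<close> are again independent of the growth rate.\<close>

lemma rest_moment_bound:
  assumes \<Lambda>: "\<Lambda> \<ge> 1"
  shows "\<exists>C\<ge>0. \<exists>K\<ge>2. \<forall>s p m (n::int). growth s \<longrightarrow> 0 \<le> s \<longrightarrow> s < Re p \<longrightarrow> Re p \<le> R \<longrightarrow> \<bar>Im p\<bar> \<le> w / 2 \<longrightarrow>
    norm (laplace_moment m (rest \<Lambda>) (p + \<i> * of_real (of_int n * w)))
      \<le> C * K ^ m * decay_scale (norm p) m * lattice_weight (nat \<bar>n\<bar>)"
proof -
  obtain D where D1: "D \<ge> 1" and MB: "\<forall>s p m (n::int). growth s \<longrightarrow> 0 \<le> s \<longrightarrow> s < Re p \<longrightarrow> Re p \<le> R \<longrightarrow> \<bar>Im p\<bar> \<le> w / 2 \<longrightarrow>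
    norm (laplace_moment m q (p + \<i> * of_real (of_int n * w))) \<le> D * (1 + D) ^ m * decay_scale (norm p) m \<and>
    norm (laplace_moment m source (p + \<i> * of_real (of_int n * w))) \<le> D * (1 + D) ^ m * decay_scale (norm p) m"
    using moment_bounds[of R] by blast
  define B where "B = max 1 (sqrt (\<bar>R\<bar> + w))"
  have B1: "1 \<le> B" by (simp add: B_def)
  define W where "W = w / 4 * sqrt (w / 4)"
  have W0: "W > 0" using w by (simp add: W_def)
  define C0 where "C0 = D + norm \<gamma> * (sqrt pi * (B * (1 + D)))"
  define C1 where "C1 = norm \<gamma> * (2 * sqrt pi * \<Lambda> * B / W * (B * (1 + D)))"
  have C0: "0 \<le> C0" "0 \<le> C1" using D1 B1 \<Lambda> W0 by (simp_all add: C0_def C1_def)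
  have main: "norm (laplace_moment m (rest \<Lambda>) (p + \<i> * of_real (of_int n * w)))
      \<le> (C0 + C1) * (1 + D) ^ m * decay_scale (norm p) m * lattice_weight (nat \<bar>n\<bar>)"
    if g: "growth s" "0 \<le> s" "s < Re p" and pR: "Re p \<le> R" "\<bar>Im p\<bar> \<le> w / 2" for s p m and n :: int
  proof -
    define z where "z = p + \<i> * of_real (of_int n * w)"
    define \<rho> where "\<rho> = norm p"
    have rz: "s < Re z" "0 < Re z" using g by (auto simp: z_def)
    have \<rho>0: "\<rho> > 0" using g by (auto simp: \<rho>_def)
    have z\<rho>: "\<rho> \<le> norm z" unfolding \<rho>_def z_def by (rule lattice_point_norm(1)[OF pR(2) w])
    have "\<rho> \<le> \<bar>R\<bar> + w" using cmod_le[of p] g pR w by (simp add: \<rho>_def)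
    then have \<rho>B: "sqrt \<rho> \<le> B" by (simp add: B_def le_max_iff_disj)
    have Q: "norm (laplace_moment j q z) \<le> D * (1 + D) ^ j * decay_scale \<rho> j" for j
      using MB g pR by (auto simp: z_def \<rho>_def)
    have S: "norm (laplace_moment j source z) \<le> D * (1 + D) ^ j * decay_scale \<rho> j" for j
      using MB g pR by (auto simp: z_def \<rho>_def)
    have ds0: "0 \<le> decay_scale \<rho> j" for j by (rule decay_scale_nonneg[OF \<rho>0])
    \<comment> \<open>A Cauchy product with a kernel on the scale \<open>decay_scale\<close> costs
      only the factor B (1 + D), uniformly in m.\<close>
    have conv: "norm (\<Sum>i\<le>m. k i * laplace_moment (m - i) source z) \<le> a * (B * (1 + D)) * (1 + D) ^ m * decay_scale \<rho> m"
      if k: "\<And>i. norm (k i) \<le> a * decay_scale \<rho> i" and a: "0 \<le> a" for k :: "nat \<Rightarrow> complex" and a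
    proof -
      have "norm (\<Sum>i\<le>m. k i * laplace_moment (m - i) source z) \<le> (\<Sum>i\<le>m. a * B * decay_scale \<rho> m * (D * (1 + D) ^ (m - i)))"
      proof (intro order_trans[OF norm_sum] sum_mono)
        fix i assume i: "i \<in> {..m}"
        have "norm (k i * laplace_moment (m - i) source z) \<le> a * decay_scale \<rho> i * (D * (1 + D) ^ (m - i) * decay_scale \<rho> (m - i))"
          unfolding norm_mult by (intro mult_mono k S mult_nonneg_nonneg ds0 a) auto
        also have "\<dots> = a * (D * (1 + D) ^ (m - i)) * (decay_scale \<rho> i * decay_scale \<rho> (m - i))" by simp
        also have "\<dots> \<le> a * (D * (1 + D) ^ (m - i)) * (B * decay_scale \<rho> (i + (m - i)))"
          using a D1 by (intro mult_left_mono decay_scale_mult_le[OF \<rho>0 B1 \<rho>B]) auto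
        also have "i + (m - i) = m" using i by simp
        finally show "norm (k i * laplace_moment (m - i) source z) \<le> a * B * decay_scale \<rho> m * (D * (1 + D) ^ (m - i))"
          by (simp add: mult_ac)
      qed
      also have "\<dots> = a * B * decay_scale \<rho> m * (\<Sum>j<Suc m. D * (1 + D) ^ j)"
        unfolding sum_distrib_left[symmetric] lessThan_Suc_atMost[symmetric]
        by (subst sum.nat_diff_reindex[symmetric]) simp
      also have "\<dots> \<le> a * B * decay_scale \<rho> m * (1 + D) ^ Suc m"
        unfolding sum_geometric_shift using a B1 ds0 by (intro mult_left_mono) auto
      finally show ?thesis by (simp add: mult_ac)
    qed
    have P0: "0 \<le> (1 + D) ^ m * decay_scale \<rho> m" using D1 ds0 by simp
    have "norm (laplace_moment m (rest \<Lambda>) z) \<le> (C0 + C1) * ((1 + D) ^ m * decay_scale \<rho> m * lattice_weight (nat \<bar>n\<bar>))"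
    \<comment> \<open>For n = 0 the point z may be arbitrarily close to the branch point; for all
      other n it stays away from 0 at distance proportional to 1 + |n|.\<close>
    proof (cases "n = 0")
      case True
      then have zp: "z = p" by (simp add: z_def)
      have "norm (laplace_moment i (abel_kernel \<Lambda>) z) \<le> sqrt pi * decay_scale \<rho> i" for i
        using abel_kernel_moment_bound[OF \<Lambda> rz(2), of i] by (simp add: zp \<rho>_def)
      then have b: "norm (\<Sum>i\<le>m. laplace_moment i (abel_kernel \<Lambda>) z * laplace_moment (m - i) source z)
          \<le> sqrt pi * (B * (1 + D)) * (1 + D) ^ m * decay_scale \<rho> m"
        by (intro conv) auto
      have "norm (laplace_moment m (rest \<Lambda>) z) \<le> norm (laplace_moment m q z)
          + norm \<gamma> * norm (\<Sum>i\<le>m. laplace_moment i (abel_kernel \<Lambda>) z * laplace_moment (m - i) source z)"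
        using \<Lambda> unfolding rest_moment(2)[OF g(1,2) rz(1), of \<Lambda>] norm_mult[symmetric]
        by (subst rest_moment(2)[OF g(1,2) rz(1)]) (auto intro: norm_triangle_ineq4)
      also have "\<dots> \<le> D * (1 + D) ^ m * decay_scale \<rho> m + norm \<gamma> * (sqrt pi * (B * (1 + D)) * (1 + D) ^ m * decay_scale \<rho> m)"
        by (intro add_mono mult_left_mono Q b) auto
      also have "\<dots> = C0 * ((1 + D) ^ m * decay_scale \<rho> m)" by (simp add: C0_def algebra_simps)
      also have "\<dots> \<le> (C0 + C1) * ((1 + D) ^ m * decay_scale \<rho> m)" using C0 P0 by (intro mult_right_mono) auto
      finally show ?thesis using True by (simp add: lattice_weight_def)
    next
      case False
      define y where "y = (1 + \<bar>real_of_int n\<bar>) * (w / 4)"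
      have y: "0 < y" "y \<le> norm z"
        using lattice_point_norm(2)[OF pR(2) w False] w by (auto simp: y_def z_def)
      have "y * sqrt y = W * ((1 + \<bar>real_of_int n\<bar>) * sqrt (1 + \<bar>real_of_int n\<bar>))"
        unfolding y_def W_def real_sqrt_mult by simp
      then have yl: "1 / (y * sqrt y) = lattice_weight (nat \<bar>n\<bar>) / W"
        using W0 by (simp add: lattice_weight_def)
      have zy: "1 / (norm z * sqrt (norm z)) \<le> 1 / (y * sqrt y)"
        using y by (intro divide_left_mono mult_mono mult_pos_pos) auto
      define a where "a = 2 * sqrt pi * \<Lambda> * B / W * lattice_weight (nat \<bar>n\<bar>)"
      have a0: "0 \<le> a" using \<Lambda> B1 W0 lattice_weight_nonneg by (simp add: a_def)
      have "norm (laplace_moment i (abel_kernel 0) z - laplace_moment i (abel_kernel \<Lambda>) z) \<le> a * decay_scale \<rho> i" for i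
      proof -
        have "norm (laplace_moment i (abel_kernel 0) z - laplace_moment i (abel_kernel \<Lambda>) z)
            \<le> 2 * sqrt pi * \<Lambda> * B * decay_scale \<rho> i / (norm z * sqrt (norm z))"
          by (rule abel_kernel_moment_diff_bound[OF \<Lambda> rz(2) \<rho>0 z\<rho> B1 \<rho>B])
        also have "\<dots> = 2 * sqrt pi * \<Lambda> * B * decay_scale \<rho> i * (1 / (norm z * sqrt (norm z)))" by simp
        also have "\<dots> \<le> 2 * sqrt pi * \<Lambda> * B * decay_scale \<rho> i * (1 / (y * sqrt y))"
          using \<Lambda> B1 ds0 by (intro mult_left_mono zy) auto
        also have "\<dots> = a * decay_scale \<rho> i" unfolding yl by (simp add: a_def)
        finally show ?thesis .
      qed
      then have b: "norm (\<Sum>i\<le>m. (laplace_moment i (abel_kernel 0) z - laplace_moment i (abel_kernel \<Lambda>) z) * laplace_moment (m - i) source z)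
          \<le> a * (B * (1 + D)) * (1 + D) ^ m * decay_scale \<rho> m"
        by (intro conv a0)
      have "norm (laplace_moment m (rest \<Lambda>) z) \<le> norm \<gamma> * (a * (B * (1 + D)) * (1 + D) ^ m * decay_scale \<rho> m)"
        using \<Lambda> b by (subst rest_moment(1)[OF g(1,2) rz(1)]) (auto simp: norm_mult intro: mult_left_mono)
      also have "\<dots> = C1 * ((1 + D) ^ m * decay_scale \<rho> m * lattice_weight (nat \<bar>n\<bar>))"
        by (simp add: C1_def a_def mult_ac)
      also have "\<dots> \<le> (C0 + C1) * ((1 + D) ^ m * decay_scale \<rho> m * lattice_weight (nat \<bar>n\<bar>))"
        using C0 P0 lattice_weight_nonneg by (intro mult_right_mono) auto
      finally show ?thesis .
    qed
    then show ?thesis by (simp add: z_def \<rho>_def mult.assoc)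
  qed
  show ?thesis
    by (rule exI[of _ "C0 + C1"], rule conjI, use C0 in simp, rule exI[of _ "1 + D"]) (use D1 main in auto)
qed

text \<open>Moments from the second on are integrable on vertical lines: |p|^(-3/2-m) is at most
  \<sigma>^(-m) times a cusp, whose integral is of order \<sigma>^(-1/2), and the lattice weights
  add up to a finite factor. The powers \<open>K ^ (m + 2)\<close> and \<open>\<sigma> ^ m\<close>
  are kept explicit for the later summation over m.\<close>

lemma rest_pointwise:
  assumes \<Lambda>: "\<Lambda> \<ge> 1"
  shows "\<exists>C\<ge>0. \<exists>K\<ge>2. \<forall>s \<sigma> m t. growth s \<longrightarrow> 0 \<le> s \<longrightarrow> s < \<sigma> \<longrightarrow> \<sigma> \<le> R \<longrightarrow> t > 0 \<longrightarrow>
    t ^ (m + 2) / fact (m + 2) * norm (rest \<Lambda> t) \<le> C * K ^ (m + 2) / (\<sigma> ^ m * sqrt \<sigma>) * exp (\<sigma> * t)"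
proof -
  obtain C K where C0: "C \<ge> 0" and K2: "K \<ge> 2" and CK: "\<forall>s p m (n::int). growth s \<longrightarrow> 0 \<le> s \<longrightarrow> s < Re p \<longrightarrow> Re p \<le> R \<longrightarrow> \<bar>Im p\<bar> \<le> w / 2 \<longrightarrow>
    norm (laplace_moment m (rest \<Lambda>) (p + \<i> * of_real (of_int n * w)))
      \<le> C * K ^ m * decay_scale (norm p) m * lattice_weight (nat \<bar>n\<bar>)"
    using rest_moment_bound[OF \<Lambda>, of R] by blast
  define S where "S = suminf lattice_weight"
  have S0: "0 \<le> S" unfolding S_def by (intro suminf_nonneg summable_lattice_weight lattice_weight_nonneg)
  have main: "t ^ (m + 2) / fact (m + 2) * norm (rest \<Lambda> t) \<le> (24 * C * S) * K ^ (m + 2) / (\<sigma> ^ m * sqrt \<sigma>) * exp (\<sigma> * t)"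
    if g: "growth s" "0 \<le> s" "s < \<sigma>" and R: "\<sigma> \<le> R" and t: "t > 0" for s \<sigma> m t
  proof -
    have \<sigma>: "\<sigma> > 0" using g by simp
    define A where "A = 3 * C * K ^ (m + 2) / \<sigma> ^ m"
    have A0: "0 \<le> A" using C0 K2 \<sigma> by (simp add: A_def)
    \<comment> \<open>The index that belongs to x is afterwards replaced by a sum over all k.
      Including both signs of k w gives a majorant that is measurable and can be integrated term by
      term.\<close>
    have pt: "\<exists>k::nat. norm (laplace_moment (m + 2) (rest \<Lambda>) (Complex \<sigma> x))
        \<le> A * lattice_weight k * (cusp \<sigma> (- (real k * w) + x) + cusp \<sigma> (real k * w + x))" for x
    proof -
      \<comment> \<open>Subtracting the nearest multiple of w puts p into the strip |Im p| <= w / 2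
        where the moment bounds hold.\<close>
      define n where "n = round (x / w)"
      define p where "p = Complex \<sigma> (x - of_int n * w)"
      have "\<bar>x / w - of_int n\<bar> \<le> 1 / 2" unfolding n_def using of_int_round_abs_le[of "x / w"] by (simp add: abs_minus_commute)
      then have "\<bar>x / w - of_int n\<bar> * w \<le> 1 / 2 * w" using w by (intro mult_right_mono) auto
      moreover have "\<bar>x / w - of_int n\<bar> * w = \<bar>x - of_int n * w\<bar>"
      proof -
        have "\<bar>x / w - of_int n\<bar> * w = \<bar>(x / w - of_int n) * w\<bar>" using w by (simp add: abs_mult)
        moreover have "(x / w - of_int n) * w = x - of_int n * w" using w by (simp add: left_diff_distrib)
        ultimately show ?thesis by (simp only:)
      qed
      ultimately have imp: "\<bar>Im p\<bar> \<le> w / 2" by (simp add: p_def)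
      have cz: "Complex \<sigma> x = p + \<i> * of_real (of_int n * w)" by (simp add: p_def complex_eq_iff)
      have p0: "norm p > 0" "\<sigma> \<le> norm p" using \<sigma> abs_Re_le_cmod[of p] by (auto simp: p_def)
      define u where "u = \<sigma> + \<bar>x - of_int n * w\<bar>"
      have u: "u > 0" "u / 2 \<le> norm p"
        using \<sigma> abs_Re_le_cmod[of p] abs_Im_le_cmod[of p] by (auto simp: u_def p_def)
      have "decay_scale (norm p) (m + 2) \<le> 3 / \<sigma> ^ m * cusp \<sigma> (x - of_int n * w)"
      proof -
        have "decay_scale (norm p) (m + 2) = 1 / (norm p ^ m * (norm p * sqrt (norm p)))"
          by (simp add: numeral_2_eq_2 mult_ac)
        also have "\<dots> \<le> 1 / (\<sigma> ^ m * (u / 2 * sqrt (u / 2)))"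
          using u p0 \<sigma> by (intro divide_left_mono mult_mono power_mono mult_pos_pos) auto
        also have "\<dots> \<le> 1 / (\<sigma> ^ m * (u * sqrt u / 3))"
        proof (intro divide_left_mono mult_left_mono mult_pos_pos)
          have "2 \<le> 3 * sqrt (1 / 2)"
          proof -
            have "sqrt 2 \<le> 3 / 2" by (rule real_le_lsqrt) (auto simp: power2_eq_square)
            then have "2 * sqrt 2 \<le> 3" by simp
            then show ?thesis by (simp add: real_sqrt_divide field_simps)
          qed
          then have "u * sqrt u * 2 \<le> u * sqrt u * (3 * sqrt (1 / 2))" using u by (intro mult_left_mono) auto
          moreover have "sqrt (u / 2) = sqrt u * sqrt (1 / 2)" by (simp flip: real_sqrt_mult)
          ultimately show "u * sqrt u / 3 \<le> u / 2 * sqrt (u / 2)" by simp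
        qed (use u \<sigma> in auto)
        also have "\<dots> = 3 / \<sigma> ^ m * cusp \<sigma> (x - of_int n * w)" by (simp add: cusp_def u_def)
        finally show ?thesis .
      qed
      then have "C * K ^ (m + 2) * decay_scale (norm p) (m + 2) * lattice_weight (nat \<bar>n\<bar>)
          \<le> C * K ^ (m + 2) * (3 / \<sigma> ^ m * cusp \<sigma> (x - of_int n * w)) * lattice_weight (nat \<bar>n\<bar>)"
        using C0 K2 lattice_weight_nonneg by (intro mult_right_mono mult_left_mono) auto
      also have "\<dots> = A * lattice_weight (nat \<bar>n\<bar>) * cusp \<sigma> (x - of_int n * w)" by (simp add: A_def)
      finally have le: "norm (laplace_moment (m + 2) (rest \<Lambda>) (Complex \<sigma> x)) \<le> A * lattice_weight (nat \<bar>n\<bar>) * cusp \<sigma> (x - of_int n * w)"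
        using CK[rule_format, of s p "m + 2" n] g R imp unfolding cz by (simp add: p_def)
      have c0: "0 \<le> cusp \<sigma> y" for y using \<sigma> by (simp add: cusp_def)
      have "cusp \<sigma> (x - of_int n * w) \<le> cusp \<sigma> (- (real (nat \<bar>n\<bar>) * w) + x) + cusp \<sigma> (real (nat \<bar>n\<bar>) * w + x)"
      proof (cases "0 \<le> n")
        case True
        then have "x - of_int n * w = - (real (nat \<bar>n\<bar>) * w) + x" by simp
        then show ?thesis using c0[of "real (nat \<bar>n\<bar>) * w + x"] by (simp only: add_increasing add_increasing2 order_refl)
      next
        case False
        then have "x - of_int n * w = real (nat \<bar>n\<bar>) * w + x" by simp
        then show ?thesis using c0[of "- (real (nat \<bar>n\<bar>) * w) + x"] by (simp only: add_increasing add_increasing2 order_refl)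
      qed
      then have "A * lattice_weight (nat \<bar>n\<bar>) * cusp \<sigma> (x - of_int n * w) \<le> A * lattice_weight (nat \<bar>n\<bar>) *
          (cusp \<sigma> (- (real (nat \<bar>n\<bar>) * w) + x) + cusp \<sigma> (real (nat \<bar>n\<bar>) * w + x))"
        using A0 lattice_weight_nonneg by (intro mult_left_mono) auto
      with le show ?thesis by (meson order_trans)
    qed
    have c0: "0 \<le> cusp \<sigma> y" for y using \<sigma> by (simp add: cusp_def)
    have "(\<integral>\<^sup>+x. ennreal (norm (laplace_moment (m + 2) (rest \<Lambda>) (Complex \<sigma> x))) \<partial>lborel)
        \<le> (\<integral>\<^sup>+x. (\<Sum>k. ennreal (A * lattice_weight k) * (ennreal (cusp \<sigma> (- (real k * w) + x)) + ennreal (cusp \<sigma> (real k * w + x)))) \<partial>lborel)"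
    proof (intro nn_integral_mono)
      fix x
      let ?T = "\<lambda>k. ennreal (A * lattice_weight k) * (ennreal (cusp \<sigma> (- (real k * w) + x)) + ennreal (cusp \<sigma> (real k * w + x)))"
      obtain k where "norm (laplace_moment (m + 2) (rest \<Lambda>) (Complex \<sigma> x))
        \<le> A * lattice_weight k * (cusp \<sigma> (- (real k * w) + x) + cusp \<sigma> (real k * w + x))" using pt by blast
      then have "ennreal (norm (laplace_moment (m + 2) (rest \<Lambda>) (Complex \<sigma> x))) \<le> ?T k"
        using A0 lattice_weight_nonneg c0
        by (simp add: ennreal_mult[symmetric] ennreal_plus[symmetric] ennreal_leI del: ennreal_plus)
      also have "\<dots> \<le> suminf ?T"
        using sum_le_suminf[of ?T "{k}"] by simp
      finally show "ennreal (norm (laplace_moment (m + 2) (rest \<Lambda>) (Complex \<sigma> x))) \<le> suminf ?T" .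
    qed
    also have "\<dots> = (\<Sum>k. \<integral>\<^sup>+x. ennreal (A * lattice_weight k) * (ennreal (cusp \<sigma> (- (real k * w) + x)) + ennreal (cusp \<sigma> (real k * w + x))) \<partial>lborel)"
      by (intro nn_integral_suminf) measurable
    also have "\<dots> \<le> (\<Sum>k. ennreal (A * lattice_weight k * (8 / sqrt \<sigma>)))"
    proof (intro suminf_le summableI)
      fix k
      have "(\<integral>\<^sup>+x. ennreal (A * lattice_weight k) * (ennreal (cusp \<sigma> (- (real k * w) + x)) + ennreal (cusp \<sigma> (real k * w + x))) \<partial>lborel)
          = ennreal (A * lattice_weight k) * ((\<integral>\<^sup>+x. ennreal (cusp \<sigma> (- (real k * w) + x)) \<partial>lborel) + (\<integral>\<^sup>+x. ennreal (cusp \<sigma> (real k * w + x)) \<partial>lborel))"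
        by (simp add: nn_integral_cmult nn_integral_add)
      also have "\<dots> \<le> ennreal (A * lattice_weight k) * (ennreal (4 / sqrt \<sigma>) + ennreal (4 / sqrt \<sigma>))"
        by (intro mult_left_mono add_mono nn_integral_cusp \<sigma>) auto
      also have "\<dots> = ennreal (A * lattice_weight k * (8 / sqrt \<sigma>))"
        using A0 lattice_weight_nonneg \<sigma>
        by (simp add: ennreal_mult[symmetric] ennreal_plus[symmetric] del: ennreal_plus)
      finally show "(\<integral>\<^sup>+x. ennreal (A * lattice_weight k) * (ennreal (cusp \<sigma> (- (real k * w) + x)) + ennreal (cusp \<sigma> (real k * w + x))) \<partial>lborel)
        \<le> ennreal (A * lattice_weight k * (8 / sqrt \<sigma>))" .
    qed
    also have "\<dots> = ennreal (\<Sum>k. A * lattice_weight k * (8 / sqrt \<sigma>))"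
      using A0 lattice_weight_nonneg \<sigma>
      by (intro suminf_ennreal2 summable_mult2 summable_mult summable_lattice_weight) auto
    also have "(\<Sum>k. A * lattice_weight k * (8 / sqrt \<sigma>)) = A * S * (8 / sqrt \<sigma>)"
      by (simp only: S_def suminf_mult2[OF summable_mult[OF summable_lattice_weight], symmetric]
          suminf_mult[OF summable_lattice_weight])
    finally have nn: "(\<integral>\<^sup>+x. ennreal (norm (laplace_moment (m + 2) (rest \<Lambda>) (Complex \<sigma> x))) \<partial>lborel) \<le> ennreal (A * S * (8 / sqrt \<sigma>))" .
    obtain Cr where Cr: "\<And>t. t > 0 \<Longrightarrow> norm (rest \<Lambda> t) \<le> Cr * exp (s * t)"
      using rest_growth[OF g(1,2), of \<Lambda>] \<Lambda> by auto
    have "t ^ (m + 2) / fact (m + 2) * norm (rest \<Lambda> t) \<le> A * S * (8 / sqrt \<sigma>) / (2 * pi) * exp (\<sigma> * t)"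
      using \<Lambda> A0 S0 \<sigma> t by (intro moment_bound_from_laplace[OF continuous_rest Cr g(3) _ nn]) auto
    \<comment> \<open>The gain 1 / (2 pi) is discarded. The constant 24 is 3 from the comparison
      with the cusp times 8 from two cusps of integral 4 / sqrt \<sigma>.\<close>
    also have "\<dots> \<le> A * S * (8 / sqrt \<sigma>) / 1 * exp (\<sigma> * t)"
      using A0 S0 \<sigma> pi_ge_two by (intro mult_right_mono divide_left_mono) auto
    also have "\<dots> = (24 * C * S) * K ^ (m + 2) / (\<sigma> ^ m * sqrt \<sigma>) * exp (\<sigma> * t)"
      by (simp add: A_def)
    finally show ?thesis .
  qed
  show ?thesis
    by (rule exI[of _ "24 * C * S"], rule conjI, use C0 S0 in simp, rule exI[of _ K]) (use K2 main in blast)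
qed

end

section \<open>Removal of exponential growth and decay of the charge\<close>

text \<open>The bounds for all m are weighted so that the left sides add up to an exponential series
  in \<sigma> t / (4 K) and the right sides to a geometric one.\<close>

lemma exp_gain_from_factorial_moments:
  fixes r t C K \<sigma> D e :: real
  assumes mom: "\<And>m. t ^ (m + 2) / fact (m + 2) * r \<le> C * K ^ (m + 2) / (\<sigma> ^ m * D) * e"
    and pos: "\<sigma> > 0" "K > 0" "D > 0" and nn: "0 \<le> r" "0 \<le> t" "0 \<le> C" "0 \<le> e"
  shows "exp (\<sigma> * t / (4 * K)) * (t\<^sup>2 * r) \<le> 8 * C * K\<^sup>2 / D * e"
proof -
  \<comment> \<open>A factor K / \<sigma> per moment is cancelled by \<sigma> / (4 K). Of the
    remaining 1/4 one half absorbs the quotient of (m + 2)! and m!, the other leaves a series of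
    ratio 1/2.\<close>
  define y where "y = \<sigma> * t / (4 * K)"
  define X where "X = C * K\<^sup>2 / D * e"
  have X0: "0 \<le> X" using pos nn by (simp add: X_def)
  have bnd: "y ^ m / fact m * (t\<^sup>2 * r) \<le> (1 / 2) ^ m * (4 * X)" for m :: nat
  proof -
    have pow: "real ((m + 1) * (m + 2)) \<le> 2 ^ (m + 2)"
    proof -
      have "(m + 1) * (m + 2) \<le> 2 ^ (m + 2)"
      proof (induction m)
        case (Suc m)
        have "m + 2 \<le> 2 ^ (m + 1)" using less_exp[of "m + 1"] by simp
        have "(Suc m + 1) * (Suc m + 2) = (m + 1) * (m + 2) + 2 * (m + 2)" by simp
        also have "\<dots> \<le> 2 ^ (m + 2) + 2 * 2 ^ (m + 1)" 
          by (rule add_mono[OF Suc.IH mult_le_mono2[OF \<open>m + 2 \<le> 2 ^ (m + 1)\<close>]])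
        finally show ?case by simp
      qed simp
      then have "real ((m + 1) * (m + 2)) \<le> real (2 ^ (m + 2))" by (simp only: of_nat_le_iff)
      then show ?thesis by simp
    qed
    have fm: "fact (m + 2) = real ((m + 1) * (m + 2)) * fact m"
      by (simp add: numeral_2_eq_2 algebra_simps)
    have "y ^ m / fact m * (t\<^sup>2 * r) = (\<sigma> / (4 * K)) ^ m * real ((m + 1) * (m + 2)) * (t ^ (m + 2) / fact (m + 2) * r)"
    proof -
      define N where "N = real ((m + 1) * (m + 2))"
      have "N > 0" unfolding N_def by (simp only: of_nat_0_less_iff) simp
      moreover have "y ^ m = (\<sigma> / (4 * K)) ^ m * t ^ m" by (simp add: y_def flip: power_mult_distrib)
      ultimately show ?thesis unfolding fm N_def[symmetric] power_add by simp
    qed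
    also have "\<dots> \<le> (\<sigma> / (4 * K)) ^ m * 2 ^ (m + 2) * (C * K ^ (m + 2) / (\<sigma> ^ m * D) * e)"
      using pos nn by (intro mult_mono mom pow) auto
    also have "\<dots> = (1 / 2) ^ m * (4 * X)"
    proof -
      have "(4::real) ^ m = 2 ^ m * 2 ^ m" by (simp flip: power_mult_distrib)
      then show ?thesis using pos
        by (simp add: X_def power_add power_mult_distrib power_divide power2_eq_square field_simps)
    qed
    finally show ?thesis .
  qed
  have "(\<lambda>m. y ^ m / fact m * (t\<^sup>2 * r)) sums (exp y * (t\<^sup>2 * r))"
    using exp_converges[of y] by (intro sums_mult2) (simp add: divide_inverse mult.commute)
  moreover have "(\<lambda>m. (1 / 2) ^ m * (4 * X)) sums (2 * (4 * X))"
    using geometric_sums[of "1 / 2 :: real"] by (intro sums_mult2) simp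
  ultimately have "exp y * (t\<^sup>2 * r) \<le> 2 * (4 * X)" by (intro sums_le[OF bnd])
  then show ?thesis by (simp add: y_def X_def)
qed

text \<open>From 1 + t <= (1 + s) (1 + (t - s)) and 1 + x <= exp x, raised to the power 3/2; the
  exponent becomes the rate \<open>\<mu>\<close> in the weighted Gronwall inequality.\<close>

lemma decay_weight_submult:
  assumes "0 \<le> s" "s \<le> t"
  shows "(1 + t) * sqrt (1 + t) \<le> (1 + s) * sqrt (1 + s) * exp (3 / 2 * (t - s))"
proof -
  have "1 + t \<le> (1 + s) * (1 + (t - s))" using assms by (simp add: algebra_simps mult_left_mono)
  also have "\<dots> \<le> (1 + s) * exp (t - s)" using assms by (intro mult_left_mono exp_ge_add_one_self) auto
  finally have le: "1 + t \<le> (1 + s) * exp (t - s)" .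
  then have "sqrt (1 + t) \<le> sqrt ((1 + s) * exp (t - s))" by simp
  also have "\<dots> = sqrt (1 + s) * exp ((t - s) / 2)" 
    unfolding real_sqrt_mult by (intro arg_cong[where f = "(*) (sqrt (1 + s))"] real_sqrt_unique)
      (simp_all add: power2_eq_square mult_exp_exp)
  finally have "(1 + t) * sqrt (1 + t) \<le> ((1 + s) * exp (t - s)) * (sqrt (1 + s) * exp ((t - s) / 2))"
    using le assms by (intro mult_mono) auto
  also have "\<dots> = (1 + s) * sqrt (1 + s) * (exp (t - s) * exp ((t - s) / 2))" by simp
  also have "exp (t - s) * exp ((t - s) / 2) = exp (3 / 2 * (t - s))" by (simp add: mult_exp_exp field_simps)
  finally show ?thesis .
qed

lemma decay_weight_le:
  assumes "t \<ge> 1"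
  shows "(1 + t) * sqrt (1 + t) \<le> 4 * (t * sqrt t)"
proof -
  have "sqrt (1 + t) \<le> sqrt (4 * t)" using assms by simp
  then have "sqrt (1 + t) \<le> 2 * sqrt t" by (simp add: real_sqrt_mult)
  then have "(1 + t) * sqrt (1 + t) \<le> (2 * t) * (2 * sqrt t)" using assms by (intro mult_mono) auto
  then show ?thesis by simp
qed

lemma decay_weight_le_4:
  assumes "0 \<le> t" "t \<le> 1"
  shows "(1 + t) * sqrt (1 + t) \<le> 4"
proof -
  have "sqrt (1 + t) \<le> 2" using assms by (intro real_le_lsqrt) auto
  then have "(1 + t) * sqrt (1 + t) \<le> 2 * 2" using assms by (intro mult_mono) auto
  then show ?thesis by simp
qed

section \<open>Lowering the growth rate, and decay\<close>

context charge_problem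
begin

text \<open>With C = \<open>norm \<gamma> * csum\<close>, every weight of rate \<mu> <= 3/2 leaves
  damping - \<mu> >= 4 pi C^2 + 1, so the Gronwall condition C sqrt (pi / (damping - \<mu>)) <= 1/2
  holds for the exponential weights and for (1 + t)^(3/2) alike.\<close>

definition "damping = 4 * pi * (norm \<gamma> * csum)\<^sup>2 + 5 / 2"

lemma damping_ge: "damping \<ge> 5 / 2"
  by (simp add: damping_def)

lemma damping_small:
  assumes "\<mu> \<le> 3 / 2"
  shows "norm \<gamma> * csum * sqrt (pi / (damping - \<mu>)) \<le> 1 / 2"
proof -
  define C where "C = norm \<gamma> * csum"
  have C0: "0 \<le> C" using csum_nonneg by (simp add: C_def)
  have "0 \<le> 4 * pi * C\<^sup>2" by simp
  then have d: "0 < damping - \<mu>" "4 * pi * C\<^sup>2 \<le> damping - \<mu>" 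
    using assms unfolding damping_def C_def[symmetric] by linarith+
  have "C\<^sup>2 * pi / (damping - \<mu>) \<le> (1/2)\<^sup>2" using d by (simp add: divide_le_eq power2_eq_square mult_ac)
  then have "sqrt (C\<^sup>2 * (pi / (damping - \<mu>))) \<le> sqrt ((1/2)\<^sup>2)" by (intro real_sqrt_le_mono) simp
  then have "sqrt (C\<^sup>2 * (pi / (damping - \<mu>))) \<le> 1/2"
    by (simp only: real_sqrt_abs abs_of_nonneg zero_le_divide_1_iff zero_le_numeral)
  moreover have "sqrt (C\<^sup>2 * (pi / (damping - \<mu>))) = C * sqrt (pi / (damping - \<mu>))"
    using C0 by (simp only: real_sqrt_mult real_sqrt_abs abs_of_nonneg)
  ultimately show ?thesis by (simp add: C_def)
qed

lemma norm_q_le_rest: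
  assumes t: "t > 0" and \<Lambda>: "\<Lambda> \<ge> 0"
  shows "norm (q t) \<le> (norm (rest \<Lambda> t) + norm \<gamma> * norm \<kappa> * norm (half_conv (abel_kernel \<Lambda>) (bound_state_datum E) t))
    + norm \<gamma> * csum * (LBINT s:{0<..<t}. exp (- (\<Lambda> * (t - s))) / sqrt (t - s) * norm (q s))"
proof -
  let ?a = "half_conv (abel_kernel \<Lambda>) (bound_state_datum E) t"
  let ?b = "half_conv (abel_kernel \<Lambda>) (\<lambda>s. of_real (\<alpha> s) * q s) t"
  have "q t = rest \<Lambda> t + (\<gamma> * \<kappa> * ?a - \<gamma> * ?b)"
    using rest_eq[OF t \<Lambda>] half_conv_source[OF t \<Lambda>] by (simp add: algebra_simps)
  then have "norm (q t) \<le> norm (rest \<Lambda> t) + norm (\<gamma> * \<kappa> * ?a - \<gamma> * ?b)"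
    using norm_triangle_ineq by metis
  moreover have "norm (\<gamma> * \<kappa> * ?a - \<gamma> * ?b) \<le> norm (\<gamma> * \<kappa> * ?a) + norm (\<gamma> * ?b)" by (rule norm_triangle_ineq4)
  moreover have "norm (\<gamma> * \<kappa> * ?a) = norm \<gamma> * norm \<kappa> * norm ?a" by (simp only: norm_mult)
  moreover have "norm (\<gamma> * ?b) \<le> norm \<gamma> * (csum * (LBINT s:{0<..<t}. exp (- (\<Lambda> * (t - s))) / sqrt (t - s) * norm (q s)))"
    unfolding norm_mult by (intro mult_left_mono norm_conv_\<alpha>q_le t \<Lambda>) simp
  ultimately show ?thesis unfolding mult.assoc by linarith
qed

text \<open>The factorial moment bounds hold with the same \<open>K\<close> at every \<open>\<sigma>\<close> slightly above the rate \<open>s0\<close>,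
  so their sum gains a factor \<open>exp (- \<sigma> t / (4 K))\<close> that overcompensates \<open>\<sigma> - s0\<close>.\<close>

lemma growth_improve:
  assumes s0: "s0 > 0" and g: "\<And>s. s > s0 \<Longrightarrow> growth s"
  shows "\<exists>s>0. s < s0 \<and> growth s"
proof -
  have \<Lambda>: "damping \<ge> 1" "damping \<ge> 0" "damping > 0" using damping_ge by linarith+
  obtain C K where C0: "C \<ge> 0" and K2: "K \<ge> 2" and CK: "\<And>s \<sigma> m t. growth s \<Longrightarrow> 0 \<le> s \<Longrightarrow> s < \<sigma> \<Longrightarrow> \<sigma> \<le> 2 * s0 \<Longrightarrow> t > 0 \<Longrightarrow>
    t ^ (m + 2) / fact (m + 2) * norm (rest damping t) \<le> C * K ^ (m + 2) / (\<sigma> ^ m * sqrt \<sigma>) * exp (\<sigma> * t)"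
    using rest_pointwise[OF \<Lambda>(1), of "2 * s0"] by blast
  \<comment> \<open>Then \<sigma> / (4 K) = 2 x \<sigma>, so starting from \<sigma> = s0 (1 + x) the
    rate drops to s0 (1 + x) (1 - 2 x), which is at most s0 (1 - x) < s0.\<close>
  define x where "x = 1 / (8 * K)"
  have x: "0 < x" "x < 1" using K2 by (auto simp: x_def)
  define \<sigma> where "\<sigma> = s0 * (1 + x)"
  \<comment> \<open>A rate strictly between \<open>s0\<close> and \<open>\<sigma>\<close>: growth is
    known only above \<open>s0\<close>, and the moment bounds need \<sigma> strictly above the
    rate.\<close>
  define s where "s = s0 * (1 + x / 2)"
  define s' where "s' = s0 * (1 - x)"
  have \<sigma>: "0 < \<sigma>" "s < \<sigma>" "\<sigma> \<le> 2 * s0" using s0 x by (auto simp: \<sigma>_def s_def)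
  have s: "s0 < s" "0 \<le> s" using s0 x by (auto simp: s_def)
  have s': "0 < s'" "s' < s0" using s0 x by (auto simp: s'_def)
  obtain C1 where C1: "\<And>t. t > 0 \<Longrightarrow> norm (rest damping t) \<le> C1 * exp (s * t)"
    using rest_growth[OF g[OF s(1)] s(2) \<Lambda>(3)] by blast
  define D where "D = 8 * C * K\<^sup>2 / sqrt \<sigma>"
  have D0: "0 \<le> D" using C0 \<sigma> by (simp add: D_def)
  define D1 where "D1 = \<bar>C1\<bar> * exp s"
  have D10: "0 \<le> D1" by (simp add: D1_def)
  have rest: "exp (- (s' * t)) * norm (rest damping t) \<le> D + D1" if t: "t > 0" for t
  proof (cases "t \<ge> 1")
    case True
    have "exp (\<sigma> * t / (4 * K)) * (t\<^sup>2 * norm (rest damping t)) \<le> 8 * C * K\<^sup>2 / sqrt \<sigma> * exp (\<sigma> * t)"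
      by (rule exp_gain_from_factorial_moments[OF CK[OF g[OF s(1)] s(2) \<sigma>(2,3) t]]) (use \<sigma> K2 C0 t in auto)
    then have "exp (- (\<sigma> * t / (4 * K))) * (exp (\<sigma> * t / (4 * K)) * (t\<^sup>2 * norm (rest damping t)))
        \<le> exp (- (\<sigma> * t / (4 * K))) * (D * exp (\<sigma> * t))"
      unfolding D_def by (intro mult_left_mono) auto
    moreover have "exp (- (\<sigma> * t / (4 * K))) * (exp (\<sigma> * t / (4 * K)) * (t\<^sup>2 * norm (rest damping t))) = t\<^sup>2 * norm (rest damping t)"
      by (simp only: mult.assoc[symmetric] mult_exp_exp) simp
    moreover have "exp (- (\<sigma> * t / (4 * K))) * (D * exp (\<sigma> * t)) = D * exp (- (\<sigma> * t / (4 * K)) + \<sigma> * t)"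
      by (simp only: exp_add mult_ac)
    ultimately have "t\<^sup>2 * norm (rest damping t) \<le> D * exp (- (\<sigma> * t / (4 * K)) + \<sigma> * t)" by linarith
    also have "\<dots> \<le> D * exp (s' * t)"
    proof (intro mult_left_mono D0)
      have "- (\<sigma> * t / (4 * K)) + \<sigma> * t = s0 * t * ((1 + x) * (1 - 2 * x))"
        using K2 by (simp add: \<sigma>_def x_def field_simps)
      also have "\<dots> \<le> s0 * t * (1 - x)"
        using s0 t by (intro mult_left_mono) (auto simp: algebra_simps)
      finally show "exp (- (\<sigma> * t / (4 * K)) + \<sigma> * t) \<le> exp (s' * t)" by (simp add: s'_def mult_ac)
    qed
    finally have t2: "t\<^sup>2 * norm (rest damping t) \<le> D * exp (s' * t)" .
    have "1 * norm (rest damping t) \<le> t\<^sup>2 * norm (rest damping t)"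
      using True by (intro mult_right_mono) auto
    with t2 have "norm (rest damping t) \<le> D * exp (s' * t)" by linarith
    then have "exp (- (s' * t)) * norm (rest damping t) \<le> exp (- (s' * t)) * (D * exp (s' * t))" by (intro mult_left_mono) auto
    also have "\<dots> = D" by (simp add: exp_minus)
    finally show ?thesis using D10 by simp
  next
    case False
    have "C1 * exp (s * t) \<le> \<bar>C1\<bar> * exp (s * 1)"
      using False mult_left_mono[of t 1 s] s by (intro mult_mono) auto
    with C1[OF t] have "norm (rest damping t) \<le> D1" by (simp add: D1_def)
    moreover have "exp (- (s' * t)) * norm (rest damping t) \<le> norm (rest damping t)"
      using s' t by (intro mult_left_le_one_le) auto
    ultimately show ?thesis using D0 by linarith
  qed
  \<comment> \<open>The damped convolution of the datum is bounded in time, hence harmless against a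
    weight that decays.\<close>
  define N where "N = norm \<gamma> * norm \<kappa> * (6 * sqrt pi)"
  have bd: "exp (- (s' * t)) * norm (q t) \<le> 2 * (D + D1 + N)" if t: "t > 0" for t
  proof (rule weighted_abel_gronwall[OF q_cont q_bdd, where v = "\<lambda>t. exp (- (s' * t))" and \<Lambda> = damping and \<mu> = "- s'"
        and c = "norm \<gamma> * csum" and a = "\<lambda>t. norm (rest damping t) + norm \<gamma> * norm \<kappa> * norm (half_conv (abel_kernel damping) (bound_state_datum E) t)"])
    fix t :: real assume t: "t > 0"
    show "norm (q t) \<le> (norm (rest damping t) + norm \<gamma> * norm \<kappa> * norm (half_conv (abel_kernel damping) (bound_state_datum E) t))
        + norm \<gamma> * csum * (LBINT s:{0<..<t}. exp (- (damping * (t - s))) / sqrt (t - s) * norm (q s))"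
      by (rule norm_q_le_rest[OF t \<Lambda>(2)])
    have "norm \<gamma> * norm \<kappa> * norm (half_conv (abel_kernel damping) (bound_state_datum E) t) \<le> N"
      unfolding N_def by (intro mult_left_mono norm_conv_datum_le t \<Lambda>(2)) auto
    moreover have "exp (- (s' * t)) * (norm \<gamma> * norm \<kappa> * norm (half_conv (abel_kernel damping) (bound_state_datum E) t))
        \<le> norm \<gamma> * norm \<kappa> * norm (half_conv (abel_kernel damping) (bound_state_datum E) t)"
      using s' t by (intro mult_left_le_one_le) auto
    ultimately show "exp (- (s' * t)) * (norm (rest damping t) + norm \<gamma> * norm \<kappa> * norm (half_conv (abel_kernel damping) (bound_state_datum E) t)) \<le> D + D1 + N"
      using rest[OF t] unfolding distrib_left by linarith
  next
    show "norm \<gamma> * csum * sqrt (pi / (damping - - s')) \<le> 1 / 2" using s' by (intro damping_small) auto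
    show "- s' < damping" using s' \<Lambda> by linarith
    show "0 \<le> norm \<gamma> * csum" using csum_nonneg by simp
    show "exp (- (s' * t)) \<le> exp (- (s' * s)) * exp (- s' * (t - s))" for s t
      by (simp add: mult_exp_exp algebra_simps)
  qed (use t in \<open>auto intro!: continuous_intros\<close>)
  have "norm (q t) \<le> 2 * (D + D1 + N) * exp (s' * t)" if t: "t > 0" for t
  proof -
    have "exp (s' * t) * (exp (- (s' * t)) * norm (q t)) \<le> exp (s' * t) * (2 * (D + D1 + N))"
      by (intro mult_left_mono bd t) auto
    moreover have "exp (s' * t) * (exp (- (s' * t)) * norm (q t)) = norm (q t)"
      by (simp only: mult.assoc[symmetric] mult_exp_exp) simp
    ultimately show ?thesis by (simp only: mult_ac)
  qed
  then have "growth s'" unfolding growth_def by blast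
  with s' show ?thesis by blast
qed

text \<open>Every rate above the infimum of the positive admissible rates is admissible, so a
  positive infimum could be improved by \<open>growth_improve\<close>.\<close>

lemma growth_all:
  assumes s: "s > 0"
  shows "growth s"
proof (rule ccontr)
  assume ng: "\<not> growth s"
  define S where "S = {s. s > 0 \<and> growth s}"
  have ne: "S \<noteq> {}" using initial_growth by (auto simp: S_def)
  have bdd: "bdd_below S" by (rule bdd_belowI[of _ 0]) (auto simp: S_def)
  have "s \<le> y" if "y \<in> S" for y using growth_mono[of y s] that ng by (force simp: S_def)
  then have "s \<le> Inf S" by (intro cInf_greatest ne) auto
  then have i0: "Inf S > 0" using s by linarith
  have "growth y" if "y > Inf S" for y
  proof -
    obtain x where "x \<in> S" "x < y" using cInf_lessD[OF ne \<open>y > Inf S\<close>] by blast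
    then show ?thesis using growth_mono[of x y] by (simp add: S_def)
  qed
  from growth_improve[OF i0 this] obtain y where "0 < y" "y < Inf S" "growth y" by blast
  then show False using cInf_lower[OF _ bdd, of y] by (simp add: S_def)
qed

text \<open>The second moment at \<sigma> = 1 / t keeps exp (\<sigma> t) bounded and turns
  \<sigma>^(-1/2) into sqrt t, so t^2 times the rest is of order sqrt t. Now that every positive
  rate is admissible, so is 1 / (2 t), below \<sigma>, with constants independent of t.\<close>

lemma rest_decay: "\<exists>C. \<forall>t>0. (1 + t) * sqrt (1 + t) * norm (rest damping t) \<le> C"
proof -
  have \<Lambda>: "damping \<ge> 1" "damping > 0" using damping_ge by linarith+
  obtain C K where C0: "C \<ge> 0" and K2: "K \<ge> 2" and CK: "\<And>s \<sigma> m t. growth s \<Longrightarrow> 0 \<le> s \<Longrightarrow> s < \<sigma> \<Longrightarrow> \<sigma> \<le> 1 \<Longrightarrow> t > 0 \<Longrightarrow>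
    t ^ (m + 2) / fact (m + 2) * norm (rest damping t) \<le> C * K ^ (m + 2) / (\<sigma> ^ m * sqrt \<sigma>) * exp (\<sigma> * t)"
    using rest_pointwise[OF \<Lambda>(1), of 1] by blast
  obtain C1 where C1: "\<And>t. t > 0 \<Longrightarrow> norm (rest damping t) \<le> C1 * exp (1 * t)"
    using rest_growth[OF growth_all[of 1] _ \<Lambda>(2)] by auto
  define D where "D = 2 * C * K\<^sup>2 * exp 1"
  define D1 where "D1 = \<bar>C1\<bar> * exp 1"
  have D0: "0 \<le> D" "0 \<le> D1" using C0 by (auto simp: D_def D1_def)
  have "(1 + t) * sqrt (1 + t) * norm (rest damping t) \<le> 4 * D + 4 * D1" if t: "t > 0" for t
  proof (cases "t \<ge> 1")
    case True
    have "t ^ (0 + 2) / fact (0 + 2) * norm (rest damping t) \<le> C * K ^ (0 + 2) / ((1 / t) ^ 0 * sqrt (1 / t)) * exp (1 / t * t)"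
      using True t by (intro CK[OF growth_all[of "1 / (2 * t)"]]) (auto simp: divide_simps)
    then have "t\<^sup>2 / 2 * norm (rest damping t) \<le> C * K\<^sup>2 * sqrt t * exp 1"
      using t by (simp add: real_sqrt_divide power2_eq_square)
    then have "t\<^sup>2 * norm (rest damping t) \<le> D * sqrt t" by (simp add: D_def mult_ac)
    moreover have "t\<^sup>2 = t * sqrt t * sqrt t" using t by (simp add: power2_eq_square mult.assoc)
    ultimately have "(t * sqrt t * norm (rest damping t)) * sqrt t \<le> D * sqrt t" by (simp only: mult_ac)
    then have "t * sqrt t * norm (rest damping t) \<le> D" by (rule mult_right_le_imp_le) (use t in simp)
    moreover have "(1 + t) * sqrt (1 + t) * norm (rest damping t) \<le> 4 * (t * sqrt t) * norm (rest damping t)"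
      using decay_weight_le[OF True] by (intro mult_right_mono) auto
    ultimately show ?thesis using D0 by linarith
  next
    case False
    have "C1 * exp (1 * t) \<le> \<bar>C1\<bar> * exp 1" using False by (intro mult_mono) auto
    with C1[OF t] have "norm (rest damping t) \<le> D1" by (simp add: D1_def)
    then have "(1 + t) * sqrt (1 + t) * norm (rest damping t) \<le> 4 * D1"
      using False t decay_weight_le_4[of t] by (intro mult_mono) auto
    then show ?thesis using D0 by linarith
  qed
  then show ?thesis by blast
qed

text \<open>The datum itself decays like s^(-3/2). The weight is carried from t to s under the
  integral at the price exp (3/2 (t - s)), which the damping pays.\<close>

lemma conv_datum_decay:
  "\<exists>C. \<forall>t>0. (1 + t) * sqrt (1 + t) * norm (half_conv (abel_kernel damping) (bound_state_datum E) t) \<le> C"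
proof -
  have \<Lambda>: "damping \<ge> 0" "damping - 3 / 2 > 0" using damping_ge by linarith+
  define D where "D = 4 * sqrt pi + 4 * Gamma (3 / 2) / E"
  have D0: "0 \<le> D" using E Gamma_real_nonneg[of "3 / 2"] by (simp add: D_def)
  have dat: "(1 + s) * sqrt (1 + s) * norm (bound_state_datum E s) \<le> D * (1 + 1 / sqrt s)" if s: "s > 0" for s
  proof (cases "s \<ge> 1")
    case True
    have "s powr (- 3 / 2) = 1 / (s * sqrt s)"
      using s powr_minus_divide[of s "3 / 2"] powr_add[of s 1 "1 / 2"] by (simp add: powr_half_sqrt)
    then have "norm (bound_state_datum E s) \<le> Gamma (3 / 2) / E * (1 / (s * sqrt s))"
      using norm_bound_state_datum_le(1)[OF E s] by simp
    then have "(1 + s) * sqrt (1 + s) * norm (bound_state_datum E s) \<le> 4 * (s * sqrt s) * (Gamma (3 / 2) / E * (1 / (s * sqrt s)))"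
      
      by (rule mult_mono[OF decay_weight_le[OF True]]) (use s in auto)
    also have "\<dots> = 4 * Gamma (3 / 2) / E" using s by simp
    also have "\<dots> \<le> D" by (simp add: D_def)
    also have "\<dots> \<le> D * (1 + 1 / sqrt s)" using D0 s mult_left_mono[of 1 "1 + 1 / sqrt s" D] by simp
    finally show ?thesis .
  next
    case False
    have "(1 + s) * sqrt (1 + s) * norm (bound_state_datum E s) \<le> 4 * (sqrt pi / sqrt s)"
      using False s decay_weight_le_4[of s] norm_datum_le[OF s] by (intro mult_mono) auto
    also have "\<dots> = 4 * sqrt pi * (1 / sqrt s)" by simp
    also have "\<dots> \<le> D * (1 + 1 / sqrt s)"
      using D0 s E Gamma_real_nonneg[of "3 / 2"] by (intro mult_mono) (auto simp: D_def)
    finally show ?thesis .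
  qed
  have "(1 + t) * sqrt (1 + t) * norm (half_conv (abel_kernel damping) (bound_state_datum E) t)
      \<le> D * (sqrt (pi / (damping - 3 / 2)) + 6)" if t: "t > 0" for t
  proof -
    define v where "v = (1 + t) * sqrt (1 + t)"
    have v0: "v > 0" using t by (simp add: v_def)
    \<comment> \<open>The bounded part of the weighted datum meets the kernel with the remaining
      damping; its singularity at s = 0 meets the kernel singularity in the arcsine
      integral.\<close>
    define f where "f s = exp (- ((damping - 3 / 2) * (t - s))) / sqrt (t - s) + 1 / (sqrt (t - s) * sqrt s)" for s
    have fi: "set_integrable lborel {0<..<t} f"
      unfolding f_def by (intro set_integral_add set_integral_abel_exp_le(1) set_integral_arcsine(1) t \<Lambda>)
    have fI: "(LBINT s:{0<..<t}. f s) \<le> sqrt (pi / (damping - 3 / 2)) + 6"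
      unfolding f_def
      by (subst set_integral_add(2)[OF set_integral_abel_exp_le(1) set_integral_arcsine(1)])
        (use t \<Lambda> set_integral_abel_exp_le(2)[OF t \<Lambda>(2)] set_integral_arcsine(2)[OF t] in auto)
    have "norm (half_conv (abel_kernel damping) (bound_state_datum E) t) \<le> (LBINT s:{0<..<t}. D / v * f s)"
    proof (rule norm_half_conv_abel_le[OF integrable_conv_datum[OF t \<Lambda>(1)] set_integrable_mult_right[OF fi]])
      fix s assume s: "0 < s" "s < t"
      define k where "k = exp (- ((damping - 3 / 2) * (t - s)))"
      have k: "0 < k" "k \<le> 1" using s \<Lambda> by (auto simp: k_def)
      have "v * norm (bound_state_datum E s) \<le> ((1 + s) * sqrt (1 + s) * exp (3 / 2 * (t - s))) * norm (bound_state_datum E s)"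
        unfolding v_def using s by (intro mult_right_mono decay_weight_submult) auto
      also have "\<dots> = exp (3 / 2 * (t - s)) * ((1 + s) * sqrt (1 + s) * norm (bound_state_datum E s))" by (simp only: mult_ac)
      also have "\<dots> \<le> exp (3 / 2 * (t - s)) * (D * (1 + 1 / sqrt s))" by (intro mult_left_mono dat s) auto
      finally have "exp (- (damping * (t - s))) * (v * norm (bound_state_datum E s))
          \<le> exp (- (damping * (t - s))) * (exp (3 / 2 * (t - s)) * (D * (1 + 1 / sqrt s)))"
        by (intro mult_left_mono) auto
      also have "\<dots> = k * (D * (1 + 1 / sqrt s))"
        by (simp only: mult.assoc[symmetric] mult_exp_exp k_def) (simp add: algebra_simps)
      also have "\<dots> = D * (k + k * (1 / sqrt s))" by (simp add: algebra_simps)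
      also have "\<dots> \<le> D * (k + 1 * (1 / sqrt s))"
        using k s by (intro mult_left_mono D0 add_left_mono mult_right_mono) auto
      finally have "1 / (v * sqrt (t - s)) * (exp (- (damping * (t - s))) * (v * norm (bound_state_datum E s)))
          \<le> 1 / (v * sqrt (t - s)) * (D * (k + 1 * (1 / sqrt s)))"
        using s v0 by (intro mult_left_mono) auto
      moreover have "1 / (v * sqrt (t - s)) * (exp (- (damping * (t - s))) * (v * norm (bound_state_datum E s)))
          = exp (- (damping * (t - s))) / sqrt (t - s) * norm (bound_state_datum E s)" using v0 by simp
      moreover have "1 / (v * sqrt (t - s)) * (D * (k + 1 * (1 / sqrt s))) = D / v * f s"
        by (simp add: f_def k_def distrib_left add_divide_distrib mult_ac)
      ultimately show "exp (- (damping * (t - s))) / sqrt (t - s) * norm (bound_state_datum E s) \<le> D / v * f s" by linarith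
    qed
    also have "\<dots> = D / v * (LBINT s:{0<..<t}. f s)" by (rule set_integral_mult_right)
    also have "\<dots> \<le> D / v * (sqrt (pi / (damping - 3 / 2)) + 6)" using D0 v0 by (intro mult_left_mono fI) auto
    finally have "v * norm (half_conv (abel_kernel damping) (bound_state_datum E) t) \<le> v * (D / v * (sqrt (pi / (damping - 3 / 2)) + 6))"
      using v0 by (intro mult_left_mono) auto
    then show ?thesis using v0 by (simp add: v_def[symmetric])
  qed
  then show ?thesis by blast
qed

text \<open>Rest and datum convolution carry the weight (1 + t)^(3/2); the last Gronwall argument
  passes it on to the charge.\<close>

theorem charge_decay: "\<exists>A. \<forall>t>0. (1 + t) * sqrt (1 + t) * norm (q t) \<le> A"
proof -
  have \<Lambda>: "damping \<ge> 0" "3 / 2 < damping" using damping_ge by linarith+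
  obtain C1 where C1: "\<And>t. t > 0 \<Longrightarrow> (1 + t) * sqrt (1 + t) * norm (rest damping t) \<le> C1"
    using rest_decay by blast
  obtain C2 where C2: "\<And>t. t > 0 \<Longrightarrow> (1 + t) * sqrt (1 + t) * norm (half_conv (abel_kernel damping) (bound_state_datum E) t) \<le> C2"
    using conv_datum_decay by blast
  have "(1 + t) * sqrt (1 + t) * norm (q t) \<le> 2 * (C1 + norm \<gamma> * norm \<kappa> * C2)" if t: "t > 0" for t
  proof (rule weighted_abel_gronwall[OF q_cont q_bdd, where v = "\<lambda>t. (1 + t) * sqrt (1 + t)" and \<Lambda> = damping and \<mu> = "3 / 2"
        and c = "norm \<gamma> * csum" and a = "\<lambda>t. norm (rest damping t) + norm \<gamma> * norm \<kappa> * norm (half_conv (abel_kernel damping) (bound_state_datum E) t)"])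
    fix t :: real assume t: "t > 0"
    show "norm (q t) \<le> (norm (rest damping t) + norm \<gamma> * norm \<kappa> * norm (half_conv (abel_kernel damping) (bound_state_datum E) t))
        + norm \<gamma> * csum * (LBINT s:{0<..<t}. exp (- (damping * (t - s))) / sqrt (t - s) * norm (q s))"
      by (rule norm_q_le_rest[OF t \<Lambda>(1)])
    have "norm \<gamma> * norm \<kappa> * ((1 + t) * sqrt (1 + t) * norm (half_conv (abel_kernel damping) (bound_state_datum E) t))
        \<le> norm \<gamma> * norm \<kappa> * C2" by (intro mult_left_mono C2 t) auto
    then show "(1 + t) * sqrt (1 + t) * (norm (rest damping t) + norm \<gamma> * norm \<kappa> * norm (half_conv (abel_kernel damping) (bound_state_datum E) t))
        \<le> C1 + norm \<gamma> * norm \<kappa> * C2"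
      using C1[OF t] by (simp only: distrib_left mult_ac)
  next
    show "norm \<gamma> * csum * sqrt (pi / (damping - 3 / 2)) \<le> 1 / 2" by (intro damping_small) auto
    show "0 \<le> norm \<gamma> * csum" using csum_nonneg by simp
    show "(1 + t) * sqrt (1 + t) \<le> (1 + s) * sqrt (1 + s) * exp (3 / 2 * (t - s))" if "0 < s" "s < t" for s t
      using that by (intro decay_weight_submult) auto
  qed (use t \<Lambda> in \<open>auto intro!: continuous_intros\<close>)
  then show ?thesis by blast
qed

end

text \<open>The charge equation uses gauge integrals over the closed interval. Absolute
  integrability on the open interval identifies them with Lebesgue integrals. The endpoints do not
  count, so \<open>f\<close> and \<open>g\<close> may differ there, as the datum and its formula may
  at time 0.\<close>

lemma integral_abel_eq_half_conv:
  fixes f g :: "real \<Rightarrow> complex"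
  assumes int: "set_integrable lborel {0<..<t} (\<lambda>s. abel_kernel 0 (t - s) * g s)"
    and eq: "\<And>s. 0 < s \<Longrightarrow> s < t \<Longrightarrow> f s = g s"
  shows "integral {0..t} (\<lambda>s. f s / of_real (sqrt (t - s))) = half_conv (abel_kernel 0) g t"
proof -
  have "integral {0..t} (\<lambda>s. f s / of_real (sqrt (t - s))) = integral {0<..<t} (\<lambda>s. abel_kernel 0 (t - s) * g s)"
    unfolding integral_open_interval_real
    by (intro Henstock_Kurzweil_Integration.integral_cong) (simp add: eq abel_kernel_def)
  also have "\<dots> = half_conv (abel_kernel 0) g t"
    unfolding half_conv_def by (rule set_borel_integral_eq_integral(2)[OF int, symmetric])
  finally show ?thesis .
qed

lemma infsum_eq_integral_count_space:
  fixes f :: "'a \<Rightarrow> complex"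
  assumes "integrable (count_space UNIV) f"
  shows "infsum f UNIV = (LINT k|count_space UNIV. f k)"
  using infsetsum_infsum[of f UNIV] assms by (simp add: infsetsum_def Infinite_Set_Sum.abs_summable_on_def)

theorem mainTheorem14:
  fixes \<alpha> :: "real \<Rightarrow> real" and T :: real and c :: "int \<Rightarrow> complex"
    and q :: "real \<Rightarrow> complex"
  assumes "standing_assumptions \<alpha> T c"
    and "c 0 = 0"
    and "generic c"
    and "continuous_on {0<..} q"
    and "bounded (q ` {0<..1})"
    and "charge_eq \<alpha> (\<lambda>\<tau>. U0_at_origin \<tau> (phi_ev (\<alpha> 0))) q"
  shows "\<exists>A::real. \<exists>C::real. \<exists>B::real. \<exists>R::real \<Rightarrow> real. C > 0 \<and> B > 0 \<and>
           (\<forall>\<^sub>F t in at_top. norm (q t) \<le> A * t powr (-3/2) + R t) \<and>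
           R \<sim>[at_top] (\<lambda>t. C * exp (- B * t))"
proof -
  have T: "T > 0" and cont: "continuous_on UNIV \<alpha>" and sum: "(\<lambda>n. norm (c n)) summable_on UNIV"
    and herm: "\<And>n. c n = cnj (c (- n))"
    and ser: "\<And>t. complex_of_real (\<alpha> t) =
          infsum (\<lambda>n. c n * exp (- \<i> * of_int n * complex_of_real (2 * pi / T) * complex_of_real t)) UNIV"
    and neg: "\<alpha> 0 < 0"
    using assms(1) unfolding standing_assumptions_def by blast+
  define w where "w = 2 * pi / T"
  define E where "E = (4 * pi * \<bar>\<alpha> 0\<bar>)\<^sup>2"
  have w: "w > 0" using T by (simp add: w_def)
  have E: "E > 0" using neg by (simp add: E_def)
  obtain \<kappa> where \<kappa>: "\<And>\<tau>. \<tau> > 0 \<Longrightarrow> U0_at_origin \<tau> (phi_ev (\<alpha> 0)) = \<kappa> * bound_state_datum E \<tau>"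
    using U0_at_origin_phi_ev_eq_datum[OF neg] unfolding E_def by blast
  have ci: "integrable (count_space UNIV) c"
    using sum abs_summable_equivalent[of c UNIV] by (simp add: Infinite_Set_Sum.abs_summable_on_def)
  have \<alpha>: "of_real (\<alpha> t) = (LINT k|count_space UNIV. c k * exp (- (\<i> * of_real (of_int k * w) * of_real t)))" for t
  proof -
    have e: "- \<i> * of_int k * complex_of_real (2 * pi / T) * complex_of_real t = - (\<i> * of_real (of_int k * w) * of_real t)" for k
      by (simp add: w_def)
    have "integrable (count_space UNIV) (\<lambda>k. c k * exp (- (\<i> * of_real (of_int k * w) * of_real t)))"
      by (rule Bochner_Integration.integrable_bound[OF ci]) (auto simp: norm_mult)
    then show ?thesis unfolding ser e by (rule infsum_eq_integral_count_space)
  qed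
  have q_eq: "q t = 4 * csqrt (of_real pi * \<i>) *
        half_conv (abel_kernel 0) (\<lambda>s. \<kappa> * bound_state_datum E s - of_real (\<alpha> s) * q s) t" if t: "t > 0" for t
  proof -
    have di: "set_integrable lborel {0<..<t} (\<lambda>s. abel_kernel 0 (t - s) * (\<kappa> * bound_state_datum E s))"
    proof (rule set_integrable_abel_conv[OF t order_refl])
      show "continuous_on {0<..} (\<lambda>s. \<kappa> * bound_state_datum E s)"
        by (intro continuous_intros continuous_on_bound_state_datum E)
      fix s :: real assume s: "0 < s" "s < t"
      have "norm (bound_state_datum E s) \<le> sqrt pi * (1 / sqrt s)"
        using norm_bound_state_datum_le(2)[OF E s(1)] by (simp only: inverse_sqrt_powr[OF s(1)])
      also have "\<dots> \<le> sqrt pi * (1 + 1 / sqrt s)" by (intro mult_left_mono) auto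
      finally show "norm (\<kappa> * bound_state_datum E s) \<le> norm \<kappa> * sqrt pi * (1 + 1 / sqrt s)"
        unfolding norm_mult mult.assoc by (rule mult_left_mono) simp
    qed
    obtain B where B: "\<And>s. 0 < s \<Longrightarrow> s \<le> t \<Longrightarrow> norm (q s) \<le> B"
      using bounded_initial_segment[OF assms(4,5)] by blast
    have "bounded (\<alpha> ` {0..t})"
      by (intro compact_imp_bounded compact_continuous_image continuous_on_subset[OF cont]) auto
    then obtain M where "\<forall>x\<in>\<alpha> ` {0..t}. norm x \<le> M"
      unfolding bounded_iff by (rule exE)
    then have M: "\<bar>\<alpha> s\<bar> \<le> M" if "0 \<le> s" "s \<le> t" for s using that by auto
    have qi: "set_integrable lborel {0<..<t} (\<lambda>s. abel_kernel 0 (t - s) * (of_real (\<alpha> s) * q s))"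
    proof (rule set_integrable_abel_conv[OF t order_refl])
      show "continuous_on {0<..} (\<lambda>s. of_real (\<alpha> s) * q s)"
        by (intro continuous_intros assms(4) continuous_on_subset[OF cont]) auto
      fix s :: real assume s: "0 < s" "s < t"
      have "norm (of_real (\<alpha> s) * q s) \<le> M * B"
        unfolding norm_mult using M[of s] B[of s] s by (intro mult_mono) auto
      moreover from this have "0 \<le> M * B" by (rule order_trans[OF norm_ge_zero])
      then have "M * B * 1 \<le> M * B * (1 + 1 / sqrt s)" using s by (intro mult_left_mono) auto
      ultimately show "norm (of_real (\<alpha> s) * q s) \<le> M * B * (1 + 1 / sqrt s)" by linarith
    qed
    have diff: "half_conv (abel_kernel 0) (\<lambda>s. \<kappa> * bound_state_datum E s - of_real (\<alpha> s) * q s) t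
        = half_conv (abel_kernel 0) (\<lambda>s. \<kappa> * bound_state_datum E s) t - half_conv (abel_kernel 0) (\<lambda>s. of_real (\<alpha> s) * q s) t"
      unfolding half_conv_def right_diff_distrib by (rule set_integral_diff(2)[OF di qi])
    have qI: "integral {0..t} (\<lambda>s. of_real (\<alpha> s) * q s / of_real (sqrt (t - s)))
        = half_conv (abel_kernel 0) (\<lambda>s. of_real (\<alpha> s) * q s) t"
      by (rule integral_abel_eq_half_conv[OF qi refl])
    have dI: "integral {0..t} (\<lambda>s. U0_at_origin s (phi_ev (\<alpha> 0)) / of_real (sqrt (t - s)))
        = half_conv (abel_kernel 0) (\<lambda>s. \<kappa> * bound_state_datum E s) t"
      by (rule integral_abel_eq_half_conv[OF di \<kappa>])
    have "q t + 4 * csqrt (of_real pi * \<i>) * half_conv (abel_kernel 0) (\<lambda>s. of_real (\<alpha> s) * q s) t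
        = 4 * csqrt (of_real pi * \<i>) * half_conv (abel_kernel 0) (\<lambda>s. \<kappa> * bound_state_datum E s) t"
      using assms(6)[unfolded charge_eq_def, rule_format, OF t] unfolding qI dI .
    then show ?thesis unfolding diff right_diff_distrib by (simp only: eq_diff_eq)
  qed
  interpret charge_problem \<alpha> w E c \<kappa> q
    by unfold_locales (fact w E ci herm assms(3) \<alpha> cont assms(4,5) q_eq)+
  obtain A where A: "\<And>t. t > 0 \<Longrightarrow> (1 + t) * sqrt (1 + t) * norm (q t) \<le> A" using charge_decay by blast
  have "norm (q t) \<le> A * t powr (-3/2) + exp (- t)" if t: "t > 0" for t
  proof -
    have "t * sqrt t * norm (q t) \<le> (1 + t) * sqrt (1 + t) * norm (q t)"
      using t by (intro mult_right_mono mult_mono) auto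
    then have "t * sqrt t * norm (q t) \<le> A" using A[OF t] by linarith
    then have "norm (q t) \<le> A * (1 / (t * sqrt t))" using t by (simp add: pos_le_divide_eq mult_ac)
    also have "1 / (t * sqrt t) = t powr (-3/2)"
      using t powr_minus_divide[of t "3 / 2"] powr_add[of t 1 "1 / 2"] by (simp add: powr_half_sqrt)
    finally show ?thesis by (simp add: add_increasing2)
  qed
  then have "\<forall>\<^sub>F t in at_top. norm (q t) \<le> A * t powr (-3/2) + exp (- t)"
    by (intro eventually_mono[OF eventually_gt_at_top[of 0]])
  then show ?thesis
    by (intro exI[of _ A] exI[of _ 1] exI[of _ "\<lambda>t. exp (- t)"]) simp
qed

end
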